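(* Let $(X_n)_{n\in\mathbb{N}}$ be a strictly stationary sequence with extremal index $\theta\in(0,1]$ and let $(u_r)_{r\in\mathbb{N}}$ be a (deterministic) sequence of thresholds such that $r\bar F(u_r)\to\tau\in(0,\infty)$ as $r\to\infty$. Let $(r_n)$ and $(l_n)$ be positive integer sequences such that, as $n\to\infty$, $$l_n=o(r_n),\qquad r_n=o(n),\qquad \sum_{l=l_n}^{n}\rho_{n,l}(u_{r_n})=o(r_n),\qquad \sum_{l=1}^{n}\rho_{n,l}(u_{r_n})=o(r_n^{1/2}).$$ Suppose there exist a positive integer sequence $(s_n)_{n\in\mathbb{N}}$ and a probability distribution $(\pi_j)_{j\in\mathbb{N}}$ on the positive integers such that, as $n\to\infty$, $$l_n=o(s_n),\qquad s_n=o(r_n),\qquad \rho_{n,l_n}(u_{r_n})=o(s_n/n),$$ $$\Pr\{N_{s_n}(u_{r_n})=j\mid M_{s_n}>u_{r_n}\}\to\pi_j\quad\text{for all }j\in\mathbb{N},$$ $$\mathrm{E}[N_{s_n}^2(u_{r_n})\mid M_{s_n}>u_{r_n}]\to\sum_{j=1}^{\infty}j^2\pi_j<\infty.$$ Suppose also that there exists a constant $p>1$ such that $\mathrm{E}[N_{r_n}^{2p}(u_{r_n})]=O(1)$ as $n\to\infty$. Write $k_n=\lfloor n/r_n\rfloor$. Then, as $n\to\infty$, $$\sqrt{k_n}\begin{pmatrix}\hat F^{\mathrm{dj}}_{n,r_n}(u_{r_n})-F_{r_n}(u_{r_n})\\ \hat F^{\mathrm{sl}}_{n,r_n}(u_{r_n})-F_{r_n}(u_{r_n})\\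 \hat\tau_{n,r_n}(u_{r_n})-\tau_{r_n}(u_{r_n})\end{pmatrix}\xrightarrow{d}N(\mathbf 0,\boldsymbol\Sigma)$$ where $\boldsymbol\Sigma=(\sigma_{ij})_{i,j=1}^3$ is symmetric and, writing $\alpha=\tau\theta$ and $m_2=\sum_{j\ge1}j^2\pi_j$, $$\sigma_{11}=e^{-\alpha}(1-e^{-\alpha}),\qquad \sigma_{22}=\sigma_{12}=2\alpha^{-1}e^{-\alpha}\bigl(1-(1+\alpha)e^{-\alpha}\bigr),$$ $$\sigma_{31}=\sigma_{32}=-\tau e^{-\alpha},\qquad \sigma_{33}=\alpha m_2 .$$
   Context: $(X_n)_{n\in\mathbb{N}}$, $\mathbb{N}=\{1,2,\dots\}$, is a strictly stationary sequence of real random variables with marginal distribution function $F$, and $\bar F=1-F$. $\xrightarrow{d}$ denotes convergence in distribution. Extremal index: the sequence has extremal index $\theta\in(0,1]$ if for each $\tau>0$ there exists a sequence of levels $(u_n(\tau))_{n\in\mathbb{N}}$ such that $\lim_{n\to\infty}n\bar F(u_n(\tau))=\tau$ and $\lim_{n\to\infty}\Pr(M_n\le u_n(\tau))=e^{-\theta\tau}$, where $M_n=\max\{X_1,\dots,X_n\}$. For a positive integer $r$ and a threshold $u$: $F_r(u)=\Pr(M_r\le u)$, $\tau_r(u)=r\bar F(u)$, $N_r(u)=\sum_{i=1}^{r}I(X_i>u)$. For integers $0\le s<r$, $M_{s,r}=\max_{s<i\le r}X_i$. For integers $1\le r\le n$, with $k=\lfloor n/r\rfloor$, $$\hat F^{\mathrm{dj}}_{n,r}(u)=\frac1k\sum_{i=1}^{k}I(M_{(i-1)r,ir}\le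 u),\quad \hat F^{\mathrm{sl}}_{n,r}(u)=\frac1{n-r+1}\sum_{i=0}^{n-r}I(M_{i,i+r}\le u),\quad \hat\tau_{n,r}(u)=\frac1k\sum_{i=1}^{rk}I(X_i>u).$$ Maximal correlation coefficients relative to the threshold $u$: $$\rho_{n,l}(u)=\max_{t=1,\dots,n-l}\ \sup\bigl\{|\operatorname{corr}(\xi,\eta)|:\ \xi\in L_2(\mathcal F_{1,t}(u)),\ \eta\in L_2(\mathcal F_{t+l,n}(u))\bigr\},$$ where $\mathcal F_{a,b}(u)$ is the $\sigma$-field generated by the events $\{X_i\le u\}$, $i\in\{a,\dots,b\}$, $L_2(\mathcal F)$ is the space of $\mathcal F$-measurable square-integrable random variables, and $\xi,\eta$ are required to have positive variance. A maximum or supremum over an empty set is $0$ (in particular $\rho_{n,n}(u)=0$). *)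

theory Defs
  imports "HOL-Probability.Probability" "HOL-Library.Landau_Symbols"
begin

text \<open>
  A sequence of random variables indexed by the positive integers is a function
  \<open>X :: nat \<Rightarrow> 'a \<Rightarrow> real\<close>; the value \<open>X 0\<close> is never referred to.
\<close>

definition strictly_stationary :: "'a measure \<Rightarrow> (nat \<Rightarrow> 'a \<Rightarrow> real) \<Rightarrow> bool" where
  "strictly_stationary M X \<longleftrightarrow>
     (\<forall>n h. distr M (\<Pi>\<^sub>M i\<in>{1..n}. borel) (\<lambda>\<omega>. \<lambda>i\<in>{1..n}. X (i + h) \<omega>) =
            distr M (\<Pi>\<^sub>M i\<in>{1..n}. borel) (\<lambda>\<omega>. \<lambda>i\<in>{1..n}. X i \<omega>))"

definition marginal_cdf :: "'a measure \<Rightarrow> (nat \<Rightarrow> 'a \<Rightarrow> real) \<Rightarrow> real \<Rightarrow> real" where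
  "marginal_cdf M X = cdf (distr M borel (X 1))"

definition tail :: "'a measure \<Rightarrow> (nat \<Rightarrow> 'a \<Rightarrow> real) \<Rightarrow> real \<Rightarrow> real" where
  "tail M X u = 1 - marginal_cdf M X u"

text \<open>Only meaningful for \<open>s < r\<close>, where the maximum is over a nonempty set.\<close>

definition block_max :: "(nat \<Rightarrow> 'a \<Rightarrow> real) \<Rightarrow> nat \<Rightarrow> nat \<Rightarrow> 'a \<Rightarrow> real" where
  "block_max X s r \<omega> = Max ((\<lambda>i. X i \<omega>) ` {s<..r})"

definition has_extremal_index :: "'a measure \<Rightarrow> (nat \<Rightarrow> 'a \<Rightarrow> real) \<Rightarrow> real \<Rightarrow> bool" where
  "has_extremal_index M X \<theta> \<longleftrightarrow>
     0 < \<theta> \<and> \<theta> \<le> 1 \<and>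
     (\<forall>\<tau>>0. \<exists>v :: nat \<Rightarrow> real.
        (\<lambda>n. real n * tail M X (v n)) \<longlonglongrightarrow> \<tau> \<and>
        (\<lambda>n. \<P>(\<omega> in M. block_max X 0 n \<omega> \<le> v n)) \<longlonglongrightarrow> exp (- \<theta> * \<tau>))"

definition F_block :: "'a measure \<Rightarrow> (nat \<Rightarrow> 'a \<Rightarrow> real) \<Rightarrow> nat \<Rightarrow> real \<Rightarrow> real" where
  "F_block M X r u = \<P>(\<omega> in M. block_max X 0 r \<omega> \<le> u)"

definition tau_block :: "'a measure \<Rightarrow> (nat \<Rightarrow> 'a \<Rightarrow> real) \<Rightarrow> nat \<Rightarrow> real \<Rightarrow> real" where
  "tau_block M X r u = real r * tail M X u"

definition N_exc :: "(nat \<Rightarrow> 'a \<Rightarrow> real) \<Rightarrow> nat \<Rightarrow> real \<Rightarrow> 'a \<Rightarrow> nat" where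
  "N_exc X r u \<omega> = (\<Sum>i = 1..r. of_bool (X i \<omega> > u))"

text \<open>The estimators are intended for \<open>1 \<le> r \<le> n\<close>.\<close>

definition F_dj :: "(nat \<Rightarrow> 'a \<Rightarrow> real) \<Rightarrow> nat \<Rightarrow> nat \<Rightarrow> real \<Rightarrow> 'a \<Rightarrow> real" where
  "F_dj X n r u \<omega> =
     (\<Sum>i = 1..n div r. of_bool (block_max X ((i - 1) * r) (i * r) \<omega> \<le> u)) / real (n div r)"

definition F_sl :: "(nat \<Rightarrow> 'a \<Rightarrow> real) \<Rightarrow> nat \<Rightarrow> nat \<Rightarrow> real \<Rightarrow> 'a \<Rightarrow> real" where
  "F_sl X n r u \<omega> =
     (\<Sum>i = 0..n - r. of_bool (block_max X i (i + r) \<omega> \<le> u)) / real (n - r + 1)"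

definition tau_hat :: "(nat \<Rightarrow> 'a \<Rightarrow> real) \<Rightarrow> nat \<Rightarrow> nat \<Rightarrow> real \<Rightarrow> 'a \<Rightarrow> real" where
  "tau_hat X n r u \<omega> =
     (\<Sum>i = 1..r * (n div r). of_bool (X i \<omega> > u)) / real (n div r)"

definition corr :: "'a measure \<Rightarrow> ('a \<Rightarrow> real) \<Rightarrow> ('a \<Rightarrow> real) \<Rightarrow> real" where
  "corr M \<xi> \<eta> =
     prob_space.expectation M
       (\<lambda>\<omega>. (\<xi> \<omega> - prob_space.expectation M \<xi>) * (\<eta> \<omega> - prob_space.expectation M \<eta>)) /
     (sqrt (prob_space.variance M \<xi>) * sqrt (prob_space.variance M \<eta>))"

definition threshold_field ::
    "'a measure \<Rightarrow> (nat \<Rightarrow> 'a \<Rightarrow> real) \<Rightarrow> real \<Rightarrow> nat \<Rightarrow> nat \<Rightarrow> 'a measure" where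
  "threshold_field M X u a b =
     sigma (space M) ((\<lambda>i. {\<omega> \<in> space M. X i \<omega> \<le> u}) ` {a..b})"

text \<open>
  \<open>\<G>\<close> is a \<open>\<sigma>\<close>-field on the space of \<open>M\<close>; only its measurable sets matter.
\<close>

definition L2_space :: "'a measure \<Rightarrow> 'a measure \<Rightarrow> ('a \<Rightarrow> real) set" where
  "L2_space M \<G> = {\<xi>. \<xi> \<in> borel_measurable \<G> \<and> integrable M (\<lambda>\<omega>. (\<xi> \<omega>)\<^sup>2)}"

text \<open>
  Inserting \<open>0\<close> into these sets of nonnegative numbers makes the maximum or supremum over the
  empty set equal to \<open>0\<close> and has no effect otherwise.  For \<open>l \<ge> n\<close> the range of \<open>t\<close> is empty.
\<close>

definition max_corr ::
    "'a measure \<Rightarrow> (nat \<Rightarrow> 'a \<Rightarrow> real) \<Rightarrow> nat \<Rightarrow> nat \<Rightarrow> real \<Rightarrow> real" where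
  "max_corr M X n l u =
     Max (insert 0 ((\<lambda>t. Sup (insert 0
        {\<bar>corr M \<xi> \<eta>\<bar> | \<xi> \<eta>.
           \<xi> \<in> L2_space M (threshold_field M X u 1 t) \<and>
           \<eta> \<in> L2_space M (threshold_field M X u (t + l) n) \<and>
           prob_space.variance M \<xi> > 0 \<and> prob_space.variance M \<eta> > 0})) ` {1..n - l}))"

definition cond_expectation_on ::
    "'a measure \<Rightarrow> ('a \<Rightarrow> real) \<Rightarrow> ('a \<Rightarrow> bool) \<Rightarrow> real" where
  "cond_expectation_on M Y A =
     (LINT \<omega>:{\<omega> \<in> space M. A \<omega>}|M. Y \<omega>) / \<P>(\<omega> in M. A \<omega>)"

definition converges_in_distribution ::
    "'a measure \<Rightarrow> (nat \<Rightarrow> 'a \<Rightarrow> 'b::metric_space) \<Rightarrow> 'b measure \<Rightarrow> bool" where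
  "converges_in_distribution M Z L \<longleftrightarrow>
     (\<forall>n. Z n \<in> borel_measurable M) \<and> prob_space L \<and> sets L = sets borel \<and>
     (\<forall>f :: 'b \<Rightarrow> real. continuous_on UNIV f \<longrightarrow> bounded (range f) \<longrightarrow>
        (\<lambda>n. \<integral>\<omega>. f (Z n \<omega>) \<partial>M) \<longlonglongrightarrow> (\<integral>x. f x \<partial>L))"

definition std_gaussian :: "(real^'n) measure" where
  "std_gaussian = density lborel (\<lambda>x. ennreal (\<Prod>i\<in>UNIV. std_normal_density (x $ i)))"

text \<open>
  \<open>L\<close> is \<open>N(\<mu>, \<Sigma>)\<close>: the law of \<open>\<mu> + A Z\<close> with \<open>Z\<close> standard Gaussian and \<open>A A\<^sup>T = \<Sigma>\<close>.  This law
  depends on \<open>A\<close> only through \<open>\<Sigma>\<close>, and \<open>\<Sigma>\<close> is allowed to be singular.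
\<close>

definition multivariate_normal ::
    "real^'n \<Rightarrow> real^'n^'n \<Rightarrow> (real^'n) measure \<Rightarrow> bool" where
  "multivariate_normal \<mu> S L \<longleftrightarrow>
     (\<exists>A :: real^'n^'n. A ** transpose A = S \<and>
        L = distr std_gaussian borel (\<lambda>z. \<mu> + A *v z))"

definition limit_cov :: "real \<Rightarrow> real \<Rightarrow> real \<Rightarrow> real^3^3" where
  "limit_cov \<tau> \<theta> m2 =
     (let \<alpha> = \<tau> * \<theta>;
          s11 = exp (- \<alpha>) * (1 - exp (- \<alpha>));
          s12 = 2 / \<alpha> * exp (- \<alpha>) * (1 - (1 + \<alpha>) * exp (- \<alpha>));
          s31 = - \<tau> * exp (- \<alpha>);
          s33 = \<alpha> * m2
      in vector [vector [s11, s12, s31],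
                 vector [s12, s12, s31],
                 vector [s31, s31, s33]])"

end

theory Submission
  imports Defs "HOL-Real_Asymp.Real_Asymp"
begin

text \<open>
  Write \<open>r\<close>, \<open>l\<close>, \<open>s\<close> for the \<open>n\<close>-th block length, gap and short block length, \<open>k = n div r\<close>, and
  \<open>\<rho>\<close> for the maximal correlation coefficient at gap \<open>l\<close>.  All three estimators are functions of the
  exceedance indicators of the threshold.  Cut the time axis into \<open>k\<close> blocks of length \<open>r\<close>; up to a
  negligible boundary term, a linear combination of the estimators is an average of one contribution
  per block.  The contribution of a block depends on this block and the next one only, the next one
  entering through the sliding windows that begin in the block.

  \<^bold>\<open>Central limit theorem.\<close>  The assumptions give \<open>k * \<rho> \<longlonglongrightarrow> 0\<close>.  Hence variables separated by a gap
  of length \<open>l\<close> behave like uncorrelated, and functions of them like independent, variables even after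
  summation over all \<open>k\<close> blocks.  Bernstein's method collects \<open>q\<close> consecutive contributions, drops the
  next two, and so on.  For fixed \<open>q\<close> the characteristic function of the sum of the collected groups is
  close to a power of that of one group, and the moment of order \<open>2 * p > 2\<close> yields the second-order
  expansion of the latter.  The dropped contributions have relative variance of order \<open>1 / q\<close>.  So one
  lets first \<open>n\<close> and then \<open>q\<close> tend to infinity; the filter \<open>iter_seq\<close> expresses this iterated limit,
  and \<open>bernstein_clt\<close> is the result: what matters is the limit of the variance of \<open>q\<close> consecutive
  contributions, divided by \<open>q\<close>.

  \<^bold>\<open>Covariances.\<close>  Let \<open>\<alpha> = \<tau> * \<theta>\<close>.  Applying the extremal index at the level \<open>x * \<tau>\<close> shows that a window
  of length \<open>x * r\<close> contains no exceedance with probability tending to \<open>exp (- \<alpha> * x)\<close>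
  (\<open>no_exc_prob_tendsto\<close>).  Two windows of length \<open>r\<close> at distance \<open>x * r\<close>, with \<open>x \<le> 1\<close>, are both clear
  if and only if their union is, so the covariance of their indicators tends to
  \<open>exp (- \<alpha> * (1 + x)) - exp (- 2 * \<alpha>)\<close>, and to \<open>0\<close> for \<open>x \<ge> 1\<close>.  For every single window, the sum over
  all window positions of the covariances with it, divided by \<open>r\<close>, therefore has the same limit
  \<open>\<gamma> = 2 * (\<integral>x=0..1. exp (- \<alpha> * (1 + x)) - exp (- 2 * \<alpha>))\<close>.  This is why the sliding blocks estimator has
  the same covariance with itself as with the disjoint blocks estimator.  A clear window contains no
  exceedance, so its indicator has covariance exactly \<open>- r * tail * P (clear)\<close> with the number of
  exceedances inside it, which tends to \<open>- \<tau> * exp (- \<alpha>)\<close>; exceedances elsewhere contribute nothing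
  in the limit.  Finally the number of exceedances is a sum over short blocks of length \<open>s\<close>, nearly
  uncorrelated once they are shortened by \<open>l\<close>.  As the probability \<open>exp (- \<alpha>)\<close> of a clear
  block is approximately that of a clear short block to the power \<open>r / s\<close>, a short block is hit with
  probability asymptotic to \<open>\<alpha> * s / r\<close>.  The conditional second moment \<open>m2\<close> then gives the
  variance \<open>\<alpha> * m2\<close> per block (\<open>variance_hit_tendsto\<close>).

  \<^bold>\<open>Conclusion.\<close>  The limiting covariance matrix is positive semidefinite as a limit of covariance
  matrices, so it has a factorisation \<open>A ** transpose A\<close>.  The central limit theorem for all linear
  combinations gives convergence of the characteristic functions on \<open>real^3\<close>, and
  \<open>multivariate_levy_continuity\<close> turns it into convergence in distribution.
\<close>

section \<open>Levy continuity in several dimensions\<close>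

text \<open>
  The products of such functions are again in the set, by the product formula for cosines, so that
  the Stone--Weierstrass theorem applies; sines are included through the phase \<open>b\<close>.
\<close>
inductive_set trig_polys :: "('b::euclidean_space \<Rightarrow> real) set" where
  cos: "(\<lambda>x. c * cos (a \<bullet> x + b)) \<in> trig_polys"
| add: "f \<in> trig_polys \<Longrightarrow> g \<in> trig_polys \<Longrightarrow> (\<lambda>x. f x + g x) \<in> trig_polys"

lemma trig_polys_const: "(\<lambda>x. c) \<in> trig_polys"
  using trig_polys.cos[of c 0 0] by simp

lemma trig_polys_mult:
  assumes "f \<in> trig_polys" "g \<in> trig_polys"
  shows "(\<lambda>x. f x * g x) \<in> trig_polys"
  using assms
proof (induction arbitrary: g)
  case (cos c a b)
  from cos.prems show ?case
  proof induction
    case (cos c' a' b')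
    have "(\<lambda>x. c * cos (a \<bullet> x + b) * (c' * cos (a' \<bullet> x + b'))) =
      (\<lambda>x. (c * c' / 2) * cos ((a - a') \<bullet> x + (b - b')) + (c * c' / 2) * cos ((a + a') \<bullet> x + (b + b')))"
    proof
      fix x
      have "cos (a \<bullet> x + b) * cos (a' \<bullet> x + b') =
        (cos ((a - a') \<bullet> x + (b - b')) + cos ((a + a') \<bullet> x + (b + b'))) / 2"
        by (simp add: cos_times_cos inner_diff_left inner_add_left add_ac diff_add_eq add_diff_eq diff_diff_eq2 diff_diff_eq)
      then show "c * cos (a \<bullet> x + b) * (c' * cos (a' \<bullet> x + b')) =
        (c * c' / 2) * cos ((a - a') \<bullet> x + (b - b')) + (c * c' / 2) * cos ((a + a') \<bullet> x + (b + b'))"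
        by (simp add: field_simps)
    qed
    then show ?case by (simp only: trig_polys.intros)
  next
    case (add f h)
    then show ?case by (simp add: distrib_left trig_polys.add)
  qed
next
  case (add f h)
  then show ?case by (simp add: distrib_right trig_polys.add)
qed

lemma trig_polys_continuous: "f \<in> trig_polys \<Longrightarrow> continuous_on S f"
  by (induction rule: trig_polys.induct) (auto intro!: continuous_intros)

lemma trig_polys_bounded: "f \<in> trig_polys \<Longrightarrow> \<exists>H. \<forall>x. \<bar>f x\<bar> \<le> H"
proof (induction rule: trig_polys.induct)
  case (cos c a b)
  have "\<bar>c * cos (a \<bullet> x + b)\<bar> \<le> \<bar>c\<bar>" for x
    using mult_left_mono[OF abs_cos_le_one, of "\<bar>c\<bar>"] by (simp add: abs_mult)
  then show ?case by blast
next
  case (add f g)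
  then obtain H1 H2 where "\<forall>x. \<bar>f x\<bar> \<le> H1" "\<forall>x. \<bar>g x\<bar> \<le> H2" by auto
  then have "\<forall>x. \<bar>f x + g x\<bar> \<le> H1 + H2"
    by (meson abs_triangle_ineq add_mono order_trans)
  then show ?case by blast
qed

lemma trig_polys_separable:
  fixes x y :: "'b::euclidean_space"
  assumes "x \<noteq> y"
  shows "\<exists>f\<in>trig_polys. f x \<noteq> f y"
proof -
  define d where "d = x - y"
  have d: "d \<bullet> d > 0" using assms by (simp add: d_def)
  define a where "a = (1 / (d \<bullet> d)) *\<^sub>R d"
  \<comment> \<open>normalised so that the phases at the two points are \<open>0\<close> and \<open>1\<close>\<close>
  have "a \<bullet> x + (- (a \<bullet> y)) = a \<bullet> d" by (simp add: d_def inner_diff_right)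
  also have "\<dots> = 1" using d by (simp add: a_def)
  finally have "a \<bullet> x + (- (a \<bullet> y)) = 1" .
  moreover have "cos (1::real) \<noteq> 1"
    using cos_monotone_0_pi[of 0 1] pi_gt3 by simp
  ultimately show ?thesis
    using trig_polys.cos[of 1 a "- (a \<bullet> y)"]
    by (intro bexI[of _ "\<lambda>z. 1 * cos (a \<bullet> z + (- (a \<bullet> y)))"]) simp_all
qed

lemma trig_polys_poly:
  assumes "real_polynomial_function (q::real \<Rightarrow> real)" "h \<in> trig_polys"
  shows "(\<lambda>x. q (h x)) \<in> trig_polys"
  using assms
proof induction
  case (linear f)
  have ft: "f t = f 1 * t" for t
    using linear.hyps linear_simps(5)[of f t 1] by (simp add: mult.commute)
  have "(\<lambda>x. f (h x)) = (\<lambda>x. f 1 * h x)" by (rule ext) (rule ft)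
  then show ?case
    using trig_polys_mult[OF trig_polys_const linear.prems] by (simp only:)
qed (auto intro: trig_polys_const trig_polys.add trig_polys_mult)

text \<open>
  A function approximated on a compact set by a trigonometric polynomial may be badly approximated
  off that set, where the polynomial is only known to be bounded by some unspecified constant.
  Composing it with a polynomial close to the truncation to \<open>[-B, B]\<close> repairs this.
\<close>
lemma trig_polys_approx:
  fixes f :: "'b::euclidean_space \<Rightarrow> real"
  assumes S: "compact S" and f: "continuous_on S f" and B: "\<And>x. \<bar>f x\<bar> \<le> B" and e: "e > 0"
  shows "\<exists>g\<in>trig_polys. (\<forall>x\<in>S. \<bar>f x - g x\<bar> \<le> 2 * e) \<and> (\<forall>x. \<bar>g x\<bar> \<le> B + e)"
proof -
  interpret function_ring_on trig_polys S
    by unfold_locales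
      (use S trig_polys_const trig_polys_mult trig_polys.add trig_polys_separable
        trig_polys_continuous in auto)
  obtain h where h: "h \<in> trig_polys" "\<And>x. x \<in> S \<Longrightarrow> \<bar>f x - h x\<bar> < e"
    using Stone_Weierstrass_basic[OF f e] by blast
  obtain H where H: "\<And>x. \<bar>h x\<bar> \<le> H" using trig_polys_bounded[OF h(1)] by blast
  define cl where "cl t = max (-B) (min B t)" for t :: real
  have "B \<ge> 0" using B[of 0] by linarith
  have "continuous_on {-H..H} cl" unfolding cl_def by (intro continuous_intros)
  then obtain q where q: "real_polynomial_function q" "\<And>t. t \<in> {-H..H} \<Longrightarrow> \<bar>cl t - q t\<bar> < e"
    using Stone_Weierstrass_real_polynomial_function[of "{-H..H}" cl e] e by auto
  have clq: "\<bar>cl (h x) - q (h x)\<bar> < e" for x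
    using q(2)[of "h x"] H[of x] by (auto simp: abs_le_iff)
  have clB: "\<bar>cl t\<bar> \<le> B" for t using \<open>B \<ge> 0\<close> by (auto simp: cl_def)
  have fcl: "\<bar>f x - cl (h x)\<bar> \<le> e" if "x \<in> S" for x
    using h(2)[OF that] B[of x] by (auto simp: cl_def max_def min_def abs_le_iff)
  have "\<bar>f x - q (h x)\<bar> \<le> 2 * e" if "x \<in> S" for x
    using fcl[OF that] clq[of x] by linarith
  moreover have "\<bar>q (h x)\<bar> \<le> B + e" for x
    using clq[of x] clB[of "h x"] by linarith
  ultimately show ?thesis
    using trig_polys_poly[OF q(1) h(1)] by (intro bexI[of _ "\<lambda>x. q (h x)"]) auto
qed

lemma trig_polys_integral_tendsto:
  fixes Z :: "nat \<Rightarrow> 'a \<Rightarrow> 'b::euclidean_space"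
  assumes M: "prob_space M" and [measurable]: "\<And>n. Z n \<in> borel_measurable M"
    and L: "prob_space L" and sL[measurable_cong]: "sets L = sets borel"
    and conv: "\<And>a. (\<lambda>n. \<integral>\<omega>. iexp (a \<bullet> Z n \<omega>) \<partial>M) \<longlonglongrightarrow> (\<integral>x. iexp (a \<bullet> x) \<partial>L)"
    and h: "h \<in> trig_polys"
  shows "(\<lambda>n. \<integral>\<omega>. h (Z n \<omega>) \<partial>M) \<longlonglongrightarrow> (\<integral>x. h x \<partial>L)"
  using h
proof induction
  interpret M: prob_space M by fact
  interpret L: prob_space L by fact
  case (cos c a b)
  have eq: "c * cos (a \<bullet> x + b) = Re (complex_of_real c * (cis b * iexp (a \<bullet> x)))" for x
  proof -
    have "cis b * iexp (a \<bullet> x) = cis (a \<bullet> x + b)"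
      by (simp only: cis_conv_exp[symmetric] cis_mult add.commute)
    then show ?thesis by simp
  qed
  have intM: "integrable M (\<lambda>\<omega>. iexp (a \<bullet> Z n \<omega>))" for n
    by (intro M.integrable_const_bound[where B=1]) auto
  have intL: "integrable L (\<lambda>x. iexp (a \<bullet> x))"
    by (intro L.integrable_const_bound[where B=1]) auto
  have "(\<integral>\<omega>. c * cos (a \<bullet> Z n \<omega> + b) \<partial>M) =
      Re (complex_of_real c * (cis b * (\<integral>\<omega>. iexp (a \<bullet> Z n \<omega>) \<partial>M)))" for n
    unfolding eq by (subst integral_Re) (auto intro!: integrable_mult_right intM)
  moreover have "(\<integral>x. c * cos (a \<bullet> x + b) \<partial>L) =
      Re (complex_of_real c * (cis b * (\<integral>x. iexp (a \<bullet> x) \<partial>L)))"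
    unfolding eq by (subst integral_Re) (auto intro!: integrable_mult_right intL)
  moreover have "(\<lambda>n. Re (complex_of_real c * (cis b * (\<integral>\<omega>. iexp (a \<bullet> Z n \<omega>) \<partial>M)))) \<longlonglongrightarrow>
     Re (complex_of_real c * (cis b * (\<integral>x. iexp (a \<bullet> x) \<partial>L)))"
    by (intro tendsto_Re tendsto_mult tendsto_const conv)
  ultimately show ?case by (simp only:)
next
  interpret M: prob_space M by fact
  interpret L: prob_space L by fact
  case (add f g)
  have int: "integrable M (\<lambda>\<omega>. f (Z n \<omega>))" "integrable L f" if ftp: "f \<in> trig_polys" for f n
  proof -
    obtain H where H: "\<And>x. \<bar>f x\<bar> \<le> H" using trig_polys_bounded[OF ftp] by blast
    have [measurable]: "f \<in> borel_measurable borel"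
      by (intro borel_measurable_continuous_onI trig_polys_continuous ftp)
    show "integrable M (\<lambda>\<omega>. f (Z n \<omega>))"
      by (intro M.integrable_const_bound[where B=H]) (auto simp: H)
    show "integrable L f"
      by (intro L.integrable_const_bound[where B=H]) (auto simp: H)
  qed
  show ?case
    using add.IH int[OF add.hyps(1)] int[OF add.hyps(2)] by (simp add: tendsto_add)
qed

text \<open>
  Convergence of characteristic functions is convergence of the integrals of trigonometric
  polynomials.  A bounded continuous function is close to one of them on a large cube.  The mass
  outside the cube is controlled, for all large \<open>n\<close> at once, by the one-dimensional continuity theorem
  applied to the coordinates.
\<close>
theorem multivariate_levy_continuity:
  fixes Z :: "nat \<Rightarrow> 'a \<Rightarrow> 'b::euclidean_space"
  assumes M: "prob_space M" and Zm[measurable]: "\<And>n. Z n \<in> borel_measurable M"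
    and L: "prob_space L" and sL[measurable_cong]: "sets L = sets borel"
    and conv: "\<And>a. (\<lambda>n. \<integral>\<omega>. iexp (a \<bullet> Z n \<omega>) \<partial>M) \<longlonglongrightarrow> (\<integral>x. iexp (a \<bullet> x) \<partial>L)"
  shows "converges_in_distribution M Z L"
proof -
  interpret M: prob_space M by fact
  interpret L: prob_space L by fact
  have coord: "weak_conv_m (\<lambda>n. distr M borel (\<lambda>\<omega>. b \<bullet> Z n \<omega>)) (distr L borel (\<lambda>x. b \<bullet> x))" for b
  proof (rule levy_continuity)
    show "real_distribution (distr M borel (\<lambda>\<omega>. b \<bullet> Z n \<omega>))" for n
      by (intro M.real_distribution_distr) measurable
    show "real_distribution (distr L borel (\<lambda>x. b \<bullet> x))"
      by (intro L.real_distribution_distr) measurable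
    show "(\<lambda>n. char (distr M borel (\<lambda>\<omega>. b \<bullet> Z n \<omega>)) t) \<longlonglongrightarrow> char (distr L borel (\<lambda>x. b \<bullet> x)) t" for t
      using conv[of "t *\<^sub>R b"] by (simp add: char_def integral_distr)
  qed
  \<comment> \<open>a continuous majorant of the indicator of \<open>\<bar>t\<bar> \<ge> K + 1\<close> that vanishes on \<open>[-K, K]\<close>\<close>
  define cut where "cut K t = min 1 (max 0 (\<bar>t\<bar> - real K))" for K :: nat and t :: real
  have cut01: "0 \<le> cut K t" "cut K t \<le> 1" for K t by (auto simp: cut_def)
  have cut_cont: "continuous_on UNIV (cut K)" for K
    unfolding cut_def by (intro continuous_intros)
  have [measurable]: "cut K \<in> borel_measurable borel" for K
    using cut_cont by (rule borel_measurable_continuous_onI)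
  have cut_conv: "(\<lambda>n. \<integral>\<omega>. cut K (b \<bullet> Z n \<omega>) \<partial>M) \<longlonglongrightarrow> (\<integral>x. cut K (b \<bullet> x) \<partial>L)" for K b
  proof -
    have "(\<lambda>n. integral\<^sup>L (distr M borel (\<lambda>\<omega>. b \<bullet> Z n \<omega>)) (cut K)) \<longlonglongrightarrow>
        integral\<^sup>L (distr L borel (\<lambda>x. b \<bullet> x)) (cut K)"
      by (rule weak_conv_imp_integral_bdd_continuous_conv[where B=1, OF _ _ coord])
        (use cut01 cut_cont in \<open>auto intro!: M.real_distribution_distr L.real_distribution_distr
          simp: continuous_on_eq_continuous_at\<close>)
    then show ?thesis by (simp add: integral_distr)
  qed
  have cut_int: "integrable M (\<lambda>\<omega>. cut K (b \<bullet> Z n \<omega>))" "integrable L (\<lambda>x. cut K (b \<bullet> x))" for K b n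
    by (intro M.integrable_const_bound[where B=1] L.integrable_const_bound[where B=1];
        use cut01 in auto)+
  have cut_small: "(\<lambda>K. \<Sum>b\<in>Basis. \<integral>x. cut K (b \<bullet> x) \<partial>L) \<longlonglongrightarrow> (\<Sum>b\<in>(Basis::'b set). \<integral>x. 0 \<partial>L)"
  proof (intro tendsto_sum integral_dominated_convergence[where w="\<lambda>_. 1"])
    fix b :: 'b
    have "(\<lambda>K. cut K (b \<bullet> x)) \<longlonglongrightarrow> 0" for x
    proof (rule tendsto_eventually)
      obtain K0 :: nat where "\<bar>b \<bullet> x\<bar> \<le> real K0" using real_arch_simple by blast
      then show "\<forall>\<^sub>F K in sequentially. cut K (b \<bullet> x) = 0"
        by (intro eventually_sequentiallyI[of K0]) (auto simp: cut_def)
    qed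
    then show "AE x in L. (\<lambda>K. cut K (b \<bullet> x)) \<longlonglongrightarrow> 0" by simp
  qed (use cut01 in auto)
  have main: "(\<lambda>n. \<integral>\<omega>. f (Z n \<omega>) \<partial>M) \<longlonglongrightarrow> (\<integral>x. f x \<partial>L)"
    if f: "continuous_on UNIV f" "bounded (range f)" for f :: "'b \<Rightarrow> real"
  proof (rule LIMSEQ_I)
    fix e0 :: real assume e0: "e0 > 0"
    obtain B where B: "\<And>x. \<bar>f x\<bar> \<le> B" using f(2) by (auto simp: bounded_iff)
    have "B \<ge> 0" using B[of 0] by linarith
    have [measurable]: "f \<in> borel_measurable borel"
      using f(1) by (rule borel_measurable_continuous_onI)
    define e where "e = min 1 (e0 / (2 * (6 * B + 10)))"
    have e: "e > 0" "e \<le> 1" and e_le: "e * (6 * B + 10) < e0"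
    proof -
      show "e > 0" "e \<le> 1" using e0 \<open>B \<ge> 0\<close> by (auto simp: e_def)
      have "e * (6 * B + 10) \<le> (e0 / (2 * (6 * B + 10))) * (6 * B + 10)"
        using \<open>B \<ge> 0\<close> by (intro mult_right_mono) (auto simp: e_def)
      also have "\<dots> = e0 / 2" using \<open>B \<ge> 0\<close> by (simp add: field_simps)
      finally show "e * (6 * B + 10) < e0" using e0 by simp
    qed
    have "\<forall>\<^sub>F K in sequentially. (\<Sum>b\<in>(Basis::'b set). \<integral>x. cut K (b \<bullet> x) \<partial>L) < e"
      using cut_small e(1) by (intro order_tendstoD(2)[OF cut_small]) simp
    then obtain K where K: "(\<Sum>b\<in>(Basis::'b set). \<integral>x. cut K (b \<bullet> x) \<partial>L) < e"
      by (auto simp: eventually_sequentially)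
    define c where "c x = (\<Sum>b\<in>(Basis::'b set). cut K (b \<bullet> x))" for x
    have c0: "c x \<ge> 0" for x unfolding c_def by (intro sum_nonneg cut01)
    have c_int: "integrable M (\<lambda>\<omega>. c (Z n \<omega>))" "integrable L c" for n
      unfolding c_def by (intro Bochner_Integration.integrable_sum cut_int)+
    have cL: "(\<integral>x. c x \<partial>L) < e"
      using K unfolding c_def by (subst Bochner_Integration.integral_sum) (auto intro: cut_int)
    have "(\<lambda>n. \<integral>\<omega>. c (Z n \<omega>) \<partial>M) \<longlonglongrightarrow> (\<integral>x. c x \<partial>L)"
      unfolding c_def
      by (subst (1 2) Bochner_Integration.integral_sum) (auto intro!: cut_int tendsto_sum cut_conv)
    then have ev1: "\<forall>\<^sub>F n in sequentially. (\<integral>\<omega>. c (Z n \<omega>) \<partial>M) < e"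
      using cL by (rule order_tendstoD(2))
    define S :: "'b set" where "S = cbox (- (real (K + 1)) *\<^sub>R One) (real (K + 1) *\<^sub>R One)"
    obtain g where g: "g \<in> trig_polys" "\<And>x. x \<in> S \<Longrightarrow> \<bar>f x - g x\<bar> \<le> 2 * e" "\<And>x. \<bar>g x\<bar> \<le> B + e"
    proof -
      have "compact S" "continuous_on S f"
        using f(1) by (auto simp: S_def intro: continuous_on_subset)
      from trig_polys_approx[OF this B e(1)] show thesis using that by blast
    qed
    have [measurable]: "g \<in> borel_measurable borel"
      by (intro borel_measurable_continuous_onI trig_polys_continuous g)
    have g_int: "integrable M (\<lambda>\<omega>. g (Z n \<omega>))" "integrable L g" for n
      by (intro M.integrable_const_bound[where B="B+e"] L.integrable_const_bound[where B="B+e"];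
          use g(3) in auto)+
    have f_int: "integrable M (\<lambda>\<omega>. f (Z n \<omega>))" "integrable L f" for n
      by (intro M.integrable_const_bound[where B="B"] L.integrable_const_bound[where B="B"];
          use B in auto)+
    have fg: "\<bar>f x - g x\<bar> \<le> 2 * e + (2 * B + 1) * c x" for x
    proof (cases "x \<in> S")
      case True
      then show ?thesis using g(2)[OF True] c0[of x] \<open>B \<ge> 0\<close> by (simp add: add_increasing2)
    next
      case False
      then obtain b where b: "b \<in> Basis" "\<bar>b \<bullet> x\<bar> \<ge> real (K + 1)"
      proof -
        from False obtain b where b: "b \<in> Basis"
            "\<not> (- real (K + 1) \<le> x \<bullet> b \<and> x \<bullet> b \<le> real (K + 1))"
          unfolding S_def mem_box by auto
        then show thesis using that[OF b(1)] by (auto simp: inner_commute)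
      qed
      have "1 \<le> cut K (b \<bullet> x)" using b(2) by (simp add: cut_def)
      also have "\<dots> \<le> c x" unfolding c_def
        by (intro member_le_sum) (use b cut01 in auto)
      finally have "(2 * B + 1) * 1 \<le> (2 * B + 1) * c x" using \<open>B \<ge> 0\<close> by (intro mult_left_mono) auto
      moreover have "\<bar>f x - g x\<bar> \<le> 2 * e + (2 * B + 1) * 1"
        using B[of x] g(3)[of x] e by simp
      ultimately show ?thesis by linarith
    qed
    have dM: "\<bar>(\<integral>\<omega>. f (Z n \<omega>) \<partial>M) - (\<integral>\<omega>. g (Z n \<omega>) \<partial>M)\<bar> \<le> 2 * e + (2 * B + 1) * (\<integral>\<omega>. c (Z n \<omega>) \<partial>M)" for n
    proof -
      have "\<bar>(\<integral>\<omega>. f (Z n \<omega>) \<partial>M) - (\<integral>\<omega>. g (Z n \<omega>) \<partial>M)\<bar> = \<bar>\<integral>\<omega>. f (Z n \<omega>) - g (Z n \<omega>) \<partial>M\<bar>"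
        using f_int g_int by simp
      also have "\<dots> \<le> (\<integral>\<omega>. \<bar>f (Z n \<omega>) - g (Z n \<omega>)\<bar> \<partial>M)" by (rule integral_abs_bound)
      also have "\<dots> \<le> (\<integral>\<omega>. 2 * e + (2 * B + 1) * c (Z n \<omega>) \<partial>M)"
        by (intro integral_mono fg) (use f_int g_int c_int in auto)
      also have "\<dots> = 2 * e + (2 * B + 1) * (\<integral>\<omega>. c (Z n \<omega>) \<partial>M)"
        using c_int by (simp add: M.prob_space)
      finally show ?thesis .
    qed
    have dL: "\<bar>(\<integral>x. f x \<partial>L) - (\<integral>x. g x \<partial>L)\<bar> \<le> 2 * e + (2 * B + 1) * (\<integral>x. c x \<partial>L)"
    proof -
      have "\<bar>(\<integral>x. f x \<partial>L) - (\<integral>x. g x \<partial>L)\<bar> = \<bar>\<integral>x. f x - g x \<partial>L\<bar>"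
        using f_int g_int by simp
      also have "\<dots> \<le> (\<integral>x. \<bar>f x - g x\<bar> \<partial>L)" by (rule integral_abs_bound)
      also have "\<dots> \<le> (\<integral>x. 2 * e + (2 * B + 1) * c x \<partial>L)"
        by (intro integral_mono fg) (use f_int g_int c_int in auto)
      also have "\<dots> = 2 * e + (2 * B + 1) * (\<integral>x. c x \<partial>L)"
        using c_int by (simp add: L.prob_space)
      finally show ?thesis .
    qed
    have "(\<lambda>n. \<integral>\<omega>. g (Z n \<omega>) \<partial>M) \<longlonglongrightarrow> (\<integral>x. g x \<partial>L)"
      by (rule trig_polys_integral_tendsto[OF M Zm L sL conv g(1)])
    then have ev2: "\<forall>\<^sub>F n in sequentially. \<bar>(\<integral>\<omega>. g (Z n \<omega>) \<partial>M) - (\<integral>x. g x \<partial>L)\<bar> < e"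
      using e(1) by (auto dest!: tendstoD simp: dist_real_def)
    have "\<forall>\<^sub>F n in sequentially. \<bar>(\<integral>\<omega>. f (Z n \<omega>) \<partial>M) - (\<integral>x. f x \<partial>L)\<bar> < e0"
      using ev1 ev2
    proof eventually_elim
      case (elim n)
      have "(2 * B + 1) * (\<integral>\<omega>. c (Z n \<omega>) \<partial>M) \<le> (2 * B + 1) * e"
        "(2 * B + 1) * (\<integral>x. c x \<partial>L) \<le> (2 * B + 1) * e"
        using elim(1) cL \<open>B \<ge> 0\<close> by (intro mult_left_mono; simp)+
      then have "\<bar>(\<integral>\<omega>. f (Z n \<omega>) \<partial>M) - (\<integral>x. f x \<partial>L)\<bar> \<le> 5 * e + 2 * ((2 * B + 1) * e)"
        using dM[of n] dL elim(2) by linarith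
      also have "\<dots> = e * (4 * B + 7)" by (simp add: algebra_simps)
      also have "\<dots> \<le> e * (6 * B + 10)" using e(1) \<open>B \<ge> 0\<close> by (intro mult_left_mono) auto
      also have "\<dots> < e0" by (rule e_le)
      finally show ?case .
    qed
    then show "\<exists>no. \<forall>n\<ge>no. norm ((\<integral>\<omega>. f (Z n \<omega>) \<partial>M) - (\<integral>x. f x \<partial>L)) < e0"
      by (auto simp: eventually_sequentially)
  qed
  show ?thesis
    unfolding converges_in_distribution_def using main Zm L sL by auto
qed

section \<open>Gaussian laws and factorisation of covariance matrices\<close>

text \<open>
  Fubini for products of functions of the coordinates, from the construction of Lebesgue measure on a
  Euclidean space as the image of a product measure.
\<close>
lemma integral_lborel_prod:
  fixes f :: "'b::euclidean_space \<Rightarrow> real \<Rightarrow> complex"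
  assumes f: "\<And>b. b \<in> Basis \<Longrightarrow> integrable lborel (f b)"
  shows "(\<integral>x. (\<Prod>b\<in>Basis. f b (x \<bullet> b)) \<partial>lborel) = (\<Prod>b\<in>Basis. \<integral>t. f b t \<partial>lborel)"
proof -
  interpret product_sigma_finite "\<lambda>_::'b. lborel :: real measure"
    by (rule product_sigma_finite.intro) (rule sigma_finite_lborel)
  have [measurable]: "f b \<in> borel_measurable borel" if "b \<in> Basis" for b
    using borel_measurable_integrable[OF f[OF that]] by simp
  have "(\<integral>x. (\<Prod>b\<in>Basis. f b (x \<bullet> b)) \<partial>lborel) =
      (\<integral>x. (\<Prod>b\<in>Basis. f b ((\<Sum>b'\<in>Basis. x b' *\<^sub>R b') \<bullet> b)) \<partial>(\<Pi>\<^sub>M b\<in>Basis. lborel))"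
    by (subst lborel_eq, subst integral_distr) measurable
  also have "\<dots> = (\<integral>x. (\<Prod>b\<in>Basis. f b (x b)) \<partial>(\<Pi>\<^sub>M b\<in>Basis. lborel))"
    by (intro Bochner_Integration.integral_cong refl prod.cong) simp
  also have "\<dots> = (\<Prod>b\<in>Basis. \<integral>t. f b t \<partial>lborel)"
    by (intro product_integral_prod f) auto
  finally show ?thesis .
qed

lemma prod_Basis_vec:
  fixes x :: "real^'n"
  shows "(\<Prod>i\<in>UNIV. f (x $ i)) = (\<Prod>b\<in>Basis. f (x \<bullet> b))"
proof -
  have inj: "inj (\<lambda>i::'n. axis i (1::real))"
    by (auto simp: inj_on_def axis_eq_axis)
  have "(Basis :: (real^'n) set) = range (\<lambda>i. axis i 1)"
    by (auto simp: Basis_vec_def)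
  then have "(\<Prod>b\<in>Basis. f (x \<bullet> b)) = (\<Prod>b\<in>range (\<lambda>i::'n. axis i 1). f (x \<bullet> b))"
    by (simp only:)
  also have "\<dots> = (\<Prod>i\<in>UNIV. f (x $ i))"
    by (subst prod.reindex[OF inj]) (simp add: inner_axis)
  finally show ?thesis by (rule sym)
qed

lemma std_gaussian_measurable[measurable]:
  "(\<lambda>x::real^'n. \<Prod>i\<in>UNIV. std_normal_density (x $ i)) \<in> borel_measurable borel"
  by measurable

lemma sets_std_gaussian[simp, measurable_cong]: "sets (std_gaussian :: (real^'n) measure) = sets borel"
  by (simp add: std_gaussian_def)

lemma prob_space_std_gaussian: "prob_space (std_gaussian :: (real^'n) measure)"
proof
  have 1: "(\<integral>\<^sup>+t. ennreal (std_normal_density t) \<partial>lborel) = 1"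
    using prob_space.emeasure_space_1[OF prob_space_normal_density[of 1 0]]
    by (simp add: emeasure_density)
  have "emeasure (std_gaussian :: (real^'n) measure) (space std_gaussian) =
      (\<integral>\<^sup>+x. ennreal (\<Prod>i\<in>UNIV. std_normal_density ((x::real^'n) $ i)) \<partial>lborel)"
    by (simp add: std_gaussian_def emeasure_density)
  also have "\<dots> = (\<integral>\<^sup>+x. (\<Prod>b\<in>Basis. ennreal (std_normal_density ((x::real^'n) \<bullet> b))) \<partial>lborel)"
    by (simp add: prod_Basis_vec prod_ennreal)
  also have "\<dots> = 1"
    by (subst nn_integral_lborel_prod) (auto simp: 1)
  finally show "emeasure (std_gaussian :: (real^'n) measure) (space std_gaussian) = 1" .
qed

lemma char_std_gaussian:
  fixes a :: "real^'n"
  shows "(\<integral>x. iexp (a \<bullet> x) \<partial>std_gaussian) = exp (- (a \<bullet> a) / 2)"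
proof -
  define f where "f b t = std_normal_density t *\<^sub>R iexp ((a \<bullet> b) * t)" for b :: "real^'n" and t
  have int: "integrable lborel (f b)" for b
  proof -
    have "integrable std_normal_distribution (\<lambda>t. iexp ((a \<bullet> b) * t))"
      by (intro finite_measure.integrable_const_bound[where B=1] prob_space.finite_measure
          prob_space_normal_density) auto
    then show ?thesis unfolding f_def by (subst (asm) integrable_density) auto
  qed
  have val: "(\<integral>t. f b t \<partial>lborel) = exp (- (a \<bullet> b)\<^sup>2 / 2)" for b
  proof -
    have "(\<integral>t. f b t \<partial>lborel) = char std_normal_distribution (a \<bullet> b)"
      unfolding f_def char_def by (subst integral_density) auto
    then show ?thesis by (simp add: char_std_normal_distribution)
  qed
  have fprod: "(\<Prod>i\<in>UNIV. std_normal_density (x $ i)) *\<^sub>R iexp (a \<bullet> x) = (\<Prod>b\<in>Basis. f b (x \<bullet> b))" for x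
  proof -
    have "iexp (a \<bullet> x) = (\<Prod>b\<in>Basis. iexp ((a \<bullet> b) * (x \<bullet> b)))"
      by (subst euclidean_inner) (simp add: sum_distrib_left exp_sum)
    then show ?thesis
      by (simp only: prod_Basis_vec f_def scaleR_conv_of_real of_real_prod prod.distrib)
  qed
  have "(\<integral>x. iexp (a \<bullet> x) \<partial>std_gaussian) =
      (\<integral>x. (\<Prod>i\<in>UNIV. std_normal_density (x $ i)) *\<^sub>R iexp (a \<bullet> x) \<partial>lborel)"
    unfolding std_gaussian_def
    by (subst integral_density) (auto intro!: prod_nonneg)
  also have "\<dots> = (\<Prod>b\<in>Basis. complex_of_real (exp (- (a \<bullet> b)\<^sup>2 / 2)))"
    unfolding fprod by (subst integral_lborel_prod[OF int]) (simp add: val)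
  also have "\<dots> = exp (- (a \<bullet> a) / 2)"
  proof -
    have "(\<Prod>b\<in>Basis. exp (- (a \<bullet> b)\<^sup>2 / 2)) = exp (\<Sum>b\<in>Basis. - (a \<bullet> b)\<^sup>2 / 2)"
      by (simp add: exp_sum)
    also have "(\<Sum>b\<in>Basis. - (a \<bullet> b)\<^sup>2 / 2) = - (a \<bullet> a) / 2"
    proof -
      have "a \<bullet> a = (\<Sum>b\<in>Basis. (a \<bullet> b)\<^sup>2)"
        by (subst euclidean_inner) (simp add: power2_eq_square)
      then show ?thesis by (simp add: sum_negf flip: sum_divide_distrib)
    qed
    finally show ?thesis by (simp only: of_real_prod[symmetric])
  qed
  finally show ?thesis .
qed

lemma char_linear_image_std_gaussian:
  fixes A :: "real^'n^'n" and a :: "real^'n"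
  shows "(\<integral>x. iexp (a \<bullet> x) \<partial>(distr std_gaussian borel (\<lambda>z. A *v z))) =
    exp (- (a \<bullet> ((A ** transpose A) *v a)) / 2)"
proof -
  have [measurable]: "(\<lambda>z. A *v z) \<in> borel_measurable borel"
    by (intro borel_measurable_continuous_onI linear_continuous_on linear_linear[THEN iffD2]
        matrix_vector_mul_linear)
  have "(\<integral>x. iexp (a \<bullet> x) \<partial>(distr std_gaussian borel (\<lambda>z. A *v z))) =
      (\<integral>z. iexp ((transpose A *v a) \<bullet> z) \<partial>std_gaussian)"
    by (subst integral_distr) (auto simp: dot_lmul_matrix transpose_matrix_vector)
  also have "\<dots> = exp (- ((transpose A *v a) \<bullet> (transpose A *v a)) / 2)"
    by (rule char_std_gaussian)
  also have "(transpose A *v a) \<bullet> (transpose A *v a) = a \<bullet> ((A ** transpose A) *v a)"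
    by (simp add: dot_lmul_matrix transpose_matrix_vector flip: matrix_vector_mul_assoc)
  finally show ?thesis .
qed

text \<open>
  A Cholesky factorisation that allows singular forms: if the first diagonal entry vanishes, then so
  does the off-diagonal one.
\<close>
lemma psd2_factor:
  fixes a b c :: real
  assumes psd: "\<And>x y. a * x\<^sup>2 + 2 * b * x * y + c * y\<^sup>2 \<ge> 0"
  shows "\<exists>p q r. p\<^sup>2 = a \<and> p * q = b \<and> q\<^sup>2 + r\<^sup>2 = c"
proof -
  have a: "a \<ge> 0" and c: "c \<ge> 0" using psd[of 1 0] psd[of 0 1] by auto
  show ?thesis
  proof (cases "a = 0")
    case True
    have "b = 0"
    proof (rule ccontr)
      assume "b \<noteq> 0"
      then show False using psd[of "- (c + 1) / (2 * b)" 1] True by (simp add: field_simps)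
    qed
    then show ?thesis using True c by (intro exI[of _ 0] exI[of _ "sqrt c"]) auto
  next
    case False
    then have "a > 0" using a by simp
    have "a * (- b / a)\<^sup>2 + 2 * b * (- b / a) * 1 + c * 1\<^sup>2 = c - b\<^sup>2 / a"
      using False by (simp add: field_simps power2_eq_square)
    then have "c - b\<^sup>2 / a \<ge> 0" using psd[of "- b / a" 1] by simp
    then show ?thesis using \<open>a > 0\<close>
      by (intro exI[of _ "sqrt a"] exI[of _ "b / sqrt a"] exI[of _ "sqrt (c - b\<^sup>2 / a)"])
         (simp add: power_divide)
  qed
qed

lemma psd3_factor:
  fixes s11 s12 s13 s22 s23 s33 :: real
  assumes psd: "\<And>x y z. s11 * x\<^sup>2 + s22 * y\<^sup>2 + s33 * z\<^sup>2 + 2 * s12 * x * y + 2 * s13 * x * z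
    + 2 * s23 * y * z \<ge> 0"
  shows "\<exists>A :: real^3^3. A ** transpose A =
    vector [vector [s11, s12, s13], vector [s12, s22, s23], vector [s13, s23, s33]]"
proof -
  have "\<exists>p q r u v w. p\<^sup>2 = s11 \<and> p * q = s12 \<and> p * r = s13 \<and> q\<^sup>2 + u\<^sup>2 = s22 \<and> q * r + u * v = s23 \<and>
    r\<^sup>2 + v\<^sup>2 + w\<^sup>2 = s33"
  proof -
    have a: "s11 \<ge> 0" using psd[of 1 0 0] by simp
    show ?thesis
    proof (cases "s11 = 0")
      case True
      obtain p q r where "p\<^sup>2 = s22" "p * q = s23" "q\<^sup>2 + r\<^sup>2 = s33"
      proof -
        have "s22 * x\<^sup>2 + 2 * s23 * x * y + s33 * y\<^sup>2 \<ge> 0" for x y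
          using psd[of 0 x y] by simp
        from psd2_factor[OF this] that show thesis by blast
      qed
      moreover obtain p' q' r' where "p'\<^sup>2 = s11" "p' * q' = s12" "q'\<^sup>2 + r'\<^sup>2 = s22"
      proof -
        have "s11 * x\<^sup>2 + 2 * s12 * x * y + s22 * y\<^sup>2 \<ge> 0" for x y
          using psd[of x y 0] by simp
        from psd2_factor[OF this] that show thesis by blast
      qed
      moreover obtain p'' q'' r'' where "p''\<^sup>2 = s11" "p'' * q'' = s13" "q''\<^sup>2 + r''\<^sup>2 = s33"
      proof -
        have "s11 * x\<^sup>2 + 2 * s13 * x * y + s33 * y\<^sup>2 \<ge> 0" for x y
          using psd[of x 0 y] by simp
        from psd2_factor[OF this] that show thesis by blast
      qed
      ultimately show ?thesis using True
        by (intro exI[of _ 0] exI[of _ p] exI[of _ q] exI[of _ r]) auto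
    next
      case False
      then have pos: "s11 > 0" using a by simp
      \<comment> \<open>the Schur complement is nonnegative, by minimising over the first coordinate\<close>
      have schur: "(s22 - s12\<^sup>2 / s11) * y\<^sup>2 + 2 * (s23 - s12 * s13 / s11) * y * z + (s33 - s13\<^sup>2 / s11) * z\<^sup>2 \<ge> 0" for y z
      proof -
        let ?x = "- (s12 * y + s13 * z) / s11"
        have "s11 * ?x\<^sup>2 + s22 * y\<^sup>2 + s33 * z\<^sup>2 + 2 * s12 * ?x * y + 2 * s13 * ?x * z + 2 * s23 * y * z =
          (s22 - s12\<^sup>2 / s11) * y\<^sup>2 + 2 * (s23 - s12 * s13 / s11) * y * z + (s33 - s13\<^sup>2 / s11) * z\<^sup>2"
          using False by (simp add: divide_simps) (simp add: algebra_simps power2_eq_square)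
        then show ?thesis using psd[of ?x y z] by (simp only:)
      qed
      then obtain u v w where "u\<^sup>2 = s22 - s12\<^sup>2 / s11" "u * v = s23 - s12 * s13 / s11"
          "v\<^sup>2 + w\<^sup>2 = s33 - s13\<^sup>2 / s11"
      proof -
        show thesis using psd2_factor[OF schur] that by blast
      qed
      then show ?thesis using pos
        by (intro exI[of _ "sqrt s11"] exI[of _ "s12 / sqrt s11"] exI[of _ "s13 / sqrt s11"]
            exI[of _ u] exI[of _ v] exI[of _ w]) (simp add: power_divide)
    qed
  qed
  then obtain p q r u v w where *: "p\<^sup>2 = s11" "p * q = s12" "p * r = s13" "q\<^sup>2 + u\<^sup>2 = s22"
    "q * r + u * v = s23" "r\<^sup>2 + v\<^sup>2 + w\<^sup>2 = s33" by blast
  define A :: "real^3^3" where "A = vector [vector [p, 0, 0], vector [q, u, 0], vector [r, v, w]]"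
  have "A ** transpose A =
    vector [vector [s11, s12, s13], vector [s12, s22, s23], vector [s13, s23, s33]]"
    using * by (simp add: vec_eq_iff forall_3 A_def matrix_matrix_mult_def transpose_def sum_3
        power2_eq_square algebra_simps)
  then show ?thesis by blast
qed

section \<open>Iterated limits and covariances\<close>

text \<open>
  Convergence along this filter is the iterated limit of \<open>f q n\<close>, first in \<open>n\<close> and then in \<open>q\<close>, in the
  weak form which does not require the limits in \<open>n\<close> to exist for fixed \<open>q\<close>.
\<close>
definition iter_seq :: "(nat \<times> nat) filter" where
  "iter_seq = Abs_filter (\<lambda>P. \<forall>\<^sub>F q in sequentially. \<forall>\<^sub>F n in sequentially. P (q, n))"

lemma eventually_iter_seq:
  "eventually P iter_seq \<longleftrightarrow> (\<forall>\<^sub>F q in sequentially. \<forall>\<^sub>F n in sequentially. P (q, n))"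
  unfolding iter_seq_def
proof (rule eventually_Abs_filter, rule is_filter.intro)
  fix P Q :: "nat \<times> nat \<Rightarrow> bool"
  assume "\<forall>\<^sub>F q in sequentially. \<forall>\<^sub>F n in sequentially. P (q, n)"
    "\<forall>\<^sub>F q in sequentially. \<forall>\<^sub>F n in sequentially. Q (q, n)"
  then show "\<forall>\<^sub>F q in sequentially. \<forall>\<^sub>F n in sequentially. P (q, n) \<and> Q (q, n)"
    by eventually_elim (rule eventually_conj)
next
  fix P Q :: "nat \<times> nat \<Rightarrow> bool"
  assume "\<forall>x. P x \<longrightarrow> Q x" "\<forall>\<^sub>F q in sequentially. \<forall>\<^sub>F n in sequentially. P (q, n)"
  then show "\<forall>\<^sub>F q in sequentially. \<forall>\<^sub>F n in sequentially. Q (q, n)"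
    by (auto elim!: eventually_mono)
qed simp

lemma tendsto_iter_seq:
  assumes "\<And>q. (\<lambda>n. f q n) \<longlonglongrightarrow> g q" "g \<longlonglongrightarrow> l"
  shows "((\<lambda>(q, n). f q n) \<longlongrightarrow> l) iter_seq"
proof (rule topological_tendstoI)
  fix S assume S: "open S" "l \<in> S"
  have "\<forall>\<^sub>F q in sequentially. g q \<in> S" using assms(2) S by (rule topological_tendstoD)
  then show "\<forall>\<^sub>F x in iter_seq. (case x of (q, n) \<Rightarrow> f q n) \<in> S"
    unfolding eventually_iter_seq
  proof eventually_elim
    case (elim q)
    then show ?case using topological_tendstoD[OF assms(1) S(1)] by simp
  qed
qed

lemma eventually_iter_seq_snd:
  "\<forall>\<^sub>F n in sequentially. P n \<Longrightarrow> \<forall>\<^sub>F x in iter_seq. P (snd x)"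
  by (simp add: eventually_iter_seq)

lemma eventually_iter_seq_fst:
  "\<forall>\<^sub>F q in sequentially. P q \<Longrightarrow> \<forall>\<^sub>F x in iter_seq. P (fst x)"
  by (auto simp: eventually_iter_seq elim!: eventually_mono)

text \<open>
  This transfers bounds with an auxiliary parameter \<open>q\<close> to sequences that do not depend on it: for a
  given precision a single large \<open>q\<close> suffices.
\<close>
lemma LIMSEQ_0_if_iter_bound:
  fixes a :: "nat \<Rightarrow> 'c::real_normed_vector" and b :: "nat \<times> nat \<Rightarrow> real"
  assumes b: "(b \<longlongrightarrow> 0) iter_seq" and ab: "\<forall>\<^sub>F x in iter_seq. norm (a (snd x)) \<le> b x"
  shows "a \<longlonglongrightarrow> 0"
proof (rule tendstoI)
  fix e :: real assume "e > 0"
  with b have "\<forall>\<^sub>F x in iter_seq. b x < e" by (rule order_tendstoD(2))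
  with ab have "\<forall>\<^sub>F x in iter_seq. norm (a (snd x)) < e" by eventually_elim simp
  then have "\<forall>\<^sub>F n in sequentially. norm (a n) < e"
    by (simp add: eventually_iter_seq)
  then show "\<forall>\<^sub>F n in sequentially. dist (a n) 0 < e" by (auto simp: dist_norm)
qed

context prob_space
begin

definition sq_int :: "('a \<Rightarrow> real) \<Rightarrow> bool" where
  "sq_int Y \<longleftrightarrow> random_variable borel Y \<and> integrable M (\<lambda>\<omega>. (Y \<omega>)\<^sup>2)"

definition cov :: "('a \<Rightarrow> real) \<Rightarrow> ('a \<Rightarrow> real) \<Rightarrow> real" where
  "cov Y Z = expectation (\<lambda>\<omega>. Y \<omega> * Z \<omega>) - expectation Y * expectation Z"

lemma sq_int_measurable: "sq_int Y \<Longrightarrow> random_variable borel Y"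
  by (simp add: sq_int_def)

lemma sq_int_square: "sq_int Y \<Longrightarrow> integrable M (\<lambda>\<omega>. (Y \<omega>)\<^sup>2)"
  by (simp add: sq_int_def)

lemma sq_int_integrable: "sq_int Y \<Longrightarrow> integrable M Y"
  unfolding sq_int_def by (elim conjE) (rule square_integrable_imp_integrable)

lemma sq_int_mult_integrable:
  assumes "sq_int Y" "sq_int Z"
  shows "integrable M (\<lambda>\<omega>. Y \<omega> * Z \<omega>)"
proof (rule Bochner_Integration.integrable_bound)
  show "integrable M (\<lambda>\<omega>. (Y \<omega>)\<^sup>2 + (Z \<omega>)\<^sup>2)"
    using assms by (auto simp: sq_int_def)
  show "(\<lambda>\<omega>. Y \<omega> * Z \<omega>) \<in> borel_measurable M"
    using assms by (auto simp: sq_int_def)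
  have "\<bar>y * z\<bar> \<le> y\<^sup>2 + z\<^sup>2" for y z :: real
  proof -
    have "0 \<le> (\<bar>y\<bar> - \<bar>z\<bar>)\<^sup>2" by simp
    also have "\<dots> = y\<^sup>2 + z\<^sup>2 - 2 * (\<bar>y\<bar> * \<bar>z\<bar>)" by (simp add: power2_diff)
    finally have "2 * (\<bar>y\<bar> * \<bar>z\<bar>) \<le> y\<^sup>2 + z\<^sup>2" by simp
    moreover have "0 \<le> \<bar>y\<bar> * \<bar>z\<bar>" by simp
    ultimately show ?thesis unfolding abs_mult by linarith
  qed
  then show "AE \<omega> in M. norm (Y \<omega> * Z \<omega>) \<le> norm ((Y \<omega>)\<^sup>2 + (Z \<omega>)\<^sup>2)" by simp
qed

lemma sq_int_cmult[intro]: "sq_int Y \<Longrightarrow> sq_int (\<lambda>\<omega>. c * Y \<omega>)"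
  by (auto simp: sq_int_def power_mult_distrib)

lemma sq_int_add[intro]:
  assumes "sq_int Y" "sq_int Z"
  shows "sq_int (\<lambda>\<omega>. Y \<omega> + Z \<omega>)"
  using sq_int_mult_integrable[OF assms] assms
  by (auto simp: sq_int_def power2_sum mult.assoc)

lemma sq_int_bounded:
  assumes "random_variable borel Y" "\<And>\<omega>. \<bar>Y \<omega>\<bar> \<le> B"
  shows "sq_int Y"
proof -
  have "(Y \<omega>)\<^sup>2 \<le> B\<^sup>2" for \<omega> using power_mono[OF assms(2)[of \<omega>], of 2] by simp
  then show ?thesis unfolding sq_int_def
    using assms(1) by (auto intro!: integrable_const_bound[where B="B\<^sup>2"])
qed

lemma sq_int_const[simp, intro]: "sq_int (\<lambda>\<omega>. c)"
  by (rule sq_int_bounded[where B="\<bar>c\<bar>"]) auto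

lemma sq_int_diff[intro]: "sq_int Y \<Longrightarrow> sq_int Z \<Longrightarrow> sq_int (\<lambda>\<omega>. Y \<omega> - Z \<omega>)"
  using sq_int_add[of Y "\<lambda>\<omega>. (-1) * Z \<omega>"] sq_int_cmult[of Z "-1"] by simp

lemma sq_int_sum[intro]: "(\<And>i. i \<in> I \<Longrightarrow> sq_int (Y i)) \<Longrightarrow> sq_int (\<lambda>\<omega>. \<Sum>i\<in>I. Y i \<omega>)"
  by (induction I rule: infinite_finite_induct) auto

lemma sq_int_divide[intro]: "sq_int Y \<Longrightarrow> sq_int (\<lambda>\<omega>. Y \<omega> / c)"
  using sq_int_cmult[of Y "inverse c"] by (simp add: divide_inverse mult.commute)

lemma cov_commute: "cov Y Z = cov Z Y"
  by (simp add: cov_def mult.commute)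

lemma cov_add_left:
  "sq_int Y \<Longrightarrow> sq_int Y' \<Longrightarrow> sq_int Z \<Longrightarrow> cov (\<lambda>\<omega>. Y \<omega> + Y' \<omega>) Z = cov Y Z + cov Y' Z"
  by (simp add: cov_def distrib_right sq_int_mult_integrable sq_int_integrable)

lemma cov_add_right:
  "sq_int Y \<Longrightarrow> sq_int Y' \<Longrightarrow> sq_int Z \<Longrightarrow> cov Z (\<lambda>\<omega>. Y \<omega> + Y' \<omega>) = cov Z Y + cov Z Y'"
  using cov_add_left cov_commute by metis

lemma cov_cmult_left: "cov (\<lambda>\<omega>. c * Y \<omega>) Z = c * cov Y Z"
  by (simp add: cov_def right_diff_distrib mult.assoc)

lemma cov_cmult_right: "cov Y (\<lambda>\<omega>. c * Z \<omega>) = c * cov Y Z"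
  using cov_cmult_left cov_commute by metis

lemma cov_const_left[simp]: "cov (\<lambda>\<omega>. c) Z = 0"
  by (simp add: cov_def prob_space)

lemma cov_const_right[simp]: "cov Z (\<lambda>\<omega>. c) = 0"
  by (simp add: cov_def prob_space)

lemma cov_diff_const_left: "sq_int Y \<Longrightarrow> sq_int Z \<Longrightarrow> cov (\<lambda>\<omega>. Y \<omega> - c) Z = cov Y Z"
  using cov_add_left[of Y "\<lambda>_. -c" Z] by simp

lemma cov_diff_const_right: "sq_int Y \<Longrightarrow> sq_int Z \<Longrightarrow> cov Z (\<lambda>\<omega>. Y \<omega> - c) = cov Z Y"
  using cov_diff_const_left cov_commute by metis

lemma cov_sum_left:
  assumes "\<And>i. i \<in> I \<Longrightarrow> sq_int (Y i)" "sq_int Z"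
  shows "cov (\<lambda>\<omega>. \<Sum>i\<in>I. Y i \<omega>) Z = (\<Sum>i\<in>I. cov (Y i) Z)"
  using assms
proof (induction I rule: infinite_finite_induct)
  case (insert x F)
  have "sq_int (\<lambda>\<omega>. \<Sum>i\<in>F. Y i \<omega>)" using insert.prems by auto
  then show ?case using insert by (simp add: cov_add_left)
qed simp_all

lemma cov_sum_right:
  assumes "\<And>i. i \<in> I \<Longrightarrow> sq_int (Y i)" "sq_int Z"
  shows "cov Z (\<lambda>\<omega>. \<Sum>i\<in>I. Y i \<omega>) = (\<Sum>i\<in>I. cov Z (Y i))"
  using cov_sum_left[OF assms] by (simp add: cov_commute)

text \<open>
  The quadratic form of the second moments of \<open>Y\<close> and \<open>Z\<close> is positive semidefinite, and a
  factorisation of it makes the inequality evident.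
\<close>
lemma expectation_Cauchy_Schwarz:
  assumes "sq_int Y" "sq_int Z"
  shows "\<bar>expectation (\<lambda>\<omega>. Y \<omega> * Z \<omega>)\<bar> \<le>
    sqrt (expectation (\<lambda>\<omega>. (Y \<omega>)\<^sup>2)) * sqrt (expectation (\<lambda>\<omega>. (Z \<omega>)\<^sup>2))"
proof -
  let ?a = "expectation (\<lambda>\<omega>. (Y \<omega>)\<^sup>2)" and ?b = "expectation (\<lambda>\<omega>. Y \<omega> * Z \<omega>)"
    and ?c = "expectation (\<lambda>\<omega>. (Z \<omega>)\<^sup>2)"
  note int = assms[THEN sq_int_square] sq_int_mult_integrable[OF assms]
  have "?a * x\<^sup>2 + 2 * ?b * x * y + ?c * y\<^sup>2 \<ge> 0" for x y
  proof -
    have "0 \<le> expectation (\<lambda>\<omega>. (Y \<omega> * x + Z \<omega> * y)\<^sup>2)" by simp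
    also have "(\<lambda>\<omega>. (Y \<omega> * x + Z \<omega> * y)\<^sup>2) =
      (\<lambda>\<omega>. (Y \<omega>)\<^sup>2 * x\<^sup>2 + (Y \<omega> * Z \<omega>) * (2 * x * y) + (Z \<omega>)\<^sup>2 * y\<^sup>2)"
      by (auto simp: power2_eq_square algebra_simps)
    also have "expectation \<dots> = ?a * x\<^sup>2 + ?b * (2 * x * y) + ?c * y\<^sup>2"
      using int by simp
    finally show ?thesis by (simp add: algebra_simps)
  qed
  from psd2_factor[OF this] obtain p q r
    where *: "p\<^sup>2 = ?a" "p * q = ?b" "q\<^sup>2 + r\<^sup>2 = ?c" by blast
  have "\<bar>?b\<bar> = sqrt (p\<^sup>2) * sqrt (q\<^sup>2)" by (simp add: *(2)[symmetric] abs_mult)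
  also have "\<dots> \<le> sqrt ?a * sqrt ?c"
    unfolding *(1,3)[symmetric] by (intro mult_left_mono real_sqrt_le_mono) auto
  finally show ?thesis .
qed

lemma cov_centered:
  assumes "sq_int Y" "sq_int Z"
  shows "cov Y Z = expectation (\<lambda>\<omega>. (Y \<omega> - expectation Y) * (Z \<omega> - expectation Z))"
proof -
  have "cov Y Z = cov (\<lambda>\<omega>. Y \<omega> - expectation Y) (\<lambda>\<omega>. Z \<omega> - expectation Z)"
    using assms by (simp add: cov_diff_const_left cov_diff_const_right sq_int_diff)
  also have "expectation (\<lambda>\<omega>. Y \<omega> - expectation Y) = 0"
    using sq_int_integrable[OF assms(1)] by (simp add: prob_space)
  then have "cov (\<lambda>\<omega>. Y \<omega> - expectation Y) (\<lambda>\<omega>. Z \<omega> - expectation Z) =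
    expectation (\<lambda>\<omega>. (Y \<omega> - expectation Y) * (Z \<omega> - expectation Z))"
    unfolding cov_def by simp
  finally show ?thesis .
qed

lemma cov_self: "sq_int Y \<Longrightarrow> cov Y Y = variance Y"
  by (simp add: cov_centered power2_eq_square)

lemma cov_self_nonneg: "sq_int Y \<Longrightarrow> 0 \<le> cov Y Y"
  by (simp add: cov_self)

lemma cov_self_le: "cov Y Y \<le> expectation (\<lambda>\<omega>. (Y \<omega>)\<^sup>2)"
  by (simp add: cov_def power2_eq_square)

lemma cov_Cauchy_Schwarz:
  assumes "sq_int Y" "sq_int Z"
  shows "\<bar>cov Y Z\<bar> \<le> sqrt (cov Y Y) * sqrt (cov Z Z)"
  using expectation_Cauchy_Schwarz[OF sq_int_diff sq_int_diff, of Y "\<lambda>_. expectation Y" Z "\<lambda>_. expectation Z"] assms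
  by (simp add: cov_centered power2_eq_square)

lemma L2_triangle:
  assumes "sq_int Y" "sq_int Z"
  shows "sqrt (expectation (\<lambda>\<omega>. (Y \<omega> + Z \<omega>)\<^sup>2)) \<le>
    sqrt (expectation (\<lambda>\<omega>. (Y \<omega>)\<^sup>2)) + sqrt (expectation (\<lambda>\<omega>. (Z \<omega>)\<^sup>2))"
proof (rule real_le_lsqrt)
  let ?a = "expectation (\<lambda>\<omega>. (Y \<omega>)\<^sup>2)" and ?b = "expectation (\<lambda>\<omega>. Y \<omega> * Z \<omega>)"
    and ?c = "expectation (\<lambda>\<omega>. (Z \<omega>)\<^sup>2)"
  have "expectation (\<lambda>\<omega>. (Y \<omega> + Z \<omega>)\<^sup>2) = ?a + 2 * ?b + ?c"
    using sq_int_mult_integrable[OF assms] assms[THEN sq_int_square]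
    by (simp add: power2_sum mult.assoc)
  also have "\<dots> \<le> (sqrt ?a + sqrt ?c)\<^sup>2"
    using expectation_Cauchy_Schwarz[OF assms] by (simp add: power2_sum)
  finally show "expectation (\<lambda>\<omega>. (Y \<omega> + Z \<omega>)\<^sup>2) \<le> (sqrt ?a + sqrt ?c)\<^sup>2" .
qed simp

lemma L2_triangle_sum:
  assumes "\<And>i. i \<in> I \<Longrightarrow> sq_int (Y i)"
  shows "sqrt (expectation (\<lambda>\<omega>. (\<Sum>i\<in>I. Y i \<omega>)\<^sup>2)) \<le>
    (\<Sum>i\<in>I. sqrt (expectation (\<lambda>\<omega>. (Y i \<omega>)\<^sup>2)))"
  using assms
proof (induction I rule: infinite_finite_induct)
  case (insert x F)
  have "sq_int (\<lambda>\<omega>. \<Sum>i\<in>F. Y i \<omega>)" using insert.prems by auto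
  then have "sqrt (expectation (\<lambda>\<omega>. (Y x \<omega> + (\<Sum>i\<in>F. Y i \<omega>))\<^sup>2)) \<le>
    sqrt (expectation (\<lambda>\<omega>. (Y x \<omega>)\<^sup>2)) + sqrt (expectation (\<lambda>\<omega>. (\<Sum>i\<in>F. Y i \<omega>)\<^sup>2))"
    using insert.prems by (intro L2_triangle) auto
  then show ?case using insert by fastforce
qed simp_all

lemma expectation_abs_le_L2:
  assumes "sq_int Y"
  shows "expectation (\<lambda>\<omega>. \<bar>Y \<omega>\<bar>) \<le> sqrt (expectation (\<lambda>\<omega>. (Y \<omega>)\<^sup>2))"
proof -
  have "sq_int (\<lambda>\<omega>. \<bar>Y \<omega>\<bar>)" using assms by (auto simp: sq_int_def intro: borel_measurable_abs)
  from expectation_Cauchy_Schwarz[OF this sq_int_const[of 1]] show ?thesis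
    by (simp add: prob_space)
qed

text \<open>
  A sum of identically distributed, nearly uncorrelated variables: the cross terms are counted with
  the crude factor \<open>G\<^sup>2\<close>, which is harmless when \<open>G * \<delta>\<close> is small.
\<close>
lemma cov_sum_nearly_uncorrelated:
  assumes sq: "\<And>j. j < G \<Longrightarrow> sq_int (Y j)"
    and v: "\<And>j. j < G \<Longrightarrow> cov (Y j) (Y j) = v"
    and d: "\<And>i j. i < j \<Longrightarrow> j < G \<Longrightarrow> \<bar>cov (Y i) (Y j)\<bar> \<le> d"
  shows "\<bar>cov (\<lambda>\<omega>. \<Sum>j<G. Y j \<omega>) (\<lambda>\<omega>. \<Sum>j<G. Y j \<omega>) - real G * v\<bar> \<le> (real G)\<^sup>2 * \<bar>d\<bar>"
proof -
  have eq: "cov (\<lambda>\<omega>. \<Sum>j<G. Y j \<omega>) (\<lambda>\<omega>. \<Sum>j<G. Y j \<omega>) = (\<Sum>i<G. \<Sum>j<G. cov (Y i) (Y j))"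
    by (subst cov_sum_left; (intro sum.cong refl cov_sum_right)?) (use sq in auto)
  have "cov (\<lambda>\<omega>. \<Sum>j<G. Y j \<omega>) (\<lambda>\<omega>. \<Sum>j<G. Y j \<omega>) - real G * v =
      (\<Sum>i<G. \<Sum>j<G. if i = j then 0 else cov (Y i) (Y j))"
  proof -
    have "real G * v = (\<Sum>i<G. \<Sum>j<G. if i = j then v else 0)"
      by (simp add: sum.delta)
    then show ?thesis unfolding eq
      by (simp add: sum_subtractf[symmetric] del: sum.delta sum.delta')
        (intro sum.cong refl, auto simp: v)
  qed
  also have "\<bar>\<dots>\<bar> \<le> (\<Sum>i<G. \<Sum>j<G. \<bar>d\<bar>)"
  proof (intro order_trans[OF sum_abs] sum_mono)
    fix i j assume "i \<in> {..<G}" "j \<in> {..<G}"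
    then show "\<bar>if i = j then 0 else cov (Y i) (Y j)\<bar> \<le> \<bar>d\<bar>"
      using d[of i j] d[of j i] cov_commute[of "Y i" "Y j"]
      by (cases i j rule: linorder_cases) auto
  qed
  also have "\<dots> = (real G)\<^sup>2 * \<bar>d\<bar>" by (simp add: power2_eq_square)
  finally show ?thesis .
qed

end

section \<open>Bounds for characteristic functions\<close>

lemma norm_iexp_diff_le: "norm (iexp x - iexp y) \<le> \<bar>x - y\<bar>"
proof -
  have "iexp x = iexp y * iexp (x - y)"
    by (simp add: algebra_simps flip: exp_add)
  then have "iexp x - iexp y = iexp y * (iexp (x - y) - 1)"
    by (simp only: right_diff_distrib mult_1_right)
  also have "norm \<dots> = norm (iexp (x - y) - 1)" by (simp add: norm_mult)
  also have "\<dots> \<le> \<bar>x - y\<bar>" using iexp_approx1[of "x - y" 0] by simp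
  finally show ?thesis .
qed

lemma iexp_cos_sin: "iexp x = Complex (cos x) (sin x)"
  by (simp add: complex_eq_iff flip: cis_conv_exp)

lemma exp_minus_quadratic_bound:
  fixes x :: real
  assumes "x \<ge> 0"
  shows "\<bar>exp (- x) - (1 - x)\<bar> \<le> x\<^sup>2"
proof -
  have 1: "exp (- x) \<ge> 1 - x" using exp_ge_add_one_self[of "- x"] by simp
  have "(1 + x) * exp (- x) \<le> exp x * exp (- x)"
    by (intro mult_right_mono exp_ge_add_one_self) simp
  then have "exp (- x) * (1 + x) \<le> 1" by (simp add: mult_exp_exp mult.commute)
  also have "\<dots> \<le> (1 - x + x\<^sup>2) * (1 + x)"
    using assms by (simp add: algebra_simps power2_eq_square)
  finally have "exp (- x) \<le> 1 - x + x\<^sup>2"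
    using assms by (subst (asm) mult_le_cancel_right) auto
  then show ?thesis using 1 by simp
qed

lemma square_le_1_powr:
  fixes x p :: real
  assumes "p > 1"
  shows "x\<^sup>2 \<le> 1 + \<bar>x\<bar> powr (2 * p)"
proof (cases "\<bar>x\<bar> \<le> 1")
  case True
  then have "x\<^sup>2 \<le> 1" by (simp add: abs_square_le_1)
  then show ?thesis by (simp add: add_increasing2)
next
  case False
  then have "\<bar>x\<bar> powr 2 \<le> \<bar>x\<bar> powr (2 * p)" using assms by (intro powr_mono) auto
  then show ?thesis using False by simp
qed

text \<open>Every summand is at most the largest one, whose power occurs on the right-hand side.\<close>
lemma powr_sum_le:
  fixes x :: "'i \<Rightarrow> real"
  assumes "finite I" "s \<ge> 0"
  shows "\<bar>\<Sum>i\<in>I. x i\<bar> powr s \<le> real (card I) powr s * (\<Sum>i\<in>I. \<bar>x i\<bar> powr s)"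
proof (cases "I = {}")
  case False
  define m where "m = Max ((\<lambda>i. \<bar>x i\<bar>) ` I)"
  have fin: "finite ((\<lambda>i. \<bar>x i\<bar>) ` I)" using assms by simp
  have "m \<in> (\<lambda>i. \<bar>x i\<bar>) ` I" unfolding m_def using False by (intro Max_in fin) auto
  then obtain i where i: "i \<in> I" "m = \<bar>x i\<bar>" by auto
  have "\<bar>\<Sum>i\<in>I. x i\<bar> \<le> (\<Sum>i\<in>I. \<bar>x i\<bar>)" by (rule sum_abs)
  also have "\<dots> \<le> (\<Sum>i\<in>I. m)" unfolding m_def by (intro sum_mono Max_ge fin) auto
  finally have "\<bar>\<Sum>i\<in>I. x i\<bar> \<le> real (card I) * m" by simp
  then have "\<bar>\<Sum>i\<in>I. x i\<bar> powr s \<le> (real (card I) * m) powr s"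
    using assms by (intro powr_mono2) auto
  also have "\<dots> = real (card I) powr s * \<bar>x i\<bar> powr s"
    using i by (simp add: powr_mult)
  also have "\<dots> \<le> real (card I) powr s * (\<Sum>i\<in>I. \<bar>x i\<bar> powr s)"
    using i assms by (intro mult_left_mono member_le_sum) auto
  finally show ?thesis .
qed simp

context prob_space
begin

lemma norm_expectation_iexp_diff_le:
  assumes "sq_int Y" "sq_int Z"
  shows "norm (expectation (\<lambda>\<omega>. iexp (Y \<omega>)) - expectation (\<lambda>\<omega>. iexp (Z \<omega>)))
    \<le> sqrt (expectation (\<lambda>\<omega>. (Y \<omega> - Z \<omega>)\<^sup>2))"
proof -
  have [measurable]: "random_variable borel Y" "random_variable borel Z"
    using assms by (auto intro: sq_int_measurable)
  have int: "integrable M (\<lambda>\<omega>. iexp (Y \<omega>))" "integrable M (\<lambda>\<omega>. iexp (Z \<omega>))"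
    by (intro integrable_const_bound[where B=1]; simp)+
  have "norm (expectation (\<lambda>\<omega>. iexp (Y \<omega>)) - expectation (\<lambda>\<omega>. iexp (Z \<omega>))) =
      norm (expectation (\<lambda>\<omega>. iexp (Y \<omega>) - iexp (Z \<omega>)))"
    using int by simp
  also have "\<dots> \<le> expectation (\<lambda>\<omega>. norm (iexp (Y \<omega>) - iexp (Z \<omega>)))"
    by (rule integral_norm_bound)
  also have "\<dots> \<le> expectation (\<lambda>\<omega>. \<bar>Y \<omega> - Z \<omega>\<bar>)"
    by (intro integral_mono norm_iexp_diff_le integrable_norm Bochner_Integration.integrable_diff int
        integrable_abs) (auto intro: assms sq_int_integrable)
  also have "\<dots> \<le> sqrt (expectation (\<lambda>\<omega>. (Y \<omega> - Z \<omega>)\<^sup>2))"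
    using expectation_abs_le_L2[OF sq_int_diff[OF assms]] .
  finally show ?thesis .
qed

text \<open>
  By the addition theorems, real and imaginary part of the difference are each made of two covariances
  of sines and cosines.
\<close>
lemma norm_iexp_product_le:
  assumes [measurable]: "random_variable borel X" "random_variable borel Y"
    and d: "\<And>f g :: real \<Rightarrow> real. f \<in> {sin, cos} \<Longrightarrow> g \<in> {sin, cos} \<Longrightarrow>
      \<bar>cov (\<lambda>\<omega>. f (X \<omega>)) (\<lambda>\<omega>. g (Y \<omega>))\<bar> \<le> d"
  shows "norm (expectation (\<lambda>\<omega>. iexp (X \<omega> + Y \<omega>)) -
    expectation (\<lambda>\<omega>. iexp (X \<omega>)) * expectation (\<lambda>\<omega>. iexp (Y \<omega>))) \<le> 4 * d"
proof -
  have int: "integrable M (\<lambda>\<omega>. iexp (Z \<omega>))" if [measurable]: "random_variable borel Z" for Z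
    by (intro integrable_const_bound[where B=1]) auto
  have int2: "integrable M (\<lambda>\<omega>. f (X \<omega>) * g (Y \<omega>))" if "f \<in> {sin, cos}" "g \<in> {sin, cos}"
    for f g :: "real \<Rightarrow> real"
    using that by (intro integrable_const_bound[where B=1])
      (auto simp: abs_mult intro!: mult_le_one)
  have Re: "Re (expectation (\<lambda>\<omega>. iexp (Z \<omega>))) = expectation (\<lambda>\<omega>. cos (Z \<omega>))"
    and Im: "Im (expectation (\<lambda>\<omega>. iexp (Z \<omega>))) = expectation (\<lambda>\<omega>. sin (Z \<omega>))"
    if "random_variable borel Z" for Z
    using int[OF that] by (simp_all add: integral_Re[symmetric] integral_Im[symmetric] iexp_cos_sin)
  have [measurable]: "random_variable borel (\<lambda>\<omega>. X \<omega> + Y \<omega>)" by measurable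
  let ?D = "expectation (\<lambda>\<omega>. iexp (X \<omega> + Y \<omega>)) -
    expectation (\<lambda>\<omega>. iexp (X \<omega>)) * expectation (\<lambda>\<omega>. iexp (Y \<omega>))"
  let ?c = "\<lambda>f g. cov (\<lambda>\<omega>. f (X \<omega>)) (\<lambda>\<omega>. g (Y \<omega>))"
  have "Re ?D = ?c cos cos - ?c sin sin"
    using int2[of cos cos] int2[of sin sin] Re[of "\<lambda>\<omega>. X \<omega> + Y \<omega>"]
    by (simp add: Re Im cos_add cov_def)
  moreover have "Im ?D = ?c sin cos + ?c cos sin"
    using int2[of cos sin] int2[of sin cos] Im[of "\<lambda>\<omega>. X \<omega> + Y \<omega>"]
    by (simp add: Re Im sin_add cov_def)
  moreover have "norm ?D \<le> \<bar>Re ?D\<bar> + \<bar>Im ?D\<bar>" by (rule cmod_le)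
  ultimately show ?thesis
    using d[of cos cos] d[of sin sin] d[of cos sin] d[of sin cos] by simp
qed

text \<open>
  The Lyapunov form of the second-order expansion of a characteristic function: the remainder is
  split at the level \<open>\<bar>B\<bar> = N powr (1/4)\<close>, which tends to infinity but is small compared with
  \<open>sqrt N\<close>.
\<close>
lemma char_expansion_Lyapunov:
  assumes B: "sq_int B" "expectation B = 0" and Bp: "integrable M (\<lambda>\<omega>. \<bar>B \<omega>\<bar> powr (2 * p))"
    and p: "p > 1" and N: "N > 0"
  shows "norm (expectation (\<lambda>\<omega>. iexp (B \<omega> / sqrt N)) -
      (1 - expectation (\<lambda>\<omega>. (B \<omega>)\<^sup>2) / (2 * N)))
    \<le> 1 / (6 * N) * (N powr (- 1/4) * expectation (\<lambda>\<omega>. (B \<omega>)\<^sup>2) +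
        6 * N powr ((1 - p) / 2) * expectation (\<lambda>\<omega>. \<bar>B \<omega>\<bar> powr (2 * p)))"
proof -
  let ?t = "1 / sqrt N" and ?R = "N powr (1/4)"
  have [measurable]: "random_variable borel B" using B by (auto intro: sq_int_measurable)
  have intB: "integrable M (\<lambda>\<omega>. (B \<omega>)\<^sup>2)" using B by (auto intro: sq_int_square)
  have tR: "?t * ?R = N powr (- 1/4)"
  proof -
    have "?t * ?R = N powr (1/4) / N powr (1/2)" using N by (simp add: powr_half_sqrt)
    also have "\<dots> = N powr (1/4 - 1/2)" by (rule powr_diff[symmetric])
    finally show ?thesis by simp
  qed
  have bound: "min (6 * b\<^sup>2) (\<bar>?t\<bar> * \<bar>b\<bar> ^ 3) \<le>
      N powr (- 1/4) * b\<^sup>2 + 6 * N powr ((1 - p) / 2) * \<bar>b\<bar> powr (2 * p)" for b :: real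
  proof (cases "\<bar>b\<bar> \<le> ?R")
    case True
    have "min (6 * b\<^sup>2) (\<bar>?t\<bar> * \<bar>b\<bar> ^ 3) \<le> \<bar>?t\<bar> * \<bar>b\<bar> ^ 3" by simp
    also have "\<dots> = ?t * \<bar>b\<bar> * b\<^sup>2" using N by (simp add: power3_eq_cube power2_eq_square abs_mult_self_eq mult.assoc)
    also have "\<dots> \<le> ?t * ?R * b\<^sup>2" using N True by (intro mult_right_mono mult_left_mono) auto
    also have "\<dots> \<le> N powr (- 1/4) * b\<^sup>2 + 6 * N powr ((1 - p) / 2) * \<bar>b\<bar> powr (2 * p)"
      unfolding tR by simp
    finally show ?thesis .
  next
    case False
    then have b: "\<bar>b\<bar> > ?R" "?R > 0" using N by auto
    then have b0: "\<bar>b\<bar> > 0" by linarith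
    have "\<bar>b\<bar> powr (2 - 2 * p) \<le> ?R powr (2 - 2 * p)"
      using b p by (intro powr_mono2') auto
    also have "1 / 4 * (2 - 2 * p) = (1 - p) / 2" by (simp add: field_simps)
    then have "?R powr (2 - 2 * p) = N powr ((1 - p) / 2)" by (simp only: powr_powr)
    finally have *: "\<bar>b\<bar> powr (2 - 2 * p) \<le> N powr ((1 - p) / 2)" .
    have "min (6 * b\<^sup>2) (\<bar>?t\<bar> * \<bar>b\<bar> ^ 3) \<le> 6 * b\<^sup>2" by simp
    also have "\<dots> = 6 * (\<bar>b\<bar> powr (2 - 2 * p) * \<bar>b\<bar> powr (2 * p))"
      using b0 by (simp add: powr_add[symmetric])
    also have "6 * (\<bar>b\<bar> powr (2 - 2 * p) * \<bar>b\<bar> powr (2 * p)) \<le> 6 * (N powr ((1 - p) / 2) * \<bar>b\<bar> powr (2 * p))"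
      using * by (intro mult_left_mono mult_right_mono) auto
    also have "\<dots> \<le> N powr (- 1/4) * b\<^sup>2 + 6 * N powr ((1 - p) / 2) * \<bar>b\<bar> powr (2 * p)"
      by simp
    finally show ?thesis .
  qed
  have var: "variance B = expectation (\<lambda>\<omega>. (B \<omega>)\<^sup>2)" using B by simp
  have "cmod (char (distr M borel B) ?t - (1 - ?t\<^sup>2 * expectation (\<lambda>\<omega>. (B \<omega>)\<^sup>2) / 2)) \<le>
      (?t\<^sup>2 / 6) * expectation (\<lambda>\<omega>. min (6 * (B \<omega>)\<^sup>2) (\<bar>?t\<bar> * \<bar>B \<omega>\<bar> ^ 3))"
    by (rule char_approx3'[OF _ sq_int_integrable intB B(2) var refl]) (use B in auto)
  also have "\<dots> \<le> (?t\<^sup>2 / 6) * expectation (\<lambda>\<omega>. N powr (- 1/4) * (B \<omega>)\<^sup>2 +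
      6 * N powr ((1 - p) / 2) * \<bar>B \<omega>\<bar> powr (2 * p))"
  proof (intro mult_left_mono integral_mono bound)
    show "integrable M (\<lambda>\<omega>. min (6 * (B \<omega>)\<^sup>2) (\<bar>?t\<bar> * \<bar>B \<omega>\<bar> ^ 3))"
      by (rule Bochner_Integration.integrable_bound[where f="\<lambda>\<omega>. 6 * (B \<omega>)\<^sup>2"]) (use intB in auto)
  qed (use intB Bp in auto)
  also have "\<dots> = 1 / (6 * N) * (N powr (- 1/4) * expectation (\<lambda>\<omega>. (B \<omega>)\<^sup>2) +
        6 * N powr ((1 - p) / 2) * expectation (\<lambda>\<omega>. \<bar>B \<omega>\<bar> powr (2 * p)))"
    using intB Bp N by (simp add: power_divide)
  also have "char (distr M borel B) ?t = expectation (\<lambda>\<omega>. iexp (B \<omega> / sqrt N))"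
    unfolding char_def by (subst integral_distr) auto
  also have "?t\<^sup>2 * expectation (\<lambda>\<omega>. (B \<omega>)\<^sup>2) / 2 = expectation (\<lambda>\<omega>. (B \<omega>)\<^sup>2) / (2 * N)"
    using N by (simp add: power_divide)
  finally show ?thesis by simp
qed

end

section \<open>A central limit theorem for arrays of block contributions\<close>

context prob_space
begin

lemma expectation_cong_distr:
  fixes f :: "real \<Rightarrow> 'c::{banach, second_countable_topology}"
  assumes "random_variable borel X" "random_variable borel Y" "distr M borel X = distr M borel Y"
    "f \<in> borel_measurable borel"
  shows "expectation (\<lambda>\<omega>. f (X \<omega>)) = expectation (\<lambda>\<omega>. f (Y \<omega>))"
proof -
  have "expectation (\<lambda>\<omega>. f (X \<omega>)) = integral\<^sup>L (distr M borel X) f"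
    by (rule integral_distr[OF assms(1,4), symmetric])
  also have "\<dots> = integral\<^sup>L (distr M borel Y) f" by (simp only: assms(3))
  also have "\<dots> = expectation (\<lambda>\<omega>. f (Y \<omega>))" by (rule integral_distr[OF assms(2,4)])
  finally show ?thesis .
qed

text \<open>
  Bernstein's blocking argument for one row.  The groups \<open>B j\<close> of \<open>q\<close> terms are separated by pairs \<open>S j\<close>,
  and \<open>R\<close> is what remains after the last complete group.  The first two summands of the bound account
  for \<open>S\<close> and \<open>R\<close>, the third one for replacing the dependent groups by independent ones, the fourth one
  is the Lyapunov remainder of the groups, and the last one comes from replacing \<open>1 - x\<close> by \<open>exp (- x)\<close>
  for \<open>x = v / (2 * N)\<close>.  For fixed \<open>q\<close> all but the first vanish as \<open>N\<close> grows, provided that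
  \<open>N * \<delta>\<close> does; the first one then becomes small for large \<open>q\<close>.
\<close>
lemma bernstein_row:
  fixes W :: "nat \<Rightarrow> 'a \<Rightarrow> real" and K q :: nat and N \<delta> C p :: real
  defines "T \<equiv> \<lambda>I \<omega>. \<Sum>i\<in>I. W i \<omega>"
  defines "G \<equiv> K div (q + 2)"
  defines "v \<equiv> expectation (\<lambda>\<omega>. (T {..<q} \<omega>)\<^sup>2)"
  assumes W_sq: "\<And>i. sq_int (W i)"
    and mean: "\<And>i. i < K \<Longrightarrow> expectation (W i) = 0"
    and W_p: "\<And>i. integrable M (\<lambda>\<omega>. \<bar>W i \<omega>\<bar> powr (2 * p))"
    and p: "p > 1"
    and mom: "\<And>i. i < K \<Longrightarrow> expectation (\<lambda>\<omega>. \<bar>W i \<omega>\<bar> powr (2 * p)) \<le> C"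
    and mom2: "\<And>i. i < K \<Longrightarrow> expectation (\<lambda>\<omega>. (W i \<omega>)\<^sup>2) \<le> C"
    and stat: "\<And>a q. a + q \<le> K \<Longrightarrow> distr M borel (T {a..<a+q}) = distr M borel (T {..<q})"
    and mix: "\<And>b I I' (f :: real \<Rightarrow> real) (g :: real \<Rightarrow> real).
      b + 2 \<le> K \<Longrightarrow> I \<subseteq> {..<b} \<Longrightarrow> I' \<subseteq> {b+2..<K} \<Longrightarrow>
      f \<in> borel_measurable borel \<Longrightarrow> g \<in> borel_measurable borel \<Longrightarrow>
      sq_int (\<lambda>\<omega>. f (T I \<omega>)) \<Longrightarrow> sq_int (\<lambda>\<omega>. g (T I' \<omega>)) \<Longrightarrow>
      \<bar>cov (\<lambda>\<omega>. f (T I \<omega>)) (\<lambda>\<omega>. g (T I' \<omega>))\<bar> \<le>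
        \<delta> * (sqrt (expectation (\<lambda>\<omega>. (f (T I \<omega>))\<^sup>2)) * sqrt (expectation (\<lambda>\<omega>. (g (T I' \<omega>))\<^sup>2)))"
    and d0: "\<delta> \<ge> 0" and N: "N > 0" and KN: "real K \<le> 2 * N" and q: "2 \<le> q" "q \<le> K"
  shows "norm (expectation (\<lambda>\<omega>. iexp (T {..<K} \<omega> / sqrt N)) - exp (- (real G * v) / (2 * N))) \<le>
    sqrt (8 * C * (1 + 2 * N * \<delta>) / real (q + 2)) + real (q + 2) * sqrt (C / N) + 8 * (N * \<delta>) +
    (N powr (- 1/4) * ((real q)\<^sup>2 * C) + 6 * N powr ((1 - p) / 2) * (real q powr (2 * p) * (real q * C))) / 3 +
    ((real q)\<^sup>2 * C)\<^sup>2 / (2 * N)"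
proof -
  define m where "m = q + 2"
  define B where "B j = {j * m..<j * m + q}" for j
  define S where "S j = {j * m + q..<j * m + m}" for j
  define R where "R = {G * m..<K}"
  have GmK: "G * m \<le> K" "K < G * m + m"
    using div_times_less_eq_dividend[of K m] dividend_less_div_times[of m K]
    by (auto simp: G_def m_def)
  have jm: "j * m + m \<le> K" if "j < G" for j
  proof -
    have "(j + 1) * m \<le> G * m" using that by (intro mult_right_mono) auto
    then show ?thesis using GmK by simp
  qed
  have "K > 0" using q by simp
  have C0: "C \<ge> 0"
    using mom2[OF \<open>K > 0\<close>] by (rule order_trans[rotated]) simp
  have T_sq: "sq_int (T I)" for I unfolding T_def using W_sq by auto
  have [measurable]: "random_variable borel (T I)" for I
    by (intro sq_int_measurable T_sq)
  have T_mean: "expectation (T I) = 0" if "I \<subseteq> {..<K}" for I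
  proof -
    have "expectation (T I) = (\<Sum>i\<in>I. expectation (W i))"
      unfolding T_def by (rule Bochner_Integration.integral_sum) (rule sq_int_integrable[OF W_sq])
    also have "\<dots> = 0" using that mean by (intro sum.neutral) auto
    finally show ?thesis .
  qed
  have T_L2: "sqrt (expectation (\<lambda>\<omega>. (T I \<omega>)\<^sup>2)) \<le> real (card I) * sqrt C" if "I \<subseteq> {..<K}" for I
  proof -
    have "sqrt (expectation (\<lambda>\<omega>. (T I \<omega>)\<^sup>2)) \<le> (\<Sum>i\<in>I. sqrt (expectation (\<lambda>\<omega>. (W i \<omega>)\<^sup>2)))"
      unfolding T_def by (rule L2_triangle_sum) (rule W_sq)
    also have "\<dots> \<le> (\<Sum>i\<in>I. sqrt C)" using that mom2 by (intro sum_mono real_sqrt_le_mono) auto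
    finally show ?thesis by simp
  qed
  have T_L2': "expectation (\<lambda>\<omega>. (T I \<omega>)\<^sup>2) \<le> (real (card I))\<^sup>2 * C" if "I \<subseteq> {..<K}" for I
    using power_mono[OF T_L2[OF that], of 2] C0 by (simp add: power_mult_distrib)
  have BK: "B j \<subseteq> {..<K}" "S j \<subseteq> {..<K}" if "j < G" for j
    using jm[OF that] by (auto simp: B_def S_def m_def)
  have RK: "R \<subseteq> {..<K}" by (auto simp: R_def)
  have split: "T {..<K} \<omega> = (\<Sum>j<G. T (B j) \<omega>) + ((\<Sum>j<G. T (S j) \<omega>) + T R \<omega>)" for \<omega>
  proof -
    have "T {..<K} \<omega> = T {0..<G * m} \<omega> + T {G * m..<K} \<omega>"
      unfolding T_def using GmK by (simp add: sum.atLeastLessThan_concat lessThan_atLeast0)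
    also have "T {0..<G * m} \<omega> = (\<Sum>j<G. T {j * m..<j * m + m} \<omega>)"
      unfolding T_def by (simp only: sum.nat_group lessThan_atLeast0[symmetric])
    also have "\<dots> = (\<Sum>j<G. T (B j) \<omega> + T (S j) \<omega>)"
      unfolding T_def B_def S_def by (intro sum.cong refl sum.atLeastLessThan_concat[symmetric]) (auto simp: m_def)
    finally show ?thesis by (simp add: R_def sum.distrib)
  qed
  let ?SN = "sqrt N"
  define \<phi> where "\<phi> = expectation (\<lambda>\<omega>. iexp (T {..<q} \<omega> / ?SN))"
  have E1: "norm (expectation (\<lambda>\<omega>. iexp (Y \<omega>))) \<le> 1" if "random_variable borel Y" for Y
  proof -
    have "norm (expectation (\<lambda>\<omega>. iexp (Y \<omega>))) \<le> expectation (\<lambda>\<omega>. norm (iexp (Y \<omega>)))"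
      by (rule integral_norm_bound)
    then show ?thesis by (simp add: prob_space)
  qed
  have \<phi>1: "norm \<phi> \<le> 1" unfolding \<phi>_def by (rule E1) measurable
  \<comment> \<open>the pairs are far apart, so their variances essentially add up\<close>
  have small: "expectation (\<lambda>\<omega>. (\<Sum>j<G. T (S j) \<omega>)\<^sup>2) \<le> real G * (4 * C) + (real G)\<^sup>2 * (\<delta> * (4 * C))"
  proof -
    have cardS: "card (S j) = 2" for j by (simp add: S_def m_def)
    have vS: "cov (T (S j)) (T (S j)) = expectation (\<lambda>\<omega>. (T {..<2} \<omega>)\<^sup>2)" if "j < G" for j
    proof -
      have "distr M borel (T (S j)) = distr M borel (T {..<2})"
        using stat[of "j * m + q" 2] jm[OF that] by (simp add: S_def m_def add.assoc)
      then have "expectation (\<lambda>\<omega>. (T (S j) \<omega>)\<^sup>2) = expectation (\<lambda>\<omega>. (T {..<2} \<omega>)\<^sup>2)"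
        by (intro expectation_cong_distr[where f="\<lambda>x. x\<^sup>2"]) auto
      then show ?thesis using T_mean[OF BK(2)[OF that]] by (simp add: cov_def power2_eq_square)
    qed
    have cS: "\<bar>cov (T (S i)) (T (S j))\<bar> \<le> \<delta> * (4 * C)" if ij: "i < j" "j < G" for i j
    proof -
      have im: "(i + 1) * m \<le> j * m" using ij by (intro mult_right_mono) auto
      have "S i \<subseteq> {..<(i + 1) * m}" "S j \<subseteq> {(i + 1) * m + 2..<K}" "(i + 1) * m + 2 \<le> K"
        using im jm[OF ij(2)] q by (auto simp: S_def m_def)
      from mix[OF this(3) this(1,2), of "\<lambda>x. x" "\<lambda>x. x"]
      have "\<bar>cov (T (S i)) (T (S j))\<bar> \<le> \<delta> * (sqrt (expectation (\<lambda>\<omega>. (T (S i) \<omega>)\<^sup>2)) * sqrt (expectation (\<lambda>\<omega>. (T (S j) \<omega>)\<^sup>2)))"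
        using T_sq by simp
      also have "\<dots> \<le> \<delta> * ((2 * sqrt C) * (2 * sqrt C))"
        using T_L2[OF BK(2)[of i]] T_L2[OF BK(2)[of j]] ij d0 C0
        by (intro mult_left_mono mult_mono) (auto simp: cardS)
      finally show ?thesis using C0 by simp
    qed
    have "\<bar>cov (\<lambda>\<omega>. \<Sum>j<G. T (S j) \<omega>) (\<lambda>\<omega>. \<Sum>j<G. T (S j) \<omega>) - real G * expectation (\<lambda>\<omega>. (T {..<2} \<omega>)\<^sup>2)\<bar>
        \<le> (real G)\<^sup>2 * \<bar>\<delta> * (4 * C)\<bar>"
      by (rule cov_sum_nearly_uncorrelated) (use T_sq vS cS in auto)
    moreover have "expectation (\<lambda>\<omega>. \<Sum>j<G. T (S j) \<omega>) = 0"
      using T_sq T_mean BK by (subst Bochner_Integration.integral_sum) (auto intro: sq_int_integrable)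
    ultimately have "expectation (\<lambda>\<omega>. (\<Sum>j<G. T (S j) \<omega>)\<^sup>2) \<le>
        real G * expectation (\<lambda>\<omega>. (T {..<2} \<omega>)\<^sup>2) + (real G)\<^sup>2 * (\<delta> * (4 * C))"
      using d0 C0 by (simp add: cov_def power2_eq_square)
    also have "\<dots> \<le> real G * (4 * C) + (real G)\<^sup>2 * (\<delta> * (4 * C))"
      using T_L2'[of "{..<2}"] q by (intro add_right_mono mult_left_mono) auto
    finally show ?thesis .
  qed
  have GN: "real G * real m \<le> 2 * N"
    using GmK(1) KN by (metis of_nat_le_iff of_nat_mult order_trans)
  have G2: "real G \<le> 2 * N / real m" using GN by (simp add: m_def field_simps)
  have G3: "real G \<le> 2 * N"
  proof -
    have "2 * N / real m \<le> 2 * N / 1" using N by (intro divide_left_mono) (auto simp: m_def)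
    then show ?thesis using G2 by simp
  qed
  \<comment> \<open>drop the pairs and the incomplete last group\<close>
  have step1: "norm (expectation (\<lambda>\<omega>. iexp (T {..<K} \<omega> / ?SN)) -
      expectation (\<lambda>\<omega>. iexp ((\<Sum>j<G. T (B j) \<omega>) / ?SN))) \<le>
      sqrt (8 * C * (1 + 2 * N * \<delta>) / real m) + real m * sqrt (C / N)"
  proof -
    have sqS: "sq_int (\<lambda>\<omega>. \<Sum>j<G. T (S j) \<omega>)" using T_sq by auto
    have "norm (expectation (\<lambda>\<omega>. iexp (T {..<K} \<omega> / ?SN)) -
        expectation (\<lambda>\<omega>. iexp ((\<Sum>j<G. T (B j) \<omega>) / ?SN))) \<le>
      sqrt (expectation (\<lambda>\<omega>. (T {..<K} \<omega> / ?SN - (\<Sum>j<G. T (B j) \<omega>) / ?SN)\<^sup>2))"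
      by (intro norm_expectation_iexp_diff_le sq_int_divide sq_int_sum T_sq)
    also have "(\<lambda>\<omega>. (T {..<K} \<omega> / ?SN - (\<Sum>j<G. T (B j) \<omega>) / ?SN)\<^sup>2) =
        (\<lambda>\<omega>. ((\<Sum>j<G. T (S j) \<omega>) + T R \<omega>)\<^sup>2 / N)"
      unfolding split using N by (auto simp: diff_divide_distrib[symmetric] power_divide)
    also have "sqrt (expectation \<dots>) = sqrt (expectation (\<lambda>\<omega>. ((\<Sum>j<G. T (S j) \<omega>) + T R \<omega>)\<^sup>2)) / ?SN"
      by (simp add: real_sqrt_divide)
    also have "\<dots> \<le> (sqrt (expectation (\<lambda>\<omega>. (\<Sum>j<G. T (S j) \<omega>)\<^sup>2)) + sqrt (expectation (\<lambda>\<omega>. (T R \<omega>)\<^sup>2))) / ?SN"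
      by (intro divide_right_mono L2_triangle sqS T_sq) (use N in auto)
    also have "\<dots> \<le> (sqrt (real G * (4 * C) + (real G)\<^sup>2 * (\<delta> * (4 * C))) + real m * sqrt C) / ?SN"
    proof (intro divide_right_mono add_mono real_sqrt_le_mono small)
      have "card R \<le> m" using GmK by (simp add: R_def)
      then have "real (card R) * sqrt C \<le> real m * sqrt C" using C0 by (intro mult_right_mono) auto
      then show "sqrt (expectation (\<lambda>\<omega>. (T R \<omega>)\<^sup>2)) \<le> real m * sqrt C" using T_L2[OF RK] by simp
    qed (use N in auto)
    also have "\<dots> = sqrt ((real G * (4 * C) + (real G)\<^sup>2 * (\<delta> * (4 * C))) / N) + real m * sqrt (C / N)"
      by (simp only: add_divide_distrib[of _ _ "sqrt N"] real_sqrt_divide times_divide_eq_right)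
    also have "(real G * (4 * C) + (real G)\<^sup>2 * (\<delta> * (4 * C))) / N = real G * (4 * C) * (1 + real G * \<delta>) / N"
      by (simp add: algebra_simps power2_eq_square)
    also have "real G * (4 * C) * (1 + real G * \<delta>) / N \<le> (2 * N / real m) * (4 * C) * (1 + (2 * N) * \<delta>) / N"
      using C0 d0 N G2 G3 by (intro divide_right_mono mult_mono add_mono) auto
    also have "\<dots> = 8 * C * (1 + 2 * N * \<delta>) / real m"
    proof -
      have "2 * N / x * (4 * C) * y / N = 8 * C * y / x" for x y :: real using N by simp
      then show ?thesis .
    qed
    finally show ?thesis by simp
  qed
  \<comment> \<open>factorise the characteristic function group by group\<close>
  have step2: "norm (expectation (\<lambda>\<omega>. iexp ((\<Sum>j<J. T (B j) \<omega>) / ?SN)) - \<phi> ^ J) \<le> real J * (4 * \<delta>)"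
    if "J \<le> G" for J
    using that
  proof (induction J)
    case 0
    then show ?case by (simp add: prob_space)
  next
    case (Suc J)
    let ?X = "\<lambda>\<omega>. (\<Sum>j<J. T (B j) \<omega>) / ?SN" and ?Y = "\<lambda>\<omega>. T (B J) \<omega> / ?SN"
    have \<phi>J: "expectation (\<lambda>\<omega>. iexp (?Y \<omega>)) = \<phi>"
      unfolding \<phi>_def
      by (rule expectation_cong_distr[where f="\<lambda>x. iexp (x / ?SN)"])
        (use stat[of "J * m" q] jm[of J] Suc.prems in \<open>auto simp: B_def m_def\<close>)
    have h1: "norm (expectation (\<lambda>\<omega>. iexp (?X \<omega> + ?Y \<omega>)) -
      expectation (\<lambda>\<omega>. iexp (?X \<omega>)) * expectation (\<lambda>\<omega>. iexp (?Y \<omega>))) \<le> 4 * \<delta>"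
    proof (rule norm_iexp_product_le)
      fix f g :: "real \<Rightarrow> real" assume fg: "f \<in> {sin, cos}" "g \<in> {sin, cos}"
      then have fgm[measurable]: "f \<in> borel_measurable borel" "g \<in> borel_measurable borel" by auto
      have fg1: "\<bar>f x\<bar> \<le> 1" "\<bar>g x\<bar> \<le> 1" for x using fg by auto
      have L1: "sqrt (expectation (\<lambda>\<omega>. (h (T I \<omega> / ?SN))\<^sup>2)) \<le> 1"
        if h: "\<And>x. \<bar>h x\<bar> \<le> 1" "h \<in> borel_measurable borel" for h :: "real \<Rightarrow> real" and I
      proof -
        have [measurable]: "h \<in> borel_measurable borel" by (rule h)
        have h2: "(h x)\<^sup>2 \<le> 1" for x using h(1)[of x] by (simp add: abs_square_le_1)
        have "expectation (\<lambda>\<omega>. (h (T I \<omega> / ?SN))\<^sup>2) \<le> expectation (\<lambda>\<omega>. 1)"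
          using h2 by (intro integral_mono integrable_const_bound[where B=1]) auto
        then show ?thesis by (simp add: prob_space)
      qed
      show "\<bar>cov (\<lambda>\<omega>. f (?X \<omega>)) (\<lambda>\<omega>. g (?Y \<omega>))\<bar> \<le> \<delta>"
      proof (cases "J = 0")
        case True
        then show ?thesis using d0 by simp
      next
        case False
        let ?I = "\<Union>j<J. B j"
        have Jm: "j * m + m \<le> J * m" if "j < J" for j
        proof -
          have "(j + 1) * m \<le> J * m" using that by (intro mult_right_mono) auto
          then show ?thesis by simp
        qed
        have X: "(\<Sum>j<J. T (B j) \<omega>) = T ?I \<omega>" for \<omega>
          unfolding T_def
        proof (rule sum.UNION_disjoint[symmetric])
          show "\<forall>i\<in>{..<J}. \<forall>j\<in>{..<J}. i \<noteq> j \<longrightarrow> B i \<inter> B j = {}"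
          proof (intro ballI impI)
            fix i j :: nat assume "i \<noteq> j"
            then consider "i + 1 \<le> j" | "j + 1 \<le> i" by linarith
            then show "B i \<inter> B j = {}"
            proof cases
              case 1
              then have "(i + 1) * m \<le> j * m" by (rule mult_right_mono) simp
              then show ?thesis by (auto simp: B_def m_def)
            next
              case 2
              then have "(j + 1) * m \<le> i * m" by (rule mult_right_mono) simp
              then show ?thesis by (auto simp: B_def m_def)
            qed
          qed
        qed (auto simp: B_def)
        have "1 * m \<le> J * m" using False by (intro mult_right_mono) auto
        \<comment> \<open>the last group before position \<open>J * m\<close> ends two positions earlier\<close>
        then have m2: "J * m - 2 + 2 = J * m" by (simp add: m_def)
        have "?I \<subseteq> {..<J * m - 2}"
        proof
          fix x assume "x \<in> ?I"
          then obtain j where "j < J" "x < j * m + q" by (auto simp: B_def)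
          then show "x \<in> {..<J * m - 2}" using Jm[of j] by (simp add: m_def)
        qed
        moreover have "B J \<subseteq> {J * m - 2 + 2..<K}" "J * m - 2 + 2 \<le> K"
          unfolding m2 using jm[of J] Suc.prems by (auto simp: B_def m_def)
        ultimately have "\<bar>cov (\<lambda>\<omega>. f (T ?I \<omega> / ?SN)) (\<lambda>\<omega>. g (T (B J) \<omega> / ?SN))\<bar> \<le>
            \<delta> * (sqrt (expectation (\<lambda>\<omega>. (f (T ?I \<omega> / ?SN))\<^sup>2)) * sqrt (expectation (\<lambda>\<omega>. (g (T (B J) \<omega> / ?SN))\<^sup>2)))"
          by (intro mix[of "J * m - 2" ?I "B J" "\<lambda>x. f (x / ?SN)" "\<lambda>x. g (x / ?SN)"])
            (use fg1 in \<open>auto intro!: sq_int_bounded[where B=1]\<close>)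
        also have "\<dots> \<le> \<delta> * (1 * 1)"
          using d0 by (intro mult_left_mono mult_mono L1 fg1 fgm) auto
        finally show ?thesis unfolding X by simp
      qed
    qed measurable
    have "expectation (\<lambda>\<omega>. iexp (?X \<omega>)) * \<phi> - \<phi> ^ Suc J = (expectation (\<lambda>\<omega>. iexp (?X \<omega>)) - \<phi> ^ J) * \<phi>"
      by (simp only: left_diff_distrib power_Suc2)
    moreover have "norm ((expectation (\<lambda>\<omega>. iexp (?X \<omega>)) - \<phi> ^ J) * \<phi>) \<le> (real J * (4 * \<delta>)) * 1"
      unfolding norm_mult using Suc d0 \<phi>1 by (intro mult_mono) auto
    ultimately have h2: "norm (expectation (\<lambda>\<omega>. iexp (?X \<omega>)) * \<phi> - \<phi> ^ Suc J) \<le> (real J * (4 * \<delta>)) * 1"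
      by (simp only:)
    have "expectation (\<lambda>\<omega>. iexp ((\<Sum>j<Suc J. T (B j) \<omega>) / ?SN)) = expectation (\<lambda>\<omega>. iexp (?X \<omega> + ?Y \<omega>))"
      by (simp add: add_divide_distrib)
    then have "norm (expectation (\<lambda>\<omega>. iexp ((\<Sum>j<Suc J. T (B j) \<omega>) / ?SN)) - \<phi> ^ Suc J) \<le>
        4 * \<delta> + (real J * (4 * \<delta>)) * 1"
      using norm_diff_triangle_le[OF h1[unfolded \<phi>J] h2] by (simp only:)
    then show ?case by (simp add: algebra_simps)
  qed
  have qK: "{..<q} \<subseteq> {..<K}" using q by auto
  have vq: "0 \<le> v" "v \<le> (real q)\<^sup>2 * C"
    using T_L2'[OF qK] by (auto simp: v_def)
  have T_p: "integrable M (\<lambda>\<omega>. \<bar>T {..<q} \<omega>\<bar> powr (2 * p))"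
    and T_p': "expectation (\<lambda>\<omega>. \<bar>T {..<q} \<omega>\<bar> powr (2 * p)) \<le> real q powr (2 * p) * (real q * C)"
  proof -
    have b: "\<bar>T {..<q} \<omega>\<bar> powr (2 * p) \<le> real q powr (2 * p) * (\<Sum>i<q. \<bar>W i \<omega>\<bar> powr (2 * p))" for \<omega>
      unfolding T_def using powr_sum_le[of "{..<q}" "2 * p" "\<lambda>i. W i \<omega>"] p by simp
    have i: "integrable M (\<lambda>\<omega>. real q powr (2 * p) * (\<Sum>i<q. \<bar>W i \<omega>\<bar> powr (2 * p)))"
      by (intro integrable_mult_right Bochner_Integration.integrable_sum W_p)
    show 1: "integrable M (\<lambda>\<omega>. \<bar>T {..<q} \<omega>\<bar> powr (2 * p))"
      by (rule Bochner_Integration.integrable_bound[OF i])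
        (auto intro!: AE_I2 order_trans[OF b abs_ge_self])
    have "expectation (\<lambda>\<omega>. \<bar>T {..<q} \<omega>\<bar> powr (2 * p)) \<le>
        expectation (\<lambda>\<omega>. real q powr (2 * p) * (\<Sum>i<q. \<bar>W i \<omega>\<bar> powr (2 * p)))"
      by (intro integral_mono 1 i b)
    also have "\<dots> = real q powr (2 * p) * (\<Sum>i<q. expectation (\<lambda>\<omega>. \<bar>W i \<omega>\<bar> powr (2 * p)))"
      using W_p by simp
    also have "\<dots> \<le> real q powr (2 * p) * (\<Sum>i<q. C)"
      using q by (intro mult_left_mono sum_mono mom) auto
    finally show "expectation (\<lambda>\<omega>. \<bar>T {..<q} \<omega>\<bar> powr (2 * p)) \<le> real q powr (2 * p) * (real q * C)" by simp
  qed
  let ?x = "v / (2 * N)"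
  have x0: "0 \<le> ?x" using vq N by simp
  let ?e3 = "N powr (- 1/4) * ((real q)\<^sup>2 * C) + 6 * N powr ((1 - p) / 2) * (real q powr (2 * p) * (real q * C))"
  have step3: "norm (\<phi> - exp (- ?x)) \<le> ?e3 / (6 * N) + ?x\<^sup>2"
  proof -
    have "norm (\<phi> - (1 - ?x)) \<le> 1 / (6 * N) * (N powr (- 1/4) * v +
        6 * N powr ((1 - p) / 2) * expectation (\<lambda>\<omega>. \<bar>T {..<q} \<omega>\<bar> powr (2 * p)))"
      unfolding \<phi>_def v_def using char_expansion_Lyapunov[OF T_sq T_mean[OF qK] T_p p N]
      by simp
    also have "\<dots> \<le> 1 / (6 * N) * ?e3"
      using N vq T_p' by (intro mult_left_mono add_mono) auto
    finally have "norm (\<phi> - complex_of_real (1 - ?x)) \<le> ?e3 / (6 * N)" by simp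
    moreover have "norm (complex_of_real (1 - ?x) - complex_of_real (exp (- ?x))) \<le> ?x\<^sup>2"
      using exp_minus_quadratic_bound[OF x0] by (simp only: of_real_diff[symmetric] norm_of_real abs_minus_commute)
    ultimately have "norm (\<phi> - complex_of_real (exp (- ?x))) \<le> ?e3 / (6 * N) + ?x\<^sup>2"
      by (rule norm_diff_triangle_le)
    then show ?thesis by simp
  qed
  have step4: "norm (\<phi> ^ G - complex_of_real (exp (- (real G * v) / (2 * N)))) \<le> ?e3 / 3 + ((real q)\<^sup>2 * C)\<^sup>2 / (2 * N)"
  proof -
    have "complex_of_real (exp (- (real G * v) / (2 * N))) = (complex_of_real (exp (- ?x))) ^ G"
      by (simp add: exp_of_nat_mult[symmetric] mult.commute flip: of_real_power)
    then have "norm (\<phi> ^ G - complex_of_real (exp (- (real G * v) / (2 * N)))) \<le>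
        real G * norm (\<phi> - complex_of_real (exp (- ?x)))"
      using x0 by (simp only:) (rule norm_power_diff, use \<phi>1 in auto)
    also have "\<dots> \<le> (2 * N) * (?e3 / (6 * N) + ?x\<^sup>2)"
      using step3 G3 N by (intro mult_mono) auto
    also have "\<dots> = ?e3 / 3 + v\<^sup>2 / (2 * N)" using N by (simp add: field_simps power2_eq_square)
    also have "\<dots> \<le> ?e3 / 3 + ((real q)\<^sup>2 * C)\<^sup>2 / (2 * N)"
      using vq N by (intro add_left_mono divide_right_mono power_mono) auto
    finally show ?thesis .
  qed
  have step2': "norm (expectation (\<lambda>\<omega>. iexp ((\<Sum>j<G. T (B j) \<omega>) / ?SN)) - \<phi> ^ G) \<le> 8 * (N * \<delta>)"
  proof -
    have "real G * (4 * \<delta>) \<le> (2 * N) * (4 * \<delta>)" using G3 d0 by (intro mult_right_mono) auto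
    also have "\<dots> = 8 * (N * \<delta>)" by simp
    finally show ?thesis by (rule order_trans[OF step2[OF order_refl]])
  qed
  have "norm (expectation (\<lambda>\<omega>. iexp (T {..<K} \<omega> / ?SN)) - complex_of_real (exp (- (real G * v) / (2 * N)))) \<le>
      (sqrt (8 * C * (1 + 2 * N * \<delta>) / real m) + real m * sqrt (C / N)) + (8 * (N * \<delta>) +
      (?e3 / 3 + ((real q)\<^sup>2 * C)\<^sup>2 / (2 * N)))"
    by (rule norm_diff_triangle_le[OF step1 norm_diff_triangle_le[OF step2' step4]])
  then show ?thesis by (simp add: m_def add.assoc)
qed

text \<open>
  The mixing assumption requires two missing indices between the sums, as a term may depend on its own
  and the following time block.  The number \<open>K n\<close> of terms and the normalisation \<open>N n\<close> are kept apart
  because the sliding windows that start in the last block leave the observed range.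
\<close>
theorem bernstein_clt:
  fixes W :: "nat \<Rightarrow> nat \<Rightarrow> 'a \<Rightarrow> real" and K :: "nat \<Rightarrow> nat" and N :: "nat \<Rightarrow> real"
    and \<delta> :: "nat \<Rightarrow> real" and V C p :: real
  assumes W_sq: "\<And>n i. sq_int (W n i)"
    and mean: "\<And>n i. i < K n \<Longrightarrow> expectation (W n i) = 0"
    and W_p: "\<And>n i. integrable M (\<lambda>\<omega>. \<bar>W n i \<omega>\<bar> powr (2 * p))"
    and p: "p > 1"
    and mom: "\<forall>\<^sub>F n in sequentially. \<forall>i<K n. expectation (\<lambda>\<omega>. \<bar>W n i \<omega>\<bar> powr (2 * p)) \<le> C"
    and stat: "\<And>n a q. a + q \<le> K n \<Longrightarrow>
      distr M borel (\<lambda>\<omega>. \<Sum>i\<in>{a..<a+q}. W n i \<omega>) = distr M borel (\<lambda>\<omega>. \<Sum>i<q. W n i \<omega>)"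
    and mix: "\<forall>\<^sub>F n in sequentially. \<forall>b I I' (f :: real \<Rightarrow> real) (g :: real \<Rightarrow> real).
      b + 2 \<le> K n \<longrightarrow> I \<subseteq> {..<b} \<longrightarrow> I' \<subseteq> {b+2..<K n} \<longrightarrow>
      f \<in> borel_measurable borel \<longrightarrow> g \<in> borel_measurable borel \<longrightarrow>
      sq_int (\<lambda>\<omega>. f (\<Sum>i\<in>I. W n i \<omega>)) \<longrightarrow> sq_int (\<lambda>\<omega>. g (\<Sum>i\<in>I'. W n i \<omega>)) \<longrightarrow>
      \<bar>cov (\<lambda>\<omega>. f (\<Sum>i\<in>I. W n i \<omega>)) (\<lambda>\<omega>. g (\<Sum>i\<in>I'. W n i \<omega>))\<bar> \<le>
        \<delta> n * (sqrt (expectation (\<lambda>\<omega>. (f (\<Sum>i\<in>I. W n i \<omega>))\<^sup>2)) *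
          sqrt (expectation (\<lambda>\<omega>. (g (\<Sum>i\<in>I'. W n i \<omega>))\<^sup>2)))"
    and d0: "\<And>n. \<delta> n \<ge> 0" and Nd: "(\<lambda>n. N n * \<delta> n) \<longlonglongrightarrow> 0"
    and N: "filterlim N at_top sequentially" and KN: "(\<lambda>n. real (K n) / N n) \<longlonglongrightarrow> 1"
    and var: "((\<lambda>(q, n). expectation (\<lambda>\<omega>. (\<Sum>i<q. W n i \<omega>)\<^sup>2) / real q) \<longlongrightarrow> V) iter_seq"
  shows "(\<lambda>n. expectation (\<lambda>\<omega>. iexp ((\<Sum>i<K n. W n i \<omega>) / sqrt (N n)))) \<longlonglongrightarrow> exp (- V / 2)"
proof -
  define C' where "C' = 1 + \<bar>C\<bar>"
  define v where "v q n = expectation (\<lambda>\<omega>. (\<Sum>i<q. W n i \<omega>)\<^sup>2)" for q n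
  define x where "x q n = real (K n div (q + 2)) * v q n / (2 * N n)" for q n
  define e1 where "e1 q n = sqrt (8 * C' * (1 + 2 * N n * \<delta> n) / real (q + 2)) + real (q + 2) * sqrt (C' / N n) +
    8 * (N n * \<delta> n) + (N n powr (- 1/4) * ((real q)\<^sup>2 * C') +
      6 * N n powr ((1 - p) / 2) * (real q powr (2 * p) * (real q * C'))) / 3 +
    ((real q)\<^sup>2 * C')\<^sup>2 / (2 * N n)" for q n
  have Npos: "\<forall>\<^sub>F n in sequentially. N n > 0" using N by (simp add: filterlim_at_top_dense)
  have KN2: "\<forall>\<^sub>F n in sequentially. real (K n) / N n < 2 \<and> real (K n) / N n > 1/2"
    using eventually_conj[OF order_tendstoD(2)[OF KN, of 2] order_tendstoD(1)[OF KN, of "1/2"]] by simp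
  have K: "\<forall>\<^sub>F n in sequentially. q \<le> K n" for q
  proof -
    have "\<forall>\<^sub>F n in sequentially. 2 * real q < N n" using N by (simp add: filterlim_at_top_dense)
    with Npos KN2 show ?thesis
    proof eventually_elim
      case (elim n)
      then have "N n / 2 < real (K n)" by (simp add: field_simps)
      then show ?case using elim by simp
    qed
  qed
  have inv0: "(\<lambda>n. c / N n) \<longlonglongrightarrow> 0" for c
    by (rule tendsto_divide_0[OF tendsto_const filterlim_at_top_imp_at_infinity[OF N]])
  have pow0: "(\<lambda>n. N n powr s) \<longlonglongrightarrow> 0" if "s < 0" for s
    using tendsto_neg_powr[OF that N] .
  have "((\<lambda>(q, n). e1 q n) \<longlongrightarrow> 0) iter_seq"
  proof (rule tendsto_iter_seq)
    fix q
    have "(\<lambda>n. e1 q n) \<longlonglongrightarrow> sqrt (8 * C' * (1 + 2 * 0) / real (q + 2)) + real (q + 2) * sqrt 0 + 8 * 0 +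
        (0 * ((real q)\<^sup>2 * C') + 6 * 0 * (real q powr (2 * p) * (real q * C'))) / 3 + 0"
      unfolding e1_def mult.assoc[of 2 "N _" "\<delta> _"]
      by (intro tendsto_intros Nd pow0) (use p inv0[of C'] inv0[of "((real q)\<^sup>2 * C')\<^sup>2 / 2"] in auto)
    then show "(\<lambda>n. e1 q n) \<longlonglongrightarrow> sqrt (8 * C' / real (q + 2))" by simp
  next
    have "(\<lambda>q. 8 * C' / real (q + 2)) \<longlonglongrightarrow> 0" by real_asymp
    then show "(\<lambda>q. sqrt (8 * C' / real (q + 2))) \<longlonglongrightarrow> 0" using tendsto_real_sqrt by fastforce
  qed
  moreover have "((\<lambda>(q, n). norm (complex_of_real (exp (- x q n)) - exp (- V / 2))) \<longlongrightarrow> 0) iter_seq"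
  proof -
    have "((\<lambda>(q, n). real (K n div (q + 2)) * real q / N n) \<longlongrightarrow> 1) iter_seq"
    proof (rule tendsto_iter_seq)
      fix q
      have "(\<lambda>n. real (K n div (q + 2)) / N n) \<longlonglongrightarrow> 1 / real (q + 2)"
      proof (rule real_tendsto_sandwich)
        show "\<forall>\<^sub>F n in sequentially. real (K n) / N n / real (q + 2) - 1 / N n \<le> real (K n div (q + 2)) / N n"
          using Npos
        proof eventually_elim
          case (elim n)
          have "K n \<le> K n div (q + 2) * (q + 2) + (q + 2)"
            using dividend_less_div_times[of "q + 2" "K n"] by simp
          then have "real (K n) \<le> real (K n div (q + 2) * (q + 2) + (q + 2))"
            by (simp only: of_nat_le_iff)
          also have "\<dots> = (real (K n div (q + 2)) + 1) * real (q + 2)"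
            by (simp only: of_nat_add of_nat_mult distrib_right mult_1)
          finally have "real (K n) \<le> (real (K n div (q + 2)) + 1) * real (q + 2)" .
          then have "real (K n) / real (q + 2) \<le> real (K n div (q + 2)) + 1"
            by (subst pos_divide_le_eq) (simp, assumption)
          then have "real (K n) / real (q + 2) - 1 \<le> real (K n div (q + 2))" by linarith
          then have "(real (K n) / real (q + 2) - 1) / N n \<le> real (K n div (q + 2)) / N n"
            using elim by (intro divide_right_mono) auto
          then show ?case by (simp add: diff_divide_distrib mult.commute)
        qed
        show "\<forall>\<^sub>F n in sequentially. real (K n div (q + 2)) / N n \<le> real (K n) / N n / real (q + 2)"
          using Npos
        proof eventually_elim
          case (elim n)
          have "real (K n div (q + 2)) \<le> real (K n) / real (q + 2)" by (rule of_nat_div_le_of_nat)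
          then have "real (K n div (q + 2)) / N n \<le> real (K n) / real (q + 2) / N n"
            using elim by (intro divide_right_mono) auto
          then show ?case by (simp add: mult.commute)
        qed
        show "(\<lambda>n. real (K n) / N n / real (q + 2) - 1 / N n) \<longlonglongrightarrow> 1 / real (q + 2)"
          using tendsto_diff[OF tendsto_divide[OF KN tendsto_const[of "real (q + 2)"]] inv0[of 1]] by simp
        show "(\<lambda>n. real (K n) / N n / real (q + 2)) \<longlonglongrightarrow> 1 / real (q + 2)"
          using tendsto_divide[OF KN tendsto_const[of "real (q + 2)"]] by simp
      qed
      then show "(\<lambda>n. real (K n div (q + 2)) * real q / N n) \<longlonglongrightarrow> 1 / real (q + 2) * real q"
        using tendsto_mult_right[of _ _ _ "real q"] by fastforce
    next
      show "(\<lambda>q. 1 / real (q + 2) * real q) \<longlonglongrightarrow> 1" by real_asymp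
    qed
    from tendsto_mult[OF this var]
    have "((\<lambda>y. (case y of (q, n) \<Rightarrow> real (K n div (q + 2)) * real q / N n) *
        (case y of (q, n) \<Rightarrow> v q n / real q)) \<longlongrightarrow> V) iter_seq"
      by (simp add: v_def)
    moreover have "\<forall>\<^sub>F y in iter_seq. (case y of (q, n) \<Rightarrow> real (K n div (q + 2)) * real q / N n) *
        (case y of (q, n) \<Rightarrow> v q n / real q) = (case y of (q, n) \<Rightarrow> 2 * x q n)"
      using eventually_iter_seq_fst[OF eventually_gt_at_top[of 0]]
      by eventually_elim (auto simp: x_def)
    ultimately have "((\<lambda>(q, n). 2 * x q n) \<longlongrightarrow> V) iter_seq"
      by (simp add: tendsto_cong)
    then have "((\<lambda>y. complex_of_real (exp (- (case y of (q, n) \<Rightarrow> 2 * x q n) / 2))) \<longlongrightarrow> complex_of_real (exp (- V / 2))) iter_seq"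
      by (intro tendsto_intros) auto
    then have "((\<lambda>y. norm (complex_of_real (exp (- (case y of (q, n) \<Rightarrow> 2 * x q n) / 2)) - complex_of_real (exp (- V / 2)))) \<longlongrightarrow> 0) iter_seq"
      by (intro tendsto_norm_zero) (simp add: LIM_zero_iff)
    then show ?thesis by (simp add: case_prod_unfold)
  qed
  ultimately have lim: "((\<lambda>y. (case y of (q, n) \<Rightarrow> e1 q n) +
      (case y of (q, n) \<Rightarrow> norm (complex_of_real (exp (- x q n)) - exp (- V / 2)))) \<longlongrightarrow> 0) iter_seq"
    using tendsto_add by fastforce
  have "(\<lambda>n. expectation (\<lambda>\<omega>. iexp ((\<Sum>i<K n. W n i \<omega>) / sqrt (N n))) - exp (- V / 2)) \<longlonglongrightarrow> 0"
  proof (rule LIMSEQ_0_if_iter_bound[OF lim])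
    have "\<forall>\<^sub>F n in sequentially. norm (expectation (\<lambda>\<omega>. iexp ((\<Sum>i<K n. W n i \<omega>) / sqrt (N n))) -
        complex_of_real (exp (- x q n))) \<le> e1 q n" if q: "q \<ge> 2" for q
      using Npos KN2 K[of q] mom mix
    proof eventually_elim
      case (elim n)
      have mom': "expectation (\<lambda>\<omega>. \<bar>W n i \<omega>\<bar> powr (2 * p)) \<le> C'" if "i < K n" for i
      proof -
        have "expectation (\<lambda>\<omega>. \<bar>W n i \<omega>\<bar> powr (2 * p)) \<le> C" using elim(4) that by blast
        then show ?thesis by (simp add: C'_def)
      qed
      have mom2: "expectation (\<lambda>\<omega>. (W n i \<omega>)\<^sup>2) \<le> C'" if "i < K n" for i
      proof -
        have "expectation (\<lambda>\<omega>. (W n i \<omega>)\<^sup>2) \<le> expectation (\<lambda>\<omega>. 1 + \<bar>W n i \<omega>\<bar> powr (2 * p))"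
          by (intro integral_mono square_le_1_powr[OF p] sq_int_square[OF W_sq]
              Bochner_Integration.integrable_add W_p) simp
        also have "\<dots> = 1 + expectation (\<lambda>\<omega>. \<bar>W n i \<omega>\<bar> powr (2 * p))"
          using W_p by (simp add: prob_space)
        also have "expectation (\<lambda>\<omega>. \<bar>W n i \<omega>\<bar> powr (2 * p)) \<le> C" using elim(4) that by blast
        finally show ?thesis by (simp add: C'_def)
      qed
      have K2: "real (K n) \<le> 2 * N n" using elim(1,2) by (simp add: field_simps)
      have "norm (expectation (\<lambda>\<omega>. iexp ((\<Sum>i<K n. W n i \<omega>) / sqrt (N n))) -
          exp (- (real (K n div (q + 2)) * v q n) / (2 * N n))) \<le> e1 q n"
        unfolding e1_def v_def
        by (rule bernstein_row[OF W_sq mean W_p p mom' mom2 stat _ d0 elim(1) K2 q elim(3)])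
          (use elim(5) in \<open>assumption | blast\<close>)+
      then show ?case by (simp add: x_def)
    qed
    then have ev: "\<forall>\<^sub>F y in iter_seq. norm (expectation (\<lambda>\<omega>. iexp ((\<Sum>i<K (snd y). W (snd y) i \<omega>) / sqrt (N (snd y)))) -
        complex_of_real (exp (- x (fst y) (snd y)))) \<le> e1 (fst y) (snd y)"
      unfolding eventually_iter_seq fst_conv snd_conv by (rule eventually_sequentiallyI)
    then show "\<forall>\<^sub>F y in iter_seq. norm (expectation (\<lambda>\<omega>. iexp ((\<Sum>i<K (snd y). W (snd y) i \<omega>) / sqrt (N (snd y)))) - exp (- V / 2)) \<le>
       (case y of (q, n) \<Rightarrow> e1 q n) +
      (case y of (q, n) \<Rightarrow> norm (complex_of_real (exp (- x q n)) - exp (- V / 2)))"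
    proof eventually_elim
      case (elim y)
      show ?case unfolding case_prod_beta by (rule norm_diff_triangle_le[OF elim]) simp
    qed
  qed
  then show ?thesis by (simp add: LIM_zero_iff)
qed

end

section \<open>Exceedance indicators of a stationary process\<close>

text \<open>
  For a sequence \<open>x\<close> of exceedance indicators this is the indicator of no exceedance in the window
  \<open>{a..<b}\<close>.  Products and sums of coordinates make measurability with respect to the threshold fields
  and behaviour under shifts immediate.
\<close>
definition clear :: "nat \<Rightarrow> nat \<Rightarrow> (nat \<Rightarrow> real) \<Rightarrow> real" where
  "clear a b x = (\<Prod>i\<in>{a..<b}. 1 - x i)"

definition hits :: "nat \<Rightarrow> nat \<Rightarrow> (nat \<Rightarrow> real) \<Rightarrow> real" where
  "hits a b x = (\<Sum>i\<in>{a..<b}. x i)"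

lemma clear_shift: "clear (a + h) (b + h) x = clear a b (\<lambda>i. x (i + h))"
  unfolding clear_def by (rule prod.shift_bounds_nat_ivl)

lemma hits_shift: "hits (a + h) (b + h) x = hits a b (\<lambda>i. x (i + h))"
  unfolding hits_def by (rule sum.shift_bounds_nat_ivl)

lemma clear_measurable[measurable]: "clear a b \<in> borel_measurable (\<Pi>\<^sub>M i\<in>UNIV. borel)"
  unfolding clear_def by measurable

lemma hits_measurable[measurable]: "hits a b \<in> borel_measurable (\<Pi>\<^sub>M i\<in>UNIV. borel)"
  unfolding hits_def by measurable

lemma clear_split: "a \<le> b \<Longrightarrow> b \<le> c \<Longrightarrow> clear a c x = clear a b x * clear b c x"
  unfolding clear_def by (simp add: prod.atLeastLessThan_concat)

lemma hits_split: "a \<le> b \<Longrightarrow> b \<le> c \<Longrightarrow> hits a c x = hits a b x + hits b c x"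
  unfolding hits_def by (simp add: sum.atLeastLessThan_concat)

lemma clear_01:
  assumes "\<And>i. x i \<in> {0, 1}"
  shows "clear a b x \<in> {0, 1}"
proof -
  show ?thesis
  proof (cases "\<exists>i\<in>{a..<b}. x i = 1")
    case True
    then show ?thesis unfolding clear_def by (simp add: prod_zero_iff)
  next
    case False
    then have "x i = 0" if "i \<in> {a..<b}" for i using assms[of i] that by auto
    then show ?thesis unfolding clear_def by simp
  qed
qed

lemma clear_nonneg_le_1:
  assumes "\<And>i. x i \<in> {0, 1}"
  shows "0 \<le> clear a b x" "clear a b x \<le> 1" "\<bar>clear a b x\<bar> \<le> 1"
  using clear_01[of x a b] assms by auto

lemma hits_nonneg_le:
  assumes "\<And>i. x i \<in> {0, 1}"
  shows "0 \<le> hits a b x" "hits a b x \<le> real (b - a)" "\<bar>hits a b x\<bar> \<le> real (b - a)"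
proof -
  have x: "0 \<le> x i" "x i \<le> 1" for i using assms[of i] by auto
  show "0 \<le> hits a b x" unfolding hits_def by (intro sum_nonneg x)
  moreover have "hits a b x \<le> (\<Sum>i\<in>{a..<b}. 1)" unfolding hits_def by (intro sum_mono x)
  ultimately show "hits a b x \<le> real (b - a)" "\<bar>hits a b x\<bar> \<le> real (b - a)" by auto
qed

lemma clear_mult_hits_0:
  assumes "\<And>i. x i \<in> {0, 1}" "a \<le> a'" "b' \<le> b"
  shows "clear a b x * hits a' b' x = 0"
proof (cases "\<exists>i\<in>{a..<b}. x i = 1")
  case True
  then show ?thesis unfolding clear_def by (simp add: prod_zero_iff)
next
  case False
  then have "x i = 0" if "i \<in> {a..<b}" for i using assms(1)[of i] that by auto
  then show ?thesis unfolding hits_def using assms(2,3) by (auto intro!: sum.neutral)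
qed

lemma one_minus_clear_le_hits:
  assumes "\<And>i. x i \<in> {0, 1}"
  shows "1 - clear a b x \<le> hits a b x"
proof (cases "\<exists>i\<in>{a..<b}. x i = 1")
  case True
  then obtain i where i: "i \<in> {a..<b}" "x i = 1" by auto
  have "x i \<le> hits a b x" unfolding hits_def
  proof (rule member_le_sum)
    show "0 \<le> x j" for j using assms[of j] by auto
  qed (use i in auto)
  then show ?thesis using i clear_nonneg_le_1(1)[of x a b] assms by auto
next
  case False
  then have "x i = 0" if "i \<in> {a..<b}" for i using assms[of i] that by auto
  then show ?thesis unfolding clear_def hits_def by simp
qed

text \<open>
  The number of positions where the indicators differ bounds the change of the product; with two
  thresholds this leads to a comparison through the tails.
\<close>
lemma clear_diff_le:
  assumes "\<And>i. x i \<in> {0, 1}" "\<And>i. y i \<in> {0, 1}"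
  shows "\<bar>clear a b x - clear a b y\<bar> \<le> (\<Sum>i\<in>{a..<b}. \<bar>x i - y i\<bar>)"
proof -
  have "norm (1 - x i) \<le> 1" "norm (1 - y i) \<le> 1" for i using assms(1)[of i] assms(2)[of i] by auto
  then have "norm (clear a b x - clear a b y) \<le> (\<Sum>i\<in>{a..<b}. norm ((1 - x i) - (1 - y i)))"
    unfolding clear_def by (intro norm_prod_diff)
  then show ?thesis by (simp add: abs_minus_commute)
qed

locale stationary_process = prob_space M for M :: "'a measure" +
  fixes X :: "nat \<Rightarrow> 'a \<Rightarrow> real"
  assumes X_measurable: "\<And>i. i \<ge> 1 \<Longrightarrow> X i \<in> borel_measurable M"
    and stationary: "strictly_stationary M X"
begin

text \<open>
  Position \<open>i\<close> refers to \<open>X (Suc i)\<close>, so that windows are half-open intervals of natural numbers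
  starting from \<open>0\<close>, and \<open>X 0\<close> does not occur.
\<close>
definition exc :: "real \<Rightarrow> 'a \<Rightarrow> nat \<Rightarrow> real" where
  "exc u \<omega> i = of_bool (X (Suc i) \<omega> > u)"

lemma X_Suc_measurable[measurable]: "X (Suc i) \<in> borel_measurable M"
  by (rule X_measurable) simp

lemma exc_01: "exc u \<omega> i \<in> {0, 1}" by (simp add: exc_def)

lemma exc_measurable[measurable]: "(\<lambda>\<omega>. exc u \<omega> i) \<in> borel_measurable M"
  unfolding exc_def by measurable

lemma exc_seq_measurable[measurable]: "exc u \<in> M \<rightarrow>\<^sub>M (\<Pi>\<^sub>M i\<in>UNIV. borel)"
proof (rule measurable_PiM_single')
  show "(\<lambda>\<omega>. exc u \<omega> i) \<in> borel_measurable M" if "i \<in> UNIV" for i by measurable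
qed auto

text \<open>
  The definition of stationarity concerns finite windows; the law on the space of all sequences is
  determined by them, and there every measurable functional can be shifted.
\<close>
lemma distr_shift:
  "distr M (\<Pi>\<^sub>M i\<in>UNIV. borel) (\<lambda>\<omega> i. X (Suc (i + h)) \<omega>) =
   distr M (\<Pi>\<^sub>M i\<in>UNIV. borel) (\<lambda>\<omega> i. X (Suc i) \<omega>)"
proof -
  have meas: "(\<lambda>\<omega> i. X (Suc (i + h)) \<omega>) \<in> M \<rightarrow>\<^sub>M (\<Pi>\<^sub>M i\<in>UNIV. borel)" for h
    by (rule measurable_PiM_single') auto
  let ?P = "\<lambda>h. distr M (\<Pi>\<^sub>M i\<in>UNIV. borel) (\<lambda>\<omega> i. X (Suc (i + h)) \<omega>)"
  have "?P h = ?P 0"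
  proof (rule measure_eqI_PiM_infinite)
    fix A :: "nat \<Rightarrow> real set" and J :: "nat set"
    assume J: "finite J" "J \<subseteq> UNIV" and A: "\<And>i. i \<in> J \<Longrightarrow> A i \<in> sets borel"
    obtain n where n: "J \<subseteq> {..<n}" using J(1) finite_nat_bounded by blast
    define B where "B = {x \<in> space (\<Pi>\<^sub>M i\<in>{1..n}. (borel :: real measure)). \<forall>j\<in>J. x (Suc j) \<in> A j}"
    have jn: "Suc j \<in> {1..n}" if "j \<in> J" for j using n that by auto
    have B: "B \<in> sets (\<Pi>\<^sub>M i\<in>{1..n}. borel)"
      unfolding B_def
    proof (rule sets.sets_Collect_finite_All[OF _ J(1)], goal_cases)
      case (1 j)
      have "(\<lambda>x. x (Suc j)) \<in> (\<Pi>\<^sub>M i\<in>{1..n}. (borel :: real measure)) \<rightarrow>\<^sub>M borel"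
        by (rule measurable_component_singleton) (use jn 1 in auto)
      from measurable_sets[OF this A[OF 1]] show ?case
        by (simp add: vimage_def Int_def conj_commute)
    qed
    have "emeasure (?P h) (prod_emb UNIV (\<lambda>_. borel) J (Pi\<^sub>E J A)) =
        emeasure (distr M (\<Pi>\<^sub>M i\<in>{1..n}. borel) (\<lambda>\<omega>. \<lambda>i\<in>{1..n}. X (i + h) \<omega>)) B" for h
    proof -
      have m: "(\<lambda>\<omega>. \<lambda>i\<in>{1..n}. X (i + h) \<omega>) \<in> M \<rightarrow>\<^sub>M (\<Pi>\<^sub>M i\<in>{1..n}. borel)"
        by (rule measurable_restrict) (auto intro: X_measurable)
      have pe: "prod_emb UNIV (\<lambda>_. borel) J (Pi\<^sub>E J A) \<in> sets (\<Pi>\<^sub>M i\<in>UNIV. (borel :: real measure))"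
        by (intro sets_PiM_I) (use J A in auto)
      have "(\<lambda>\<omega> i. X (Suc (i + h)) \<omega>) -` prod_emb UNIV (\<lambda>_. borel) J (Pi\<^sub>E J A) \<inter> space M =
          (\<lambda>\<omega>. \<lambda>i\<in>{1..n}. X (i + h) \<omega>) -` B \<inter> space M"
        using jn by (auto simp: prod_emb_def B_def space_PiM PiE_iff)
      then show ?thesis using meas m B pe by (simp add: emeasure_distr)
    qed
    moreover have "distr M (\<Pi>\<^sub>M i\<in>{1..n}. borel) (\<lambda>\<omega>. \<lambda>i\<in>{1..n}. X (i + h) \<omega>) =
        distr M (\<Pi>\<^sub>M i\<in>{1..n}. borel) (\<lambda>\<omega>. \<lambda>i\<in>{1..n}. X (i + 0) \<omega>)"
      using stationary unfolding strictly_stationary_def by simp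
    ultimately show "emeasure (?P h) (prod_emb UNIV (\<lambda>_. borel) J (Pi\<^sub>E J A)) =
        emeasure (?P 0) (prod_emb UNIV (\<lambda>_. borel) J (Pi\<^sub>E J A))"
      by (simp only:)
  next
    show "finite_measure (?P h)"
      by (intro prob_space.finite_measure prob_space_distr meas)
  qed simp_all
  then show ?thesis by simp
qed

lemma distr_exc_shift:
  assumes [measurable]: "\<phi> \<in> borel_measurable (\<Pi>\<^sub>M i\<in>UNIV. borel)"
  shows "distr M borel (\<lambda>\<omega>. \<phi> (\<lambda>i. exc u \<omega> (i + h))) = distr M borel (\<lambda>\<omega>. \<phi> (exc u \<omega>) :: real)"
proof -
  let ?B = "\<Pi>\<^sub>M i\<in>UNIV. (borel :: real measure)"
  define \<psi> where "\<psi> x = \<phi> (\<lambda>i. of_bool (x i > u))" for x :: "nat \<Rightarrow> real"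
  have "(\<lambda>x i. of_bool (x i > u)) \<in> ?B \<rightarrow>\<^sub>M ?B"
    by (rule measurable_PiM_single') auto
  then have \<psi>: "\<psi> \<in> borel_measurable ?B" unfolding \<psi>_def by measurable
  have meas: "(\<lambda>\<omega> i. X (Suc (i + h)) \<omega>) \<in> M \<rightarrow>\<^sub>M ?B" for h
    by (rule measurable_PiM_single') auto
  have "distr M borel (\<lambda>\<omega>. \<phi> (\<lambda>i. exc u \<omega> (i + h))) = distr (distr M ?B (\<lambda>\<omega> i. X (Suc (i + h)) \<omega>)) borel \<psi>" for h
    using \<psi> meas[of h] by (subst distr_distr) (auto simp: \<psi>_def exc_def comp_def)
  from this[of h] this[of 0] show ?thesis by (simp add: distr_shift)
qed

lemma functional_exc_measurable:
  assumes [measurable]: "\<phi> \<in> borel_measurable (\<Pi>\<^sub>M i\<in>UNIV. borel)"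
  shows "(\<lambda>\<omega>. \<phi> (\<lambda>i. exc u \<omega> (i + h)) :: real) \<in> borel_measurable M"
proof -
  have "(\<lambda>\<omega> i. exc u \<omega> (i + h)) \<in> M \<rightarrow>\<^sub>M (\<Pi>\<^sub>M i\<in>UNIV. borel)"
    by (rule measurable_PiM_single') auto
  then show ?thesis by measurable
qed

lemma expectation_exc_shift:
  assumes "\<phi> \<in> borel_measurable (\<Pi>\<^sub>M i\<in>UNIV. borel)"
  shows "expectation (\<lambda>\<omega>. \<phi> (\<lambda>i. exc u \<omega> (i + h))) = expectation (\<lambda>\<omega>. \<phi> (exc u \<omega>) :: real)"
  by (rule expectation_cong_distr[where f="\<lambda>x. x", OF functional_exc_measurable[OF assms]
      functional_exc_measurable[OF assms, where h=0, simplified] distr_exc_shift[OF assms]]) simp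

lemma threshold_field_sets:
  assumes "a \<ge> 1"
  shows "sets (threshold_field M X u a b) \<subseteq> sets M" "space (threshold_field M X u a b) = space M"
proof -
  have sub: "(\<lambda>i. {\<omega> \<in> space M. X i \<omega> \<le> u}) ` {a..b} \<subseteq> sets M"
    using assms by (auto intro!: borel_measurable_le X_measurable)
  then have "(\<lambda>i. {\<omega> \<in> space M. X i \<omega> \<le> u}) ` {a..b} \<subseteq> Pow (space M)"
    using sets.sets_into_space by blast
  then show "sets (threshold_field M X u a b) \<subseteq> sets M" "space (threshold_field M X u a b) = space M"
    using sets.sigma_sets_subset[OF sub] unfolding threshold_field_def by auto
qed

lemma threshold_field_mono:
  assumes "a' \<le> a" "b \<le> b'" "f \<in> borel_measurable (threshold_field M X u a b)"
  shows "f \<in> borel_measurable (threshold_field M X u a' b')"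
proof -
  have pow: "(\<lambda>i. {\<omega> \<in> space M. X i \<omega> \<le> u}) ` S \<subseteq> Pow (space M)" for S by auto
  have "sets (threshold_field M X u a b) \<subseteq> sets (threshold_field M X u a' b')"
    using assms(1,2) pow unfolding threshold_field_def
    by (simp add: sets_measure_of) (intro sigma_sets_mono', auto)
  moreover have "space (threshold_field M X u a b) = space (threshold_field M X u a' b')"
    using pow unfolding threshold_field_def by (simp add: space_measure_of)
  ultimately show ?thesis using assms(3) by (auto simp: measurable_def)
qed

lemma exc_threshold_field:
  assumes "a \<le> Suc i" "Suc i \<le> b"
  shows "(\<lambda>\<omega>. exc u \<omega> i) \<in> borel_measurable (threshold_field M X u a b)"
proof -
  let ?T = "threshold_field M X u a b"
  have pow: "(\<lambda>i. {\<omega> \<in> space M. X i \<omega> \<le> u}) ` {a..b} \<subseteq> Pow (space M)" by auto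
  have sp: "space ?T = space M" using pow unfolding threshold_field_def by (simp add: space_measure_of)
  have "{\<omega> \<in> space M. X (Suc i) \<omega> \<le> u} \<in> sets ?T"
    unfolding threshold_field_def using assms pow by (auto simp: sets_measure_of intro!: sigma_sets.Basic)
  then have "{\<omega> \<in> space ?T. X (Suc i) \<omega> \<le> u} \<in> sets ?T" by (simp add: sp)
  then have "(\<lambda>\<omega>. if X (Suc i) \<omega> \<le> u then 0 else 1 :: real) \<in> borel_measurable ?T"
    by (intro measurable_If) auto
  also have "(\<lambda>\<omega>. if X (Suc i) \<omega> \<le> u then 0 else 1 :: real) = (\<lambda>\<omega>. exc u \<omega> i)"
    by (auto simp: exc_def)
  finally show ?thesis .
qed

lemma clear_threshold_field:
  assumes "a' \<le> Suc a" "b \<le> b'"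
  shows "(\<lambda>\<omega>. clear a b (exc u \<omega>)) \<in> borel_measurable (threshold_field M X u a' b')"
  unfolding clear_def using assms
  by (intro borel_measurable_prod borel_measurable_diff borel_measurable_const exc_threshold_field) auto

lemma hits_threshold_field:
  assumes "a' \<le> Suc a" "b \<le> b'"
  shows "(\<lambda>\<omega>. hits a b (exc u \<omega>)) \<in> borel_measurable (threshold_field M X u a' b')"
  unfolding hits_def using assms
  by (intro borel_measurable_sum exc_threshold_field) auto

lemma corr_le_1:
  assumes "sq_int \<xi>" "sq_int \<eta>"
  shows "\<bar>corr M \<xi> \<eta>\<bar> \<le> 1"
proof -
  have "corr M \<xi> \<eta> = cov \<xi> \<eta> / (sqrt (cov \<xi> \<xi>) * sqrt (cov \<eta> \<eta>))"
    unfolding corr_def cov_centered[OF assms] by (simp add: cov_self assms)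
  moreover have "\<bar>c / s\<bar> \<le> 1" if "\<bar>c\<bar> \<le> s" for c s :: real
    using that by (cases "s = 0") (auto simp: abs_divide divide_le_eq_1)
  ultimately show ?thesis using cov_Cauchy_Schwarz[OF assms] by simp
qed

text \<open>
  The mixing coefficients enter all estimates in this form.  If one of the variances vanishes then the
  correlation is not covered by the coefficient, but the covariance is \<open>0\<close>.
\<close>
lemma cov_le_max_corr:
  assumes t: "1 \<le> t" "t \<le> n - l" "t + l \<le> t'"
    and \<xi>: "\<xi> \<in> borel_measurable (threshold_field M X u 1 t)" "sq_int \<xi>"
    and \<eta>: "\<eta> \<in> borel_measurable (threshold_field M X u t' n)" "sq_int \<eta>"
  shows "\<bar>cov \<xi> \<eta>\<bar> \<le> max_corr M X n l u *
    (sqrt (expectation (\<lambda>\<omega>. (\<xi> \<omega>)\<^sup>2)) * sqrt (expectation (\<lambda>\<omega>. (\<eta> \<omega>)\<^sup>2)))"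
proof -
  define S where "S t = {\<bar>corr M \<xi> \<eta>\<bar> | \<xi> \<eta>.
           \<xi> \<in> L2_space M (threshold_field M X u 1 t) \<and>
           \<eta> \<in> L2_space M (threshold_field M X u (t + l) n) \<and>
           variance \<xi> > 0 \<and> variance \<eta> > 0}" for t
  have mc: "max_corr M X n l u = Max (insert 0 ((\<lambda>t. Sup (insert 0 (S t))) ` {1..n - l}))"
    unfolding max_corr_def S_def by simp
  have fin: "finite (insert 0 ((\<lambda>t. Sup (insert 0 (S t))) ` {1..n - l}))" by simp
  have pos: "0 \<le> max_corr M X n l u" unfolding mc by (rule Max_ge[OF fin]) simp
  have L2_sq: "sq_int \<xi>" if "\<xi> \<in> L2_space M (threshold_field M X u a b)" "a \<ge> 1" for \<xi> a b
  proof -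
    have "random_variable borel \<xi>"
      using that(1) threshold_field_sets[OF that(2), of u b] by (auto simp: measurable_def L2_space_def)
    then show ?thesis using that(1) by (simp add: sq_int_def L2_space_def)
  qed
  have bdd: "bdd_above (insert 0 (S t))"
  proof (rule bdd_aboveI[of _ 1])
    fix x assume "x \<in> insert 0 (S t)"
    then show "x \<le> 1" using t(1) unfolding S_def by (auto intro!: corr_le_1 L2_sq)
  qed
  show ?thesis
  proof (cases "variance \<xi> > 0 \<and> variance \<eta> > 0")
    case True
    have "\<eta> \<in> borel_measurable (threshold_field M X u (t + l) n)"
      by (rule threshold_field_mono[OF t(3) order_refl \<eta>(1)])
    then have "\<bar>corr M \<xi> \<eta>\<bar> \<in> S t"
      unfolding S_def using True \<xi> \<eta> by (auto simp: L2_space_def sq_int_def)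
    then have "\<bar>corr M \<xi> \<eta>\<bar> \<le> Sup (insert 0 (S t))" by (intro cSup_upper bdd) simp
    also have "\<dots> \<le> max_corr M X n l u" unfolding mc by (rule Max_ge[OF fin]) (use t in auto)
    finally have c: "\<bar>corr M \<xi> \<eta>\<bar> \<le> max_corr M X n l u" .
    have "corr M \<xi> \<eta> = cov \<xi> \<eta> / (sqrt (cov \<xi> \<xi>) * sqrt (cov \<eta> \<eta>))"
      unfolding corr_def cov_centered[OF \<xi>(2) \<eta>(2)] by (simp add: cov_self \<xi> \<eta>)
    then have "\<bar>cov \<xi> \<eta>\<bar> = \<bar>corr M \<xi> \<eta>\<bar> * (sqrt (cov \<xi> \<xi>) * sqrt (cov \<eta> \<eta>))"
      using True \<xi> \<eta> by (simp add: abs_mult cov_self)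
    also have "\<dots> \<le> max_corr M X n l u *
      (sqrt (expectation (\<lambda>\<omega>. (\<xi> \<omega>)\<^sup>2)) * sqrt (expectation (\<lambda>\<omega>. (\<eta> \<omega>)\<^sup>2)))"
      using c pos by (intro mult_mono real_sqrt_le_mono cov_self_le mult_nonneg_nonneg)
        (auto simp: cov_self_nonneg \<xi> \<eta>)
    finally show ?thesis .
  next
    case False
    then have "cov \<xi> \<xi> = 0 \<or> cov \<eta> \<eta> = 0"
      using cov_self_nonneg[OF \<xi>(2)] cov_self_nonneg[OF \<eta>(2)]
      unfolding cov_self[OF \<xi>(2)] cov_self[OF \<eta>(2)] by linarith
    then have "cov \<xi> \<eta> = 0" using cov_Cauchy_Schwarz[OF \<xi>(2) \<eta>(2)] by auto
    then show ?thesis using pos by simp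
  qed
qed

lemma max_corr_nonneg: "0 \<le> max_corr M X n l u"
  unfolding max_corr_def by (rule Max_ge) simp_all

end

section \<open>Window probabilities and covariances across a gap\<close>

context prob_space
begin

lemma sd_triangle:
  assumes "sq_int Y" "sq_int Z"
  shows "sqrt (cov (\<lambda>\<omega>. Y \<omega> + Z \<omega>) (\<lambda>\<omega>. Y \<omega> + Z \<omega>)) \<le> sqrt (cov Y Y) + sqrt (cov Z Z)"
proof -
  have Y: "sq_int (\<lambda>\<omega>. Y \<omega> - expectation Y)" and Z: "sq_int (\<lambda>\<omega>. Z \<omega> - expectation Z)"
    using assms by (auto intro: sq_int_diff)
  have e: "expectation (\<lambda>\<omega>. Y \<omega> + Z \<omega>) = expectation Y + expectation Z"
    using assms[THEN sq_int_integrable] by simp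
  have "cov (\<lambda>\<omega>. Y \<omega> + Z \<omega>) (\<lambda>\<omega>. Y \<omega> + Z \<omega>) =
      expectation (\<lambda>\<omega>. (Y \<omega> - expectation Y + (Z \<omega> - expectation Z))\<^sup>2)"
    by (simp only: cov_self[OF sq_int_add[OF assms]] e add_diff_add)
  with L2_triangle[OF Y Z] show ?thesis by (simp only: cov_self assms)
qed

text \<open>
  Both \<open>E (Y * Z)\<close> and \<open>E Y * E Z\<close> lie between \<open>0\<close> and \<open>E Y\<close>.
\<close>
lemma cov_nonneg_bound:
  assumes "sq_int Y" "sq_int Z" "\<And>\<omega>. 0 \<le> Y \<omega>" "\<And>\<omega>. 0 \<le> Z \<omega>" "\<And>\<omega>. Z \<omega> \<le> 1"
  shows "\<bar>cov Y Z\<bar> \<le> expectation Y"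
proof -
  have i: "integrable M (\<lambda>\<omega>. Y \<omega> * Z \<omega>)" "integrable M Y" "integrable M Z"
    using assms by (auto intro: sq_int_mult_integrable sq_int_integrable)
  have "expectation (\<lambda>\<omega>. Y \<omega> * Z \<omega>) \<le> expectation Y"
    using i assms by (intro integral_mono) (auto intro: mult_left_le)
  moreover have "0 \<le> expectation (\<lambda>\<omega>. Y \<omega> * Z \<omega>)"
    by (intro integral_nonneg_AE AE_I2 mult_nonneg_nonneg assms)
  moreover have "expectation Y * expectation Z \<le> expectation Y * 1"
  proof (intro mult_left_mono)
    have "expectation Z \<le> expectation (\<lambda>\<omega>. 1)" using i assms by (intro integral_mono) auto
    then show "expectation Z \<le> 1" by (simp add: prob_space)
    show "0 \<le> expectation Y" by (intro integral_nonneg_AE AE_I2 assms)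
  qed
  moreover have "0 \<le> expectation Y * expectation Z"
    by (intro mult_nonneg_nonneg integral_nonneg_AE AE_I2 assms)
  ultimately show ?thesis unfolding cov_def by linarith
qed

end

context stationary_process
begin

abbreviation clr :: "real \<Rightarrow> nat \<Rightarrow> nat \<Rightarrow> 'a \<Rightarrow> real" where
  "clr u a b \<equiv> \<lambda>\<omega>. clear a b (exc u \<omega>)"

abbreviation hit :: "real \<Rightarrow> nat \<Rightarrow> nat \<Rightarrow> 'a \<Rightarrow> real" where
  "hit u a b \<equiv> \<lambda>\<omega>. hits a b (exc u \<omega>)"

text \<open>
  By stationarity this is the probability of a clear window of length \<open>h\<close> at any position.
\<close>
definition no_exc_prob :: "real \<Rightarrow> nat \<Rightarrow> real" where
  "no_exc_prob u h = expectation (clr u 0 h)"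

lemma clr_measurable[measurable]: "clr u a b \<in> borel_measurable M" by measurable
lemma hit_measurable[measurable]: "hit u a b \<in> borel_measurable M" by measurable

lemma clr_sq_int[simp, intro]: "sq_int (clr u a b)"
  by (rule sq_int_bounded[where B=1]) (auto intro!: clear_nonneg_le_1 exc_01)

lemma hit_sq_int[simp, intro]: "sq_int (hit u a b)"
  by (rule sq_int_bounded[where B="real (b - a)"]) (auto intro!: hits_nonneg_le exc_01)

lemma clr_bounds: "0 \<le> clr u a b \<omega>" "clr u a b \<omega> \<le> 1"
  by (auto intro!: clear_nonneg_le_1 exc_01)

lemma hit_nonneg: "0 \<le> hit u a b \<omega>"
  by (auto intro!: hits_nonneg_le exc_01)

lemma hit_mono: "c \<le> a \<Longrightarrow> b \<le> d \<Longrightarrow> hit u a b \<omega> \<le> hit u c d \<omega>"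
  unfolding hits_def by (intro sum_mono2) (auto simp: exc_def)

lemma expectation_exc: "expectation (\<lambda>\<omega>. exc u \<omega> i) = tail M X u"
proof -
  have "expectation (\<lambda>\<omega>. exc u \<omega> i) = expectation (\<lambda>\<omega>. exc u \<omega> 0)"
    using expectation_exc_shift[of "\<lambda>x. x 0" u i] by simp
  also have "(\<lambda>\<omega>. exc u \<omega> 0) = (\<lambda>\<omega>. 1 - indicator {\<omega>. X 1 \<omega> \<le> u} \<omega>)"
    by (auto simp: exc_def indicator_def)
  also have "expectation \<dots> = 1 - expectation (indicator ({\<omega>. X 1 \<omega> \<le> u} \<inter> space M))"
  proof -
    have "expectation (\<lambda>\<omega>. 1 - indicator {\<omega>. X 1 \<omega> \<le> u} \<omega> :: real) =
        expectation (\<lambda>\<omega>. 1 - indicator ({\<omega>. X 1 \<omega> \<le> u} \<inter> space M) \<omega>)"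
      by (intro Bochner_Integration.integral_cong) (auto simp: indicator_def)
    also have "{\<omega>. X 1 \<omega> \<le> u} \<inter> space M \<in> sets M"
      using X_measurable[of 1] by (simp add: Int_def conj_commute)
    then have "integrable M (indicator ({\<omega>. X 1 \<omega> \<le> u} \<inter> space M) :: 'a \<Rightarrow> real)"
      by (simp add: integrable_real_indicator emeasure_eq_measure)
    then have "expectation (\<lambda>\<omega>. 1 - indicator ({\<omega>. X 1 \<omega> \<le> u} \<inter> space M) \<omega> :: real) =
        1 - expectation (indicator ({\<omega>. X 1 \<omega> \<le> u} \<inter> space M))"
      by (subst Bochner_Integration.integral_diff) (simp_all only: integrable_const lebesgue_integral_const prob_space, simp)
    finally show ?thesis .
  qed
  also have "expectation (indicator ({\<omega>. X 1 \<omega> \<le> u} \<inter> space M)) = marginal_cdf M X u"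
    unfolding marginal_cdf_def cdf_def using X_measurable[of 1]
    by (simp add: measure_distr vimage_def)
  finally show ?thesis by (simp add: tail_def)
qed

lemma tail_bounds: "0 \<le> tail M X u" "tail M X u \<le> 1"
proof -
  have "0 \<le> expectation (\<lambda>\<omega>. exc u \<omega> 0)" by (simp add: exc_def)
  then show "0 \<le> tail M X u" by (simp only: expectation_exc)
  have "expectation (\<lambda>\<omega>. exc u \<omega> 0) \<le> expectation (\<lambda>\<omega>. 1)"
    by (intro integral_mono integrable_const_bound[where B=1]) (auto simp: exc_def)
  then show "tail M X u \<le> 1" by (simp add: expectation_exc prob_space)
qed

lemma exc_integrable[simp]: "integrable M (\<lambda>\<omega>. exc u \<omega> i)"
  by (rule integrable_const_bound[where B=1]) (auto simp: exc_def)

lemma expectation_hit: "expectation (hit u a b) = real (b - a) * tail M X u"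
  unfolding hits_def by (simp add: expectation_exc)

lemma expectation_clr: "expectation (clr u a (a + h)) = no_exc_prob u h"
  using expectation_exc_shift[OF clear_measurable, of 0 h u a] clear_shift[of 0 a h]
  by (simp add: no_exc_prob_def add.commute)

lemma expectation_hit_square: "expectation (\<lambda>\<omega>. (hit u a (a + h) \<omega>)\<^sup>2) = expectation (\<lambda>\<omega>. (hit u 0 h \<omega>)\<^sup>2)"
proof -
  have "(\<lambda>x. (hits 0 h x)\<^sup>2) \<in> borel_measurable (\<Pi>\<^sub>M i\<in>UNIV. borel)" by measurable
  from expectation_exc_shift[OF this, of u a] show ?thesis
    using hits_shift[of 0 a h] by (simp add: add.commute)
qed

lemma no_exc_prob_bounds: "0 \<le> no_exc_prob u h" "no_exc_prob u h \<le> 1"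
proof -
  show "0 \<le> no_exc_prob u h" unfolding no_exc_prob_def by (simp add: clr_bounds)
  have "expectation (clr u 0 h) \<le> expectation (\<lambda>\<omega>. 1)"
    by (intro integral_mono sq_int_integrable) (auto simp: clr_bounds)
  then show "no_exc_prob u h \<le> 1" by (simp add: no_exc_prob_def prob_space)
qed

lemma no_exc_prob_ge: "1 - no_exc_prob u h \<le> real h * tail M X u"
proof -
  have "expectation (\<lambda>\<omega>. 1 - clr u 0 h \<omega>) \<le> expectation (hit u 0 h)"
    by (intro integral_mono sq_int_integrable sq_int_diff one_minus_clear_le_hits exc_01
        clr_sq_int hit_sq_int sq_int_const)
  moreover have "integrable M (clr u 0 h)" by (intro sq_int_integrable clr_sq_int)
  ultimately show ?thesis by (simp add: expectation_hit no_exc_prob_def prob_space)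
qed

text \<open>
  Shortening a window can change its indicator only if there is an exceedance in the removed part.
\<close>
lemma clr_trim:
  assumes "a \<le> b" "b \<le> c"
  shows "0 \<le> clr u a b \<omega> - clr u a c \<omega>" "clr u a b \<omega> - clr u a c \<omega> \<le> hit u b c \<omega>"
    "0 \<le> clr u b c \<omega> - clr u a c \<omega>" "clr u b c \<omega> - clr u a c \<omega> \<le> hit u a b \<omega>"
proof -
  have 1: "clr u a b \<omega> - clr u a c \<omega> = clr u a b \<omega> * (1 - clr u b c \<omega>)"
    and 2: "clr u b c \<omega> - clr u a c \<omega> = clr u b c \<omega> * (1 - clr u a b \<omega>)"
    using clear_split[OF assms] by (simp_all add: algebra_simps)
  have h: "1 - clr u a b \<omega> \<le> hit u a b \<omega>" for a b by (intro one_minus_clear_le_hits exc_01)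
  have "clr u a b \<omega> * (1 - clr u b c \<omega>) \<le> 1 * (1 - clr u b c \<omega>)"
    "clr u b c \<omega> * (1 - clr u a b \<omega>) \<le> 1 * (1 - clr u a b \<omega>)"
    by (intro mult_right_mono; simp add: clr_bounds)+
  then show "0 \<le> clr u a b \<omega> - clr u a c \<omega>" "clr u a b \<omega> - clr u a c \<omega> \<le> hit u b c \<omega>"
    "0 \<le> clr u b c \<omega> - clr u a c \<omega>" "clr u b c \<omega> - clr u a c \<omega> \<le> hit u a b \<omega>"
    unfolding 1 2 using h[of b c] h[of a b] by (auto simp: clr_bounds)
qed

lemma no_exc_prob_Lipschitz:
  assumes "h \<le> h'"
  shows "0 \<le> no_exc_prob u h - no_exc_prob u h'"
    "no_exc_prob u h - no_exc_prob u h' \<le> real (h' - h) * tail M X u"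
proof -
  have i: "integrable M (clr u 0 h)" for h by (intro sq_int_integrable) auto
  have eq: "no_exc_prob u h - no_exc_prob u h' = expectation (\<lambda>\<omega>. clr u 0 h \<omega> - clr u 0 h' \<omega>)"
    using i by (simp add: no_exc_prob_def)
  show "0 \<le> no_exc_prob u h - no_exc_prob u h'"
    unfolding eq by (intro integral_nonneg_AE AE_I2 clr_trim) (use assms in auto)
  show "no_exc_prob u h - no_exc_prob u h' \<le> real (h' - h) * tail M X u"
    unfolding eq expectation_hit[symmetric]
    by (intro integral_mono clr_trim sq_int_integrable sq_int_diff) (use assms in auto)
qed

lemma no_exc_prob_threshold:
  "\<bar>no_exc_prob u h - no_exc_prob v h\<bar> \<le> real h * \<bar>tail M X u - tail M X v\<bar>"
proof (induction u v rule: linorder_wlog)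
  case (le u v)
  have e: "\<bar>exc u \<omega> i - exc v \<omega> i\<bar> = exc u \<omega> i - exc v \<omega> i" for \<omega> i using le by (auto simp: exc_def)
  have i: "integrable M (clr u 0 h)" for u by (intro sq_int_integrable) auto
  have "\<bar>no_exc_prob u h - no_exc_prob v h\<bar> = \<bar>expectation (\<lambda>\<omega>. clr u 0 h \<omega> - clr v 0 h \<omega>)\<bar>"
    using i by (simp add: no_exc_prob_def)
  also have "\<dots> \<le> expectation (\<lambda>\<omega>. \<bar>clr u 0 h \<omega> - clr v 0 h \<omega>\<bar>)" by (rule integral_abs_bound)
  also have "\<dots> \<le> expectation (\<lambda>\<omega>. \<Sum>i\<in>{0..<h}. exc u \<omega> i - exc v \<omega> i)"
  proof (intro integral_mono)
    show "\<bar>clr u 0 h \<omega> - clr v 0 h \<omega>\<bar> \<le> (\<Sum>i\<in>{0..<h}. exc u \<omega> i - exc v \<omega> i)" for \<omega>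
      using clear_diff_le[of "exc u \<omega>" "exc v \<omega>" 0 h] exc_01 unfolding e by blast
  qed (use i in auto)
  also have "\<dots> = real h * (tail M X u - tail M X v)"
    by (simp add: expectation_exc)
  also have "\<dots> \<le> real h * \<bar>tail M X u - tail M X v\<bar>" by (intro mult_left_mono) auto
  finally show ?case .
qed (simp add: abs_minus_commute)

lemma block_max_le_iff:
  assumes "h \<ge> 1"
  shows "of_bool (block_max X a (a + h) \<omega> \<le> u) = clr u a (a + h) \<omega>"
proof -
  have "block_max X a (a + h) \<omega> \<le> u \<longleftrightarrow> (\<forall>i\<in>{a<..a + h}. X i \<omega> \<le> u)"
    unfolding block_max_def using assms by (subst Max_le_iff) auto
  also have "{a<..a + h} = Suc ` {a..<a + h}"
    unfolding image_Suc_atLeastLessThan by auto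
  also have "(\<forall>i\<in>Suc ` {a..<a + h}. X i \<omega> \<le> u) \<longleftrightarrow> (\<forall>i\<in>{a..<a + h}. exc u \<omega> i = 0)"
  proof -
    have "(\<forall>i\<in>Suc ` A. X i \<omega> \<le> u) \<longleftrightarrow> (\<forall>i\<in>A. X (Suc i) \<omega> \<le> u)" for A by blast
    then show ?thesis by (simp only: exc_def not_less of_bool_eq_0_iff)
  qed
  finally have *: "block_max X a (a + h) \<omega> \<le> u \<longleftrightarrow> (\<forall>i\<in>{a..<a + h}. exc u \<omega> i = 0)" .
  show ?thesis
  proof (cases "\<forall>i\<in>{a..<a + h}. exc u \<omega> i = 0")
    case True
    then show ?thesis unfolding clear_def using * by simp
  next
    case False
    then have "\<exists>i\<in>{a..<a + h}. exc u \<omega> i = 1" using exc_01[of u \<omega>] by blast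
    then have "clr u a (a + h) \<omega> = 0" unfolding clear_def by (simp add: prod_zero_iff)
    then show ?thesis using False * by simp
  qed
qed

lemma prob_block_max:
  assumes "h \<ge> 1"
  shows "\<P>(\<omega> in M. block_max X 0 h \<omega> \<le> u) = no_exc_prob u h"
proof -
  have b: "of_bool (block_max X 0 h \<omega> \<le> u) = clr u 0 h \<omega>" for \<omega>
    using block_max_le_iff[OF assms, of 0] by simp
  have "{\<omega> \<in> space M. block_max X 0 h \<omega> \<le> u} = {\<omega> \<in> space M. clr u 0 h \<omega> = 1}"
    using b by (metis of_bool_eq_1_iff)
  then have [measurable]: "{\<omega> \<in> space M. block_max X 0 h \<omega> \<le> u} \<in> sets M" by simp
  have "\<P>(\<omega> in M. block_max X 0 h \<omega> \<le> u) = expectation (indicator {\<omega> \<in> space M. block_max X 0 h \<omega> \<le> u})"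
    by simp
  also have "\<dots> = expectation (clr u 0 h)"
    by (intro Bochner_Integration.integral_cong) (auto simp: b[symmetric] indicator_def)
  finally show ?thesis by (simp add: no_exc_prob_def)
qed

lemma N_exc_eq: "real (N_exc X h u \<omega>) = hit u 0 h \<omega>"
proof -
  have "(\<Sum>i = 1..h. of_bool (X i \<omega> > u)) = (\<Sum>i\<in>{0..<h}. of_bool (X (Suc i) \<omega> > u) :: nat)"
    by (rule sum.reindex_bij_witness[of _ Suc "\<lambda>i. i - 1"]) auto
  then show ?thesis by (simp add: N_exc_def hits_def exc_def)
qed

lemma clr_L2: "sqrt (expectation (\<lambda>\<omega>. (clr u a b \<omega>)\<^sup>2)) \<le> 1"
proof -
  have "expectation (\<lambda>\<omega>. (clr u a b \<omega>)\<^sup>2) \<le> expectation (\<lambda>\<omega>. 1)"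
    by (intro integral_mono sq_int_square power_le_one) (auto simp: clr_bounds)
  then show ?thesis by (simp add: prob_space)
qed

text \<open>
  The windows may be adjacent.  The gap needed for the mixing bound is obtained by removing the last
  \<open>l\<close> positions of the first window, at the price of at most \<open>l\<close> times the tail.
\<close>
lemma cov_clr_clr:
  assumes "a \<le> b" "b \<le> c" "d \<le> n" "b \<le> n - l"
  shows "\<bar>cov (clr u a b) (clr u c d)\<bar> \<le> max_corr M X n l u + 2 * (real l * tail M X u)"
proof -
  define b' where "b' = max a (b - l)"
  have b': "a \<le> b'" "b' \<le> b" "b - b' \<le> l" using assms by (auto simp: b'_def)
  let ?D = "\<lambda>\<omega>. clr u a b' \<omega> - clr u a b \<omega>"
  have D: "sq_int ?D" by (intro sq_int_diff) auto
  have "cov (clr u a b) (clr u c d) = cov (\<lambda>\<omega>. clr u a b' \<omega> + (-1) * ?D \<omega>) (clr u c d)" by simp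
  also have "\<dots> = cov (clr u a b') (clr u c d) - cov ?D (clr u c d)"
    by (subst cov_add_left) (use D in \<open>auto simp only: cov_cmult_left\<close>)
  finally have eq: "cov (clr u a b) (clr u c d) = cov (clr u a b') (clr u c d) - cov ?D (clr u c d)" .
  have "\<bar>cov ?D (clr u c d)\<bar> \<le> expectation ?D"
    by (rule cov_nonneg_bound) (use D clr_trim(1)[OF b'(1,2)] clr_bounds in auto)
  also have "\<dots> \<le> expectation (hit u b' b)"
    by (intro integral_mono sq_int_integrable D hit_sq_int clr_trim b')
  also have "\<dots> \<le> real l * tail M X u"
    unfolding expectation_hit using b' by (intro mult_right_mono tail_bounds) auto
  finally have 1: "\<bar>cov ?D (clr u c d)\<bar> \<le> real l * tail M X u" .
  have 2: "\<bar>cov (clr u a b') (clr u c d)\<bar> \<le> max_corr M X n l u"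
  proof (cases "b - l \<le> a")
    case True
    then have "clr u a b' = (\<lambda>\<omega>. 1)" by (simp add: b'_def clear_def)
    then show ?thesis by (simp add: max_corr_nonneg)
  next
    case False
    then have b'l: "b' = b - l" "b' \<ge> 1" by (auto simp: b'_def)
    have "\<bar>cov (clr u a b') (clr u c d)\<bar> \<le> max_corr M X n l u *
      (sqrt (expectation (\<lambda>\<omega>. (clr u a b' \<omega>)\<^sup>2)) * sqrt (expectation (\<lambda>\<omega>. (clr u c d \<omega>)\<^sup>2)))"
      by (rule cov_le_max_corr[where t=b' and t'="Suc c"])
        (use assms b' b'l in \<open>auto intro!: clear_threshold_field\<close>)
    also have "\<dots> \<le> max_corr M X n l u * (1 * 1)"
      by (intro mult_left_mono mult_mono clr_L2 max_corr_nonneg) auto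
    finally show ?thesis by simp
  qed
  have "0 \<le> real l * tail M X u" using tail_bounds by simp
  then show ?thesis unfolding eq using 1 2 by linarith
qed

lemma hit_L2_mono:
  assumes "c \<le> a" "b \<le> d"
  shows "sqrt (expectation (\<lambda>\<omega>. (hit u a b \<omega>)\<^sup>2)) \<le> sqrt (expectation (\<lambda>\<omega>. (hit u c d \<omega>)\<^sup>2))"
  by (intro real_sqrt_le_mono integral_mono sq_int_square power_mono hit_mono hit_nonneg assms hit_sq_int)

lemma cov_hit_clr_small: "\<bar>cov (hit u a b) (clr u c d)\<bar> \<le> real (b - a) * tail M X u"
  using cov_nonneg_bound[of "hit u a b" "clr u c d"] by (simp add: clr_bounds hit_nonneg expectation_hit)

text \<open>
  As for two windows, the gap is created by removing \<open>l\<close> positions, here from the count.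
\<close>
lemma cov_hit_clr_left:
  assumes "j \<le> n - l" "j' \<le> n"
  shows "\<bar>cov (hit u 0 j) (clr u j j')\<bar> \<le>
    max_corr M X n l u * sqrt (expectation (\<lambda>\<omega>. (hit u 0 j \<omega>)\<^sup>2)) + real l * tail M X u"
proof -
  have eq: "hit u 0 j = (\<lambda>\<omega>. hit u 0 (j - l) \<omega> + hit u (j - l) j \<omega>)"
    using hits_split[of 0 "j - l" j] by auto
  have "cov (hit u 0 j) (clr u j j') = cov (hit u 0 (j - l)) (clr u j j') + cov (hit u (j - l) j) (clr u j j')"
    unfolding eq by (rule cov_add_left) auto
  moreover have "\<bar>cov (hit u (j - l) j) (clr u j j')\<bar> \<le> real l * tail M X u"
    by (rule order_trans[OF cov_hit_clr_small]) (intro mult_right_mono tail_bounds, simp)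
  moreover have "\<bar>cov (hit u 0 (j - l)) (clr u j j')\<bar> \<le> max_corr M X n l u * sqrt (expectation (\<lambda>\<omega>. (hit u 0 j \<omega>)\<^sup>2))"
  proof (cases "j \<le> l")
    case True
    then show ?thesis by (simp add: hits_def max_corr_nonneg)
  next
    case False
    have "\<bar>cov (hit u 0 (j - l)) (clr u j j')\<bar> \<le> max_corr M X n l u *
      (sqrt (expectation (\<lambda>\<omega>. (hit u 0 (j - l) \<omega>)\<^sup>2)) * sqrt (expectation (\<lambda>\<omega>. (clr u j j' \<omega>)\<^sup>2)))"
      by (rule cov_le_max_corr[where t="j - l" and t'="Suc j"])
        (use assms False in \<open>auto intro!: clear_threshold_field hits_threshold_field\<close>)
    also have "\<dots> \<le> max_corr M X n l u * (sqrt (expectation (\<lambda>\<omega>. (hit u 0 j \<omega>)\<^sup>2)) * 1)"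
      by (intro mult_left_mono mult_mono max_corr_nonneg clr_L2 hit_L2_mono) auto
    finally show ?thesis by simp
  qed
  ultimately show ?thesis by linarith
qed

lemma cov_hit_clr_right:
  assumes "1 \<le> j" "j \<le> n - l" "d \<le> n" "j \<le> d"
  shows "\<bar>cov (hit u j d) (clr u i j)\<bar> \<le>
    max_corr M X n l u * sqrt (expectation (\<lambda>\<omega>. (hit u j d \<omega>)\<^sup>2)) + real l * tail M X u"
proof -
  \<comment> \<open>the count on \<open>{j..<e}\<close> is given up to make room for the gap\<close>
  define e where "e = min d (j + l)"
  have e: "j \<le> e" "e \<le> d" "e - j \<le> l" using assms by (auto simp: e_def)
  have eq: "hit u j d = (\<lambda>\<omega>. hit u j e \<omega> + hit u e d \<omega>)"
    using hits_split[OF e(1,2)] by auto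
  have "cov (hit u j d) (clr u i j) = cov (hit u j e) (clr u i j) + cov (hit u e d) (clr u i j)"
    unfolding eq by (rule cov_add_left) auto
  moreover have "\<bar>cov (hit u j e) (clr u i j)\<bar> \<le> real l * tail M X u"
    by (rule order_trans[OF cov_hit_clr_small])
      (intro mult_right_mono tail_bounds, use e in simp)
  moreover have "\<bar>cov (hit u e d) (clr u i j)\<bar> \<le> max_corr M X n l u * sqrt (expectation (\<lambda>\<omega>. (hit u j d \<omega>)\<^sup>2))"
  proof (cases "d \<le> j + l")
    case True
    then show ?thesis by (simp add: hits_def e_def max_corr_nonneg)
  next
    case False
    then have el: "e = j + l" by (simp add: e_def)
    have "\<bar>cov (clr u i j) (hit u e d)\<bar> \<le> max_corr M X n l u *
      (sqrt (expectation (\<lambda>\<omega>. (clr u i j \<omega>)\<^sup>2)) * sqrt (expectation (\<lambda>\<omega>. (hit u e d \<omega>)\<^sup>2)))"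
      by (rule cov_le_max_corr[where t="j" and t'="Suc e"])
        (use assms False el in \<open>auto intro!: clear_threshold_field hits_threshold_field\<close>)
    also have "\<dots> \<le> max_corr M X n l u * (1 * sqrt (expectation (\<lambda>\<omega>. (hit u j d \<omega>)\<^sup>2)))"
      by (intro mult_left_mono mult_mono max_corr_nonneg clr_L2 hit_L2_mono e) auto
    finally show ?thesis by (simp add: cov_commute)
  qed
  ultimately show ?thesis by linarith
qed

text \<open>The product vanishes identically, so that only the product of the expectations remains.\<close>
lemma cov_hit_clr_same:
  assumes "j \<le> a" "b \<le> j'" "j + h = j'" "a \<le> b"
  shows "cov (hit u a b) (clr u j j') = - (real (b - a) * tail M X u * no_exc_prob u h)"
proof -
  have "(\<lambda>\<omega>. hit u a b \<omega> * clr u j j' \<omega>) = (\<lambda>\<omega>. 0)"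
    using clear_mult_hits_0[OF exc_01 assms(1,2)] by (auto simp: mult.commute)
  then show ?thesis using assms(3) by (auto simp: cov_def expectation_hit expectation_clr)
qed

text \<open>
  Exceedances inside a window can only occur when the window is not clear, and the others are almost
  uncorrelated with it.
\<close>
lemma cov_hit_clr_within:
  assumes "j + h \<le> d" "d \<le> n" "j + h \<le> n - l" "1 \<le> h"
  shows "\<bar>cov (hit u 0 d) (clr u j (j + h)) + real h * tail M X u * no_exc_prob u h\<bar> \<le>
    2 * (max_corr M X n l u * sqrt (expectation (\<lambda>\<omega>. (hit u 0 d \<omega>)\<^sup>2)) + real l * tail M X u)"
proof -
  let ?c = "clr u j (j + h)"
  have eq: "hit u 0 d = (\<lambda>\<omega>. hit u 0 j \<omega> + (hit u j (j + h) \<omega> + hit u (j + h) d \<omega>))"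
    using hits_split[of 0 j d] hits_split[of j "j + h" d] assms by auto
  have c: "cov (hit u 0 d) ?c = cov (hit u 0 j) ?c + (cov (hit u j (j + h)) ?c + cov (hit u (j + h) d) ?c)"
    unfolding eq by (subst cov_add_left; (subst cov_add_left)?) auto
  have m: "cov (hit u j (j + h)) ?c = - (real h * tail M X u * no_exc_prob u h)"
    using cov_hit_clr_same[of j j "j + h" "j + h" h u] by simp
  have "\<bar>cov (hit u 0 j) ?c\<bar> \<le> max_corr M X n l u * sqrt (expectation (\<lambda>\<omega>. (hit u 0 j \<omega>)\<^sup>2)) + real l * tail M X u"
    by (rule cov_hit_clr_left) (use assms in auto)
  also have "\<dots> \<le> max_corr M X n l u * sqrt (expectation (\<lambda>\<omega>. (hit u 0 d \<omega>)\<^sup>2)) + real l * tail M X u"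
    using assms by (intro add_right_mono mult_left_mono max_corr_nonneg hit_L2_mono) auto
  finally have l: "\<bar>cov (hit u 0 j) ?c\<bar> \<le> max_corr M X n l u * sqrt (expectation (\<lambda>\<omega>. (hit u 0 d \<omega>)\<^sup>2)) + real l * tail M X u" .
  have "\<bar>cov (hit u (j + h) d) ?c\<bar> \<le> max_corr M X n l u * sqrt (expectation (\<lambda>\<omega>. (hit u (j + h) d \<omega>)\<^sup>2)) + real l * tail M X u"
    by (rule cov_hit_clr_right) (use assms in auto)
  also have "\<dots> \<le> max_corr M X n l u * sqrt (expectation (\<lambda>\<omega>. (hit u 0 d \<omega>)\<^sup>2)) + real l * tail M X u"
    using assms by (intro add_right_mono mult_left_mono max_corr_nonneg hit_L2_mono) auto
  finally have r: "\<bar>cov (hit u (j + h) d) ?c\<bar> \<le> max_corr M X n l u * sqrt (expectation (\<lambda>\<omega>. (hit u 0 d \<omega>)\<^sup>2)) + real l * tail M X u" .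
  have "\<bar>x + (- y + z) + y\<bar> \<le> 2 * e" if "\<bar>x\<bar> \<le> e" "\<bar>z\<bar> \<le> e" for x y z e :: real
    using that by linarith
  from this[OF l r] show ?thesis unfolding c m .
qed

text \<open>
  The part of the count inside the window is bounded crudely; only one block of window positions is
  affected.
\<close>
lemma cov_hit_clr_boundary:
  assumes "j \<le> d" "d \<le> j + h" "j + h \<le> n" "d \<le> n - l"
  shows "\<bar>cov (hit u 0 d) (clr u j (j + h))\<bar> \<le> real h * tail M X u +
    (max_corr M X n l u * sqrt (expectation (\<lambda>\<omega>. (hit u 0 d \<omega>)\<^sup>2)) + real l * tail M X u)"
proof -
  let ?c = "clr u j (j + h)"
  have eq: "hit u 0 d = (\<lambda>\<omega>. hit u 0 j \<omega> + hit u j d \<omega>)"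
    using hits_split[of 0 j d] assms by auto
  have c: "cov (hit u 0 d) ?c = cov (hit u 0 j) ?c + cov (hit u j d) ?c"
    unfolding eq by (subst cov_add_left) auto
  have "\<bar>cov (hit u 0 j) ?c\<bar> \<le> max_corr M X n l u * sqrt (expectation (\<lambda>\<omega>. (hit u 0 j \<omega>)\<^sup>2)) + real l * tail M X u"
    by (rule cov_hit_clr_left) (use assms in auto)
  also have "\<dots> \<le> max_corr M X n l u * sqrt (expectation (\<lambda>\<omega>. (hit u 0 d \<omega>)\<^sup>2)) + real l * tail M X u"
    using assms by (intro add_right_mono mult_left_mono max_corr_nonneg hit_L2_mono) auto
  finally have l: "\<bar>cov (hit u 0 j) ?c\<bar> \<le> max_corr M X n l u * sqrt (expectation (\<lambda>\<omega>. (hit u 0 d \<omega>)\<^sup>2)) + real l * tail M X u" .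
  have "\<bar>cov (hit u j d) ?c\<bar> \<le> real (d - j) * tail M X u" by (rule cov_hit_clr_small)
  also have "\<dots> \<le> real h * tail M X u" using assms by (intro mult_right_mono tail_bounds) auto
  finally show ?thesis unfolding c using l by linarith
qed

end

section \<open>The asymptotic probability of a clear window\<close>

lemma abs_exp_minus_diff_le:
  fixes a b :: real
  assumes "0 \<le> a" "0 \<le> b"
  shows "\<bar>exp (- a) - exp (- b)\<bar> \<le> \<bar>a - b\<bar>"
proof (rule linorder_wlog[of "\<lambda>a b. 0 \<le> a \<longrightarrow> 0 \<le> b \<longrightarrow> \<bar>exp (- a) - exp (- b)\<bar> \<le> \<bar>a - b\<bar>" a b, rule_format])
  fix a b :: real assume ab: "a \<le> b" and a: "0 \<le> a"
  have "exp (- a) - exp (- b) = exp (- a) * (1 - exp (- (b - a)))"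
    by (simp add: right_diff_distrib flip: exp_add)
  also have "1 - exp (- (b - a)) \<le> b - a" using exp_ge_add_one_self[of "- (b - a)"] by linarith
  then have "exp (- a) * (1 - exp (- (b - a))) \<le> 1 * (b - a)"
    using ab a by (intro mult_mono) auto
  finally show "\<bar>exp (- a) - exp (- b)\<bar> \<le> \<bar>a - b\<bar>" using ab by simp
qed (use assms in \<open>auto simp: abs_minus_commute\<close>)

lemma real_div_le: "0 < N \<Longrightarrow> real a / real N \<le> real (a div N) + 1"
proof -
  assume N: "0 < N"
  have "a \<le> a div N * N + N" using dividend_less_div_times[OF N, of a] by simp
  then have "real a \<le> real (a div N * N + N)" by (simp only: of_nat_le_iff)
  then show ?thesis using N by (simp add: field_simps)
qed

text \<open>The number \<open>m2\<close> stands for the limiting second moment of the cluster size.\<close>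
locale block_asymptotics = stationary_process M X for M :: "'a measure" and X +
  fixes \<theta> \<tau> m2 p :: real and u :: "nat \<Rightarrow> real" and r l s :: "nat \<Rightarrow> nat"
  assumes ext: "has_extremal_index M X \<theta>"
    and tau_pos: "\<tau> > 0"
    and tail_lim: "(\<lambda>k. real k * tail M X (u k)) \<longlonglongrightarrow> \<tau>"
    and r_pos: "\<And>n. n \<ge> 1 \<Longrightarrow> r n > 0"
    and l_pos: "\<And>n. n \<ge> 1 \<Longrightarrow> l n > 0"
    and s_pos: "\<And>n. n \<ge> 1 \<Longrightarrow> s n > 0"
    and l_r: "(\<lambda>n. real (l n)) \<in> o(\<lambda>n. real (r n))"
    and r_n: "(\<lambda>n. real (r n)) \<in> o(\<lambda>n. real n)"
    and l_s: "(\<lambda>n. real (l n)) \<in> o(\<lambda>n. real (s n))"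
    and s_r: "(\<lambda>n. real (s n)) \<in> o(\<lambda>n. real (r n))"
    and rho_small: "(\<lambda>n. max_corr M X n (l n) (u (r n))) \<in> o(\<lambda>n. real (s n) / real n)"
    and m2_lim: "(\<lambda>n. cond_expectation_on M (\<lambda>\<omega>. (real (N_exc X (s n) (u (r n)) \<omega>))\<^sup>2)
                 (\<lambda>\<omega>. block_max X 0 (s n) \<omega> > u (r n))) \<longlonglongrightarrow> m2"
    and p_gt_1: "p > 1"
    and moments: "(\<lambda>n. expectation (\<lambda>\<omega>. real (N_exc X (r n) (u (r n)) \<omega>) powr (2 * p))) \<in> O(\<lambda>_. 1)"
begin

abbreviation un :: "nat \<Rightarrow> real" where "un n \<equiv> u (r n)"
abbreviation rho :: "nat \<Rightarrow> real" where "rho n \<equiv> max_corr M X n (l n) (un n)"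
abbreviation tbar :: "nat \<Rightarrow> real" where "tbar n \<equiv> tail M X (un n)"
abbreviation G :: "nat \<Rightarrow> nat \<Rightarrow> real" where "G n \<equiv> no_exc_prob (un n)"
definition \<alpha> :: real where "\<alpha> = \<tau> * \<theta>"

lemma alpha_pos: "\<alpha> > 0"
  using ext tau_pos by (simp add: has_extremal_index_def \<alpha>_def)

lemma ratio_limits:
  "(\<lambda>n. real (l n) / real (r n)) \<longlonglongrightarrow> 0" "(\<lambda>n. real (r n) / real n) \<longlonglongrightarrow> 0"
  "(\<lambda>n. real (l n) / real (s n)) \<longlonglongrightarrow> 0" "(\<lambda>n. real (s n) / real (r n)) \<longlonglongrightarrow> 0"
  "(\<lambda>n. rho n * real n / real (s n)) \<longlonglongrightarrow> 0"
proof -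
  show "(\<lambda>n. real (l n) / real (r n)) \<longlonglongrightarrow> 0" using l_r by (rule smalloD_tendsto)
  show "(\<lambda>n. real (r n) / real n) \<longlonglongrightarrow> 0" using r_n by (rule smalloD_tendsto)
  show "(\<lambda>n. real (l n) / real (s n)) \<longlonglongrightarrow> 0" using l_s by (rule smalloD_tendsto)
  show "(\<lambda>n. real (s n) / real (r n)) \<longlonglongrightarrow> 0" using s_r by (rule smalloD_tendsto)
  show "(\<lambda>n. rho n * real n / real (s n)) \<longlonglongrightarrow> 0"
    using smalloD_tendsto[OF rho_small] by simp
qed

lemma ev_pos: "\<forall>\<^sub>F n in sequentially. n \<ge> 1 \<and> r n \<ge> 1 \<and> l n \<ge> 1 \<and> s n \<ge> 1"
  using r_pos l_pos s_pos by (intro eventually_sequentiallyI[of 1]) (auto simp: Suc_le_eq)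

lemma r_at_top: "filterlim r at_top sequentially"
proof -
  have "(\<lambda>n. 1 / real (r n)) \<longlonglongrightarrow> 0"
  proof (rule real_tendsto_sandwich[OF _ _ tendsto_const ratio_limits(1)])
    show "\<forall>\<^sub>F n in sequentially. 1 / real (r n) \<le> real (l n) / real (r n)"
      using ev_pos by eventually_elim (auto intro!: divide_right_mono)
  qed simp
  then have "filterlim (\<lambda>n. inverse (1 / real (r n))) at_top sequentially"
    by (rule filterlim_inverse_at_top) (use ev_pos in \<open>eventually_elim, auto\<close>)
  then show ?thesis by (simp add: filterlim_sequentially_iff_filterlim_real)
qed

lemma r_real_at_top: "filterlim (\<lambda>n. real (r n)) at_top sequentially"
  using r_at_top by (simp add: filterlim_sequentially_iff_filterlim_real)

lemma r_tbar: "(\<lambda>n. real (r n) * tbar n) \<longlonglongrightarrow> \<tau>"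
  using filterlim_compose[OF tail_lim r_at_top] .

lemma l_tbar: "(\<lambda>n. real (l n) * tbar n) \<longlonglongrightarrow> 0"
proof -
  have "(\<lambda>n. (real (l n) / real (r n)) * (real (r n) * tbar n)) \<longlonglongrightarrow> 0 * \<tau>"
    by (intro tendsto_mult ratio_limits r_tbar)
  moreover have "\<forall>\<^sub>F n in sequentially. (real (l n) / real (r n)) * (real (r n) * tbar n) = real (l n) * tbar n"
    using ev_pos by eventually_elim auto
  ultimately show ?thesis using Lim_transform_eventually by fastforce
qed

lemma s_tbar: "(\<lambda>n. real (s n) * tbar n) \<longlonglongrightarrow> 0"
proof -
  have "(\<lambda>n. (real (s n) / real (r n)) * (real (r n) * tbar n)) \<longlonglongrightarrow> 0 * \<tau>"
    by (intro tendsto_mult ratio_limits r_tbar)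
  moreover have "\<forall>\<^sub>F n in sequentially. (real (s n) / real (r n)) * (real (r n) * tbar n) = real (s n) * tbar n"
    using ev_pos by eventually_elim auto
  ultimately show ?thesis using Lim_transform_eventually by fastforce
qed

lemma tbar_0: "tbar \<longlonglongrightarrow> 0"
proof (rule real_tendsto_sandwich[OF _ _ tendsto_const s_tbar])
  show "\<forall>\<^sub>F n in sequentially. tbar n \<le> real (s n) * tbar n"
    using ev_pos
  proof eventually_elim
    case (elim n)
    then have "1 * tbar n \<le> real (s n) * tbar n" by (intro mult_right_mono tail_bounds) auto
    then show ?case by simp
  qed
qed (simp add: tail_bounds)

lemma rho_n_r: "(\<lambda>n. rho n * real n / real (r n)) \<longlonglongrightarrow> 0"
proof -
  have "(\<lambda>n. (rho n * real n / real (s n)) * (real (s n) / real (r n))) \<longlonglongrightarrow> 0 * 0"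
    by (intro tendsto_mult ratio_limits)
  moreover have "\<forall>\<^sub>F n in sequentially. (rho n * real n / real (s n)) * (real (s n) / real (r n)) = rho n * real n / real (r n)"
    using ev_pos by eventually_elim auto
  ultimately show ?thesis using Lim_transform_eventually by fastforce
qed

lemma rho_0: "rho \<longlonglongrightarrow> 0"
proof -
  have "(\<lambda>n. (rho n * real n / real (r n)) * (real (r n) / real n)) \<longlonglongrightarrow> 0 * 0"
    by (intro tendsto_mult ratio_limits rho_n_r)
  moreover have "\<forall>\<^sub>F n in sequentially. (rho n * real n / real (r n)) * (real (r n) / real n) = rho n"
    using ev_pos by eventually_elim auto
  ultimately show ?thesis using Lim_transform_eventually by fastforce
qed

lemma ev_blocks_fit: "\<forall>\<^sub>F n in sequentially. q * r n \<le> n"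
proof -
  have "\<forall>\<^sub>F n in sequentially. real (r n) / real n < 1 / (real q + 1)"
    by (rule order_tendstoD(2)[OF ratio_limits(2)]) simp
  then show ?thesis using ev_pos
  proof eventually_elim
    case (elim n)
    then have "real (r n) * (real q + 1) < real n" by (simp add: field_simps)
    then have "real (r n * (q + 1)) < real n" by (simp add: algebra_simps)
    then have "r n * (q + 1) < n" by (simp only: of_nat_less_iff)
    then show ?case by (simp add: algebra_simps)
  qed
qed

lemma ev_small_lags: "\<forall>\<^sub>F n in sequentially. l n \<le> r n \<and> 2 * l n \<le> s n \<and> s n \<le> r n"
proof -
  have "\<forall>\<^sub>F n in sequentially. real (l n) / real (r n) < 1" "\<forall>\<^sub>F n in sequentially. real (l n) / real (s n) < 1 / 2"
    "\<forall>\<^sub>F n in sequentially. real (s n) / real (r n) < 1"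
    by (intro order_tendstoD(2)[OF ratio_limits(1)] order_tendstoD(2)[OF ratio_limits(3)]
        order_tendstoD(2)[OF ratio_limits(4)]; simp)+
  then show ?thesis using ev_pos
    by eventually_elim (auto simp: divide_simps)
qed

text \<open>
  The extremal index provides some thresholds \<open>v\<close> adapted to the level \<open>x * \<tau>\<close>, used here along the
  subsequence \<open>m n\<close>.  Any other thresholds with asymptotically the same tails give the same
  probability.  For \<open>x = 0\<close> the expected number of exceedances tends to \<open>0\<close>.
\<close>
lemma no_exc_prob_tendsto:
  assumes m: "(\<lambda>n. real (m n) / real (r n)) \<longlonglongrightarrow> x" and x: "x \<ge> 0"
  shows "(\<lambda>n. G n (m n)) \<longlonglongrightarrow> exp (- \<alpha> * x)"
proof -
  have mtl: "(\<lambda>n. real (m n) * tbar n) \<longlonglongrightarrow> x * \<tau>"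
  proof -
    have "(\<lambda>n. (real (m n) / real (r n)) * (real (r n) * tbar n)) \<longlonglongrightarrow> x * \<tau>"
      by (intro tendsto_mult m r_tbar)
    moreover have "\<forall>\<^sub>F n in sequentially. (real (m n) / real (r n)) * (real (r n) * tbar n) = real (m n) * tbar n"
      using ev_pos by eventually_elim auto
    ultimately show ?thesis by (simp add: tendsto_cong)
  qed
  show ?thesis
  proof (cases "x = 0")
    case True
    have "(\<lambda>n. 1 - G n (m n)) \<longlonglongrightarrow> 0"
    proof (rule real_tendsto_sandwich[OF _ _ tendsto_const])
      show "(\<lambda>n. real (m n) * tbar n) \<longlonglongrightarrow> 0" using mtl True by simp
    qed (use no_exc_prob_bounds no_exc_prob_ge in auto)
    from tendsto_diff[OF tendsto_const[of 1] this] show ?thesis using True by simp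
  next
    case False
    then have x: "x > 0" using x by simp
    obtain v where v: "(\<lambda>n. real n * tail M X (v n)) \<longlonglongrightarrow> x * \<tau>"
      "(\<lambda>n. \<P>(\<omega> in M. block_max X 0 n \<omega> \<le> v n)) \<longlonglongrightarrow> exp (- \<theta> * (x * \<tau>))"
      using ext x tau_pos unfolding has_extremal_index_def by (meson mult_pos_pos)
    have "filterlim (\<lambda>n. real (m n) / real (r n) * real (r n)) at_top sequentially"
      by (rule filterlim_tendsto_pos_mult_at_top[OF m x r_real_at_top])
    moreover have "\<forall>\<^sub>F n in sequentially. real (m n) / real (r n) * real (r n) = real (m n)"
      using ev_pos by eventually_elim auto
    ultimately have "filterlim (\<lambda>n. real (m n)) at_top sequentially"
      by (simp add: filterlim_cong)
    then have m_top: "filterlim m at_top sequentially" by (simp add: filterlim_sequentially_iff_filterlim_real)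
    have "(\<lambda>n. \<P>(\<omega> in M. block_max X 0 (m n) \<omega> \<le> v (m n))) \<longlonglongrightarrow> exp (- \<theta> * (x * \<tau>))"
      by (rule filterlim_compose[OF v(2) m_top])
    moreover have "\<forall>\<^sub>F n in sequentially. \<P>(\<omega> in M. block_max X 0 (m n) \<omega> \<le> v (m n)) = no_exc_prob (v (m n)) (m n)"
      using eventually_compose_filterlim[OF eventually_ge_at_top[of 1] m_top]
      by eventually_elim (rule prob_block_max)
    ultimately have 1: "(\<lambda>n. no_exc_prob (v (m n)) (m n)) \<longlonglongrightarrow> exp (- \<theta> * (x * \<tau>))"
      by (simp only: tendsto_cong)
    have "(\<lambda>n. \<bar>real (m n) * tbar n - real (m n) * tail M X (v (m n))\<bar>) \<longlonglongrightarrow> \<bar>x * \<tau> - x * \<tau>\<bar>"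
      by (intro tendsto_intros mtl filterlim_compose[OF v(1) m_top])
    then have "(\<lambda>n. \<bar>real (m n) * tbar n - real (m n) * tail M X (v (m n))\<bar>) \<longlonglongrightarrow> 0" by simp
    then have "(\<lambda>n. G n (m n) - no_exc_prob (v (m n)) (m n)) \<longlonglongrightarrow> 0"
    proof (rule Lim_null_comparison[rotated])
      have "\<bar>G n (m n) - no_exc_prob (v (m n)) (m n)\<bar> \<le> \<bar>real (m n) * tbar n - real (m n) * tail M X (v (m n))\<bar>" for n
        using no_exc_prob_threshold[of "un n" "m n" "v (m n)"] by (simp add: abs_mult flip: right_diff_distrib)
      then show "\<forall>\<^sub>F n in sequentially. norm (G n (m n) - no_exc_prob (v (m n)) (m n)) \<le>
          \<bar>real (m n) * tbar n - real (m n) * tail M X (v (m n))\<bar>" by simp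
    qed
    from tendsto_add[OF this 1] show ?thesis by (simp add: mult_ac \<alpha>_def)
  qed
qed

text \<open>Both sides vary slowly in \<open>h\<close>, so a grid of mesh \<open>1/N\<close> gives uniformity.\<close>
lemma no_exc_prob_uniform:
  "\<exists>\<epsilon>. \<epsilon> \<longlonglongrightarrow> 0 \<and> (\<forall>n. \<forall>h \<le> 2 * r n. \<bar>G n h - exp (- \<alpha> * (real h / real (r n)))\<bar> \<le> \<epsilon> n)"
proof -
  define f where "f n h = \<bar>G n h - exp (- \<alpha> * (real h / real (r n)))\<bar>" for n h
  define \<epsilon> where "\<epsilon> n = Max (f n ` {..2 * r n})" for n
  define b where "b N n = real (r n) * tbar n / real N + tbar n + \<alpha> * (1 / real N + 1 / real (r n)) + (\<Sum>i\<le>2 * N. f n (i * r n div N))" for N n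
  have inv_r: "(\<lambda>n. 1 / real (r n)) \<longlonglongrightarrow> 0"
    by (rule tendsto_divide_0[OF tendsto_const filterlim_at_top_imp_at_infinity[OF r_real_at_top]])
  have "((\<lambda>(N, n). b N n) \<longlongrightarrow> 0) iter_seq"
  proof (rule tendsto_iter_seq)
    fix N
    have f0: "(\<lambda>n. f n (i * r n div N)) \<longlonglongrightarrow> 0" for i
    proof -
      have "(\<lambda>n. real (i * r n div N) / real (r n)) \<longlonglongrightarrow> real i / real N"
      proof (cases "N = 0")
        case False
        have "(\<lambda>n. real i / real N - real (i * r n div N) / real (r n)) \<longlonglongrightarrow> 0"
        proof (rule real_tendsto_sandwich[OF _ _ tendsto_const inv_r])
          have *: "\<forall>\<^sub>F n in sequentially. 0 \<le> real i / real N - real (i * r n div N) / real (r n) \<and>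
              real i / real N - real (i * r n div N) / real (r n) \<le> 1 / real (r n)"
            using ev_pos
          proof eventually_elim
            case (elim n)
            have a: "real (i * r n div N) \<le> real (i * r n) / real N" by (rule of_nat_div_le_of_nat)
            have b: "real (i * r n) / real N \<le> real (i * r n div N) + 1"
              by (rule real_div_le) (use False in simp)
            have "real i / real N = real (i * r n) / real N / real (r n)" using elim by simp
            with divide_right_mono[OF a, of "real (r n)"] divide_right_mono[OF b, of "real (r n)"]
            show ?case by (simp add: add_divide_distrib)
          qed
          show "\<forall>\<^sub>F n in sequentially. 0 \<le> real i / real N - real (i * r n div N) / real (r n)"
            using * by eventually_elim auto
          show "\<forall>\<^sub>F n in sequentially. real i / real N - real (i * r n div N) / real (r n) \<le> 1 / real (r n)"
            using * by eventually_elim auto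
        qed
        from tendsto_diff[OF tendsto_const[of "real i / real N"] this] show ?thesis by simp
      qed simp
      then have *: "(\<lambda>n. real (i * r n div N) / real (r n)) \<longlonglongrightarrow> real i / real N" .
      have "(\<lambda>n. f n (i * r n div N)) \<longlonglongrightarrow> \<bar>exp (- \<alpha> * (real i / real N)) - exp (- \<alpha> * (real i / real N))\<bar>"
        unfolding f_def by (intro tendsto_intros no_exc_prob_tendsto *) simp
      then show ?thesis by simp
    qed
    have "(\<lambda>n. b N n) \<longlonglongrightarrow> \<tau> * (1 / real N) + 0 + \<alpha> * (1 / real N + 0) + (\<Sum>i\<le>2 * N. 0)"
      unfolding b_def divide_inverse[of "_ * _" "real N"] inverse_eq_divide
      by (intro tendsto_add tendsto_mult tendsto_const r_tbar tbar_0 inv_r tendsto_sum f0)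
    then show "(\<lambda>n. b N n) \<longlonglongrightarrow> (\<tau> + \<alpha>) / real N" by (simp add: add_divide_distrib)
  next
    show "(\<lambda>N. (\<tau> + \<alpha>) / real N) \<longlonglongrightarrow> 0"
      by (rule tendsto_divide_0[OF tendsto_const filterlim_at_top_imp_at_infinity[OF filterlim_real_sequentially]])
  qed
  moreover have "\<forall>\<^sub>F x in iter_seq. norm (\<epsilon> (snd x)) \<le> (case x of (N, n) \<Rightarrow> b N n)"
  proof -
    have "\<forall>\<^sub>F n in sequentially. \<epsilon> n \<le> b N n" if N: "N \<ge> 1" for N
      using ev_pos
    proof eventually_elim
      case (elim n)
      show "\<epsilon> n \<le> b N n"
        unfolding \<epsilon>_def
      proof (rule Max.boundedI)
        fix y assume "y \<in> f n ` {..2 * r n}"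
        then obtain h where h: "h \<le> 2 * r n" "y = f n h" by auto
        \<comment> \<open>\<open>h'\<close> is the grid point next to \<open>h\<close> from below\<close>
        define i where "i = h * N div r n"
        define h' where "h' = i * r n div N"
        have rn: "r n > 0" using elim by simp
        have "i * r n \<le> h * N" unfolding i_def by (rule div_times_less_eq_dividend)
        then have h'h: "h' \<le> h" unfolding h'_def using N by (metis div_le_mono nonzero_mult_div_cancel_right not_one_le_zero)
        have "h * N \<le> 2 * N * r n" using h(1) by (simp add: mult.commute mult.left_commute)
        then have i2: "i \<le> 2 * N" unfolding i_def using rn by (metis div_le_mono nonzero_mult_div_cancel_right less_irrefl)
        have dist: "real h - real h' \<le> real (r n) / real N + 1"
        proof -
          have "h * N \<le> i * r n + r n" unfolding i_def using dividend_less_div_times[OF rn, of "h * N"] by simp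
          then have "real (h * N) \<le> real (i * r n + r n)" by (simp only: of_nat_le_iff)
          then have a: "real h \<le> (real (i * r n) + real (r n)) / real N" using N by (simp add: field_simps)
          have "real (i * r n) / real N \<le> real h' + 1"
            unfolding h'_def by (rule real_div_le) (use N in simp)
          with a show ?thesis by (simp add: add_divide_distrib)
        qed
        have "\<bar>G n h - G n h'\<bar> \<le> (real h - real h') * tbar n"
          using no_exc_prob_Lipschitz[OF h'h, of "un n"] h'h by (simp add: of_nat_diff)
        also have "\<dots> \<le> (real (r n) / real N + 1) * tbar n" using dist by (intro mult_right_mono tail_bounds)
        finally have g: "\<bar>G n h - G n h'\<bar> \<le> (real (r n) / real N + 1) * tbar n" .
        have "\<bar>exp (- (\<alpha> * (real h / real (r n)))) - exp (- (\<alpha> * (real h' / real (r n))))\<bar> \<le>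
            \<bar>\<alpha> * (real h / real (r n)) - \<alpha> * (real h' / real (r n))\<bar>"
          using alpha_pos by (intro abs_exp_minus_diff_le mult_nonneg_nonneg) auto
        also have "\<dots> = \<alpha> * ((real h - real h') / real (r n))"
        proof -
          have "\<alpha> * (real h / real (r n)) - \<alpha> * (real h' / real (r n)) = \<alpha> * ((real h - real h') / real (r n))"
            by (simp add: right_diff_distrib diff_divide_distrib)
          moreover have "0 \<le> \<alpha> * ((real h - real h') / real (r n))" using alpha_pos h'h by simp
          ultimately show ?thesis by (simp only: abs_of_nonneg)
        qed
        also have "\<dots> \<le> \<alpha> * ((real (r n) / real N + 1) / real (r n))"
          using dist alpha_pos by (intro mult_left_mono divide_right_mono) auto
        also have "(real (r n) / real N + 1) / real (r n) = 1 / real N + 1 / real (r n)"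
          using rn by (simp add: add_divide_distrib)
        finally have e: "\<bar>exp (- \<alpha> * (real h / real (r n))) - exp (- \<alpha> * (real h' / real (r n)))\<bar> \<le>
            \<alpha> * (1 / real N + 1 / real (r n))" by simp
        have "f n h' \<le> (\<Sum>i\<le>2 * N. f n (i * r n div N))"
          unfolding h'_def by (rule member_le_sum[of i _ "\<lambda>i. f n (i * r n div N)"]) (use i2 in \<open>auto simp: f_def\<close>)
        then show "y \<le> b N n"
          using g e unfolding h(2) b_def f_def by (simp add: distrib_right)
      qed auto
    qed
    moreover have "0 \<le> \<epsilon> n" for n
    proof -
      have "f n 0 \<le> \<epsilon> n" unfolding \<epsilon>_def by (intro Max_ge) auto
      then show ?thesis unfolding f_def by linarith
    qed
    ultimately have "\<forall>\<^sub>F n in sequentially. norm (\<epsilon> n) \<le> b N n" if "N \<ge> 1" for N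
      using that by simp
    then show ?thesis
      unfolding eventually_iter_seq snd_conv prod.case by (rule eventually_sequentiallyI)
  qed
  ultimately have "\<epsilon> \<longlonglongrightarrow> 0" by (rule LIMSEQ_0_if_iter_bound)
  moreover have "f n h \<le> \<epsilon> n" if "h \<le> 2 * r n" for n h
    unfolding \<epsilon>_def by (rule Max_ge) (use that in auto)
  ultimately show ?thesis unfolding f_def by blast
qed

end

section \<open>The variance of the number of exceedances\<close>

lemma sum_squares_le_square_sum:
  fixes x :: "nat \<Rightarrow> real"
  assumes "\<And>i. 0 \<le> x i"
  shows "(\<Sum>i<K. (x i)\<^sup>2) \<le> (\<Sum>i<K. x i)\<^sup>2"
proof (induction K)
  case (Suc K)
  have "0 \<le> (\<Sum>i<K. x i)" by (intro sum_nonneg assms)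
  then have "0 \<le> 2 * (\<Sum>i<K. x i) * x K" using assms by simp
  then show ?case unfolding sum.lessThan_Suc power2_sum using Suc by linarith
qed simp

lemma hits_nat_group: "hits 0 (K * h) x = (\<Sum>i<K. hits (i * h) (i * h + h) x)"
  unfolding hits_def by (simp only: sum.nat_group lessThan_atLeast0[symmetric])

context stationary_process
begin

text \<open>
  Each step splits off one block, with an error given by the covariance of two adjacent windows.
\<close>
lemma no_exc_prob_power:
  assumes "K * h \<le> n - l"
  shows "\<bar>no_exc_prob u (K * h) - no_exc_prob u h ^ K\<bar> \<le> real K * (max_corr M X n l u + 2 * (real l * tail M X u))"
  using assms
proof (induction K)
  case 0
  then show ?case by (simp add: no_exc_prob_def clear_def prob_space)
next
  case (Suc K)
  let ?e = "max_corr M X n l u + 2 * (real l * tail M X u)"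
  let ?g = "no_exc_prob u h"
  have "clr u 0 (Suc K * h) = (\<lambda>\<omega>. clr u 0 (K * h) \<omega> * clr u (K * h) (K * h + h) \<omega>)"
    using clear_split[of 0 "K * h" "Suc K * h"] by (auto simp: add.commute)
  then have "no_exc_prob u (Suc K * h) = expectation (\<lambda>\<omega>. clr u 0 (K * h) \<omega> * clr u (K * h) (K * h + h) \<omega>)"
    unfolding no_exc_prob_def by (simp only:)
  also have "\<dots> = cov (clr u 0 (K * h)) (clr u (K * h) (K * h + h)) + no_exc_prob u (K * h) * ?g"
    by (simp add: cov_def expectation_clr no_exc_prob_def[of u "K * h"])
  finally have "no_exc_prob u (Suc K * h) = cov (clr u 0 (K * h)) (clr u (K * h) (K * h + h)) + no_exc_prob u (K * h) * ?g" .
  then have "no_exc_prob u (Suc K * h) - ?g ^ Suc K =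
      cov (clr u 0 (K * h)) (clr u (K * h) (K * h + h)) + (no_exc_prob u (K * h) - ?g ^ K) * ?g"
    by (simp add: algebra_simps)
  also have "\<bar>\<dots>\<bar> \<le> ?e + (real K * ?e) * 1"
  proof (rule order_trans[OF abs_triangle_ineq add_mono])
    show "\<bar>cov (clr u 0 (K * h)) (clr u (K * h) (K * h + h))\<bar> \<le> ?e"
      by (rule cov_clr_clr) (use Suc.prems in auto)
    show "\<bar>(no_exc_prob u (K * h) - ?g ^ K) * ?g\<bar> \<le> real K * ?e * 1"
      unfolding abs_mult using Suc no_exc_prob_bounds[of u h] tail_bounds max_corr_nonneg by (intro mult_mono) auto
  qed
  also have "\<dots> = real (Suc K) * ?e" by (simp add: algebra_simps)
  finally show ?case .
qed

text \<open>The square of a sum of nonnegative counts dominates the sum of their squares.\<close>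
lemma hit_second_moment_superadditive:
  assumes "K * h \<le> d"
  shows "real K * expectation (\<lambda>\<omega>. (hit u 0 h \<omega>)\<^sup>2) \<le> expectation (\<lambda>\<omega>. (hit u 0 d \<omega>)\<^sup>2)"
proof -
  have "real K * expectation (\<lambda>\<omega>. (hit u 0 h \<omega>)\<^sup>2) = (\<Sum>i<K. expectation (\<lambda>\<omega>. (hit u (i * h) (i * h + h) \<omega>)\<^sup>2))"
    by (simp add: expectation_hit_square)
  also have "\<dots> = expectation (\<lambda>\<omega>. \<Sum>i<K. (hit u (i * h) (i * h + h) \<omega>)\<^sup>2)"
    by (rule Bochner_Integration.integral_sum[symmetric]) (auto intro: sq_int_square)
  also have "\<dots> \<le> expectation (\<lambda>\<omega>. (hit u 0 d \<omega>)\<^sup>2)"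
  proof (intro integral_mono)
    fix \<omega>
    have "(\<Sum>i<K. (hit u (i * h) (i * h + h) \<omega>)\<^sup>2) \<le> (\<Sum>i<K. hit u (i * h) (i * h + h) \<omega>)\<^sup>2"
      by (intro sum_squares_le_square_sum hit_nonneg)
    also have "\<dots> = (hit u 0 (K * h) \<omega>)\<^sup>2" by (simp only: hits_nat_group)
    also have "\<dots> \<le> (hit u 0 d \<omega>)\<^sup>2" by (intro power_mono hit_mono hit_nonneg) (use assms in auto)
    finally show "(\<Sum>i<K. (hit u (i * h) (i * h + h) \<omega>)\<^sup>2) \<le> (hit u 0 d \<omega>)\<^sup>2" .
  qed (auto intro!: sq_int_square Bochner_Integration.integrable_sum)
  finally show ?thesis .
qed

text \<open>
  The number of exceedances in a long window is approximated by a sum over short blocks of length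
  \<open>s\<close>, each shortened by \<open>l\<close>, so that the mixing bound makes the summands nearly uncorrelated.
\<close>
lemma variance_hit_blocks:
  fixes u :: real
  assumes s: "2 * l \<le> s" "0 < s" and d: "d \<le> n"
  defines "K \<equiv> d div s"
  defines "A \<equiv> expectation (\<lambda>\<omega>. (hit u 0 s \<omega>)\<^sup>2)" and "a \<equiv> expectation (\<lambda>\<omega>. (hit u 0 l \<omega>)\<^sup>2)"
  defines "v \<equiv> expectation (\<lambda>\<omega>. (hit u 0 (s - l) \<omega>)\<^sup>2) - (real (s - l) * tail M X u)\<^sup>2"
  defines "\<rho> \<equiv> max_corr M X n l u"
  shows "\<exists>w. \<bar>w - real K * v\<bar> \<le> (real K)\<^sup>2 * (\<rho> * A) \<and>
    \<bar>sqrt (cov (hit u 0 d) (hit u 0 d)) - sqrt w\<bar> \<le> sqrt (real K * a + (real K)\<^sup>2 * (\<rho> * a)) + sqrt A"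
proof -
  define B where "B i = hit u (i * s) (i * s + (s - l))" for i
  define S where "S i = hit u (i * s + (s - l)) (i * s + s)" for i
  define R where "R = hit u (K * s) d"
  have sq: "sq_int (B i)" "sq_int (S i)" "sq_int R" for i by (simp_all add: B_def S_def R_def)
  have K: "K * s \<le> d" "d < K * s + s" unfolding K_def
    using dividend_less_div_times[OF s(2), of d] by auto
  have \<rho>0: "\<rho> \<ge> 0" unfolding \<rho>_def by (rule max_corr_nonneg)
  have iK: "i * s + s \<le> d" if "i < K" for i
  proof -
    have "(i + 1) * s \<le> K * s" using that by (intro mult_right_mono) auto
    then show ?thesis using K by simp
  qed
  have ij: "i * s + s \<le> j * s" if "i < j" for i j
  proof -
    have "(i + 1) * s \<le> j * s" using that by (intro mult_right_mono) auto
    then show ?thesis by simp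
  qed
  have BL: "sqrt (expectation (\<lambda>\<omega>. (B i \<omega>)\<^sup>2)) \<le> sqrt A" for i
    unfolding B_def A_def expectation_hit_square by (rule hit_L2_mono) auto
  have Seq: "expectation (\<lambda>\<omega>. (S i \<omega>)\<^sup>2) = a" for i
    using expectation_hit_square[where u=u and a="i * s + (s - l)" and h=l] s by (simp add: S_def a_def)
  have "\<bar>cov (\<lambda>\<omega>. \<Sum>i<K. B i \<omega>) (\<lambda>\<omega>. \<Sum>i<K. B i \<omega>) - real K * v\<bar> \<le> (real K)\<^sup>2 * \<bar>\<rho> * A\<bar>"
  proof (rule cov_sum_nearly_uncorrelated)
    show "cov (B j) (B j) = v" for j
      using expectation_hit_square[where u=u and a="j * s" and h="s - l"]
      by (simp add: cov_def B_def v_def expectation_hit power2_eq_square)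
    fix i j assume "i < j" "j < K"
    have "\<bar>cov (B i) (B j)\<bar> \<le> \<rho> * (sqrt (expectation (\<lambda>\<omega>. (B i \<omega>)\<^sup>2)) * sqrt (expectation (\<lambda>\<omega>. (B j \<omega>)\<^sup>2)))"
      unfolding \<rho>_def
      by (rule cov_le_max_corr[where t="i * s + (s - l)" and t'="Suc (j * s)"])
        (use ij[OF \<open>i < j\<close>] iK[OF \<open>j < K\<close>] s d sq in \<open>auto simp: B_def intro!: hits_threshold_field\<close>)
    also have "\<dots> \<le> \<rho> * (sqrt A * sqrt A)"
      by (intro mult_left_mono mult_mono BL \<rho>0) (auto simp: A_def)
    also have "\<dots> = \<rho> * A" by (simp add: A_def)
    finally show "\<bar>cov (B i) (B j)\<bar> \<le> \<rho> * A" .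
  qed (rule sq)
  then have w: "\<bar>cov (\<lambda>\<omega>. \<Sum>i<K. B i \<omega>) (\<lambda>\<omega>. \<Sum>i<K. B i \<omega>) - real K * v\<bar> \<le> (real K)\<^sup>2 * (\<rho> * A)"
    using \<rho>0 by (simp add: A_def)
  define vs where "vs = cov (S 0) (S 0)"
  have Sv: "cov (S j) (S j) = vs" for j
    using s by (simp add: vs_def cov_def power2_eq_square[symmetric] Seq) (simp add: S_def expectation_hit)
  have "\<bar>cov (\<lambda>\<omega>. \<Sum>i<K. S i \<omega>) (\<lambda>\<omega>. \<Sum>i<K. S i \<omega>) - real K * vs\<bar> \<le> (real K)\<^sup>2 * \<bar>\<rho> * a\<bar>"
  proof (rule cov_sum_nearly_uncorrelated)
    fix i j assume "i < j" "j < K"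
    have "\<bar>cov (S i) (S j)\<bar> \<le> \<rho> * (sqrt (expectation (\<lambda>\<omega>. (S i \<omega>)\<^sup>2)) * sqrt (expectation (\<lambda>\<omega>. (S j \<omega>)\<^sup>2)))"
      unfolding \<rho>_def
      by (rule cov_le_max_corr[where t="i * s + s" and t'="Suc (j * s + (s - l))"])
        (use ij[OF \<open>i < j\<close>] iK[OF \<open>j < K\<close>] s d sq in \<open>auto simp: S_def intro!: hits_threshold_field\<close>)
    also have "\<dots> = \<rho> * a" by (simp add: Seq) (simp add: a_def)
    finally show "\<bar>cov (S i) (S j)\<bar> \<le> \<rho> * a" .
  qed (rule sq Sv)+
  moreover have "vs \<le> a" unfolding vs_def using cov_self_le[of "S 0"] by (simp add: Seq)
  then have "real K * vs \<le> real K * a" by (intro mult_left_mono) auto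
  moreover have "\<bar>\<rho> * a\<bar> = \<rho> * a" using \<rho>0 by (simp add: a_def)
  ultimately have Sc: "cov (\<lambda>\<omega>. \<Sum>i<K. S i \<omega>) (\<lambda>\<omega>. \<Sum>i<K. S i \<omega>) \<le> real K * a + (real K)\<^sup>2 * (\<rho> * a)"
    by linarith
  have Rc: "cov R R \<le> A"
  proof -
    have "cov R R \<le> expectation (\<lambda>\<omega>. (R \<omega>)\<^sup>2)" by (rule cov_self_le)
    also have "\<dots> = expectation (\<lambda>\<omega>. (hit u 0 (d - K * s) \<omega>)\<^sup>2)"
      using expectation_hit_square[where u=u and a="K * s" and h="d - K * s"] K by (simp add: R_def)
    also have "\<dots> \<le> A" unfolding A_def
      by (intro integral_mono sq_int_square power_mono hit_mono hit_nonneg hit_sq_int) (use K in auto)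
    finally show ?thesis .
  qed
  have split: "hit u 0 d \<omega> = (\<Sum>i<K. B i \<omega>) + ((\<Sum>i<K. S i \<omega>) + R \<omega>)" for \<omega>
  proof -
    have "hit u 0 d \<omega> = hit u 0 (K * s) \<omega> + R \<omega>" unfolding R_def by (rule hits_split) (use K in auto)
    also have "hit u 0 (K * s) \<omega> = (\<Sum>i<K. B i \<omega> + S i \<omega>)"
      unfolding hits_nat_group B_def S_def by (intro sum.cong refl hits_split) auto
    finally show ?thesis by (simp add: sum.distrib)
  qed
  let ?B = "\<lambda>\<omega>. \<Sum>i<K. B i \<omega>" and ?T = "\<lambda>\<omega>. (\<Sum>i<K. S i \<omega>) + R \<omega>"
  have sqB: "sq_int ?B" and sqS: "sq_int (\<lambda>\<omega>. \<Sum>i<K. S i \<omega>)" using sq by auto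
  then have sqT: "sq_int ?T" using sq by auto
  have T: "sqrt (cov ?T ?T) \<le> sqrt (real K * a + (real K)\<^sup>2 * (\<rho> * a)) + sqrt A"
    by (rule order_trans[OF sd_triangle[OF sqS sq(3)]]) (intro add_mono real_sqrt_le_mono Sc Rc)
  have h: "hit u 0 d = (\<lambda>\<omega>. ?B \<omega> + ?T \<omega>)" using split by auto
  have 1: "sqrt (cov (hit u 0 d) (hit u 0 d)) \<le> sqrt (cov ?B ?B) + sqrt (cov ?T ?T)"
    unfolding h by (rule sd_triangle[OF sqB sqT])
  have b: "?B = (\<lambda>\<omega>. hit u 0 d \<omega> + (-1) * ?T \<omega>)" using split by auto
  have "sqrt (cov ?B ?B) \<le> sqrt (cov (hit u 0 d) (hit u 0 d)) + sqrt (cov (\<lambda>\<omega>. (-1) * ?T \<omega>) (\<lambda>\<omega>. (-1) * ?T \<omega>))"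
    by (subst (1 2) b) (intro sd_triangle sq_int_cmult sqT hit_sq_int)
  also have "cov (\<lambda>\<omega>. (-1) * ?T \<omega>) (\<lambda>\<omega>. (-1) * ?T \<omega>) = cov ?T ?T"
    unfolding cov_cmult_left cov_cmult_right by (simp only: mult_minus1 minus_minus)
  finally have 2: "sqrt (cov ?B ?B) \<le> sqrt (cov (hit u 0 d) (hit u 0 d)) + sqrt (cov ?T ?T)" .
  show ?thesis using w 1 2 T by (intro exI[of _ "cov ?B ?B"]) auto
qed

end

context block_asymptotics
begin

lemma rho_r_s: "(\<lambda>n. real (r n) / real (s n) * rho n) \<longlonglongrightarrow> 0"
proof -
  have "(\<lambda>n. (rho n * real n / real (s n)) * (real (r n) / real n)) \<longlonglongrightarrow> 0 * 0"
    by (intro tendsto_mult ratio_limits)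
  moreover have "\<forall>\<^sub>F n in sequentially. (rho n * real n / real (s n)) * (real (r n) / real n) = real (r n) / real (s n) * rho n"
    using ev_pos by eventually_elim auto
  ultimately show ?thesis using Lim_transform_eventually by fastforce
qed

text \<open>
  Raising the probability that a block of length \<open>s\<close> is clear to the power \<open>r / s\<close> gives
  approximately \<open>exp (- \<alpha>)\<close>.
\<close>
lemma exceedance_prob_short_block: "(\<lambda>n. real (r n) / real (s n) * (1 - G n (s n))) \<longlonglongrightarrow> \<alpha>"
proof -
  define K where "K n = r n div s n" for n
  define x where "x n = 1 - G n (s n)" for n
  have x0: "x n \<ge> 0" for n using no_exc_prob_bounds by (simp add: x_def)
  have xl: "x \<longlonglongrightarrow> 0"
    by (rule real_tendsto_sandwich[OF _ _ tendsto_const s_tbar]) (use x0 no_exc_prob_ge in \<open>auto simp: x_def\<close>)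
  have e0: "(\<lambda>n. real (r n) / real (s n) * rho n + 2 * ((real (l n) / real (s n)) * (real (r n) * tbar n)) + real (s n) * tbar n) \<longlonglongrightarrow> 0 + 2 * (0 * \<tau>) + 0"
    by (intro tendsto_intros rho_r_s ratio_limits r_tbar s_tbar)
  have "(\<lambda>n. G n (r n) - (1 - x n) ^ K n) \<longlonglongrightarrow> 0"
  proof (rule Lim_null_comparison)
    show "\<forall>\<^sub>F n in sequentially. norm (G n (r n) - (1 - x n) ^ K n) \<le>
      real (r n) / real (s n) * rho n + 2 * ((real (l n) / real (s n)) * (real (r n) * tbar n)) + real (s n) * tbar n"
      using ev_pos ev_blocks_fit[of 2] ev_small_lags
    proof eventually_elim
      case (elim n)
      have Ks: "K n * s n \<le> r n" "r n < K n * s n + s n" unfolding K_def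
        using dividend_less_div_times[of "s n" "r n"] elim by auto
      have "\<bar>G n (K n * s n) - G n (s n) ^ K n\<bar> \<le> real (K n) * (rho n + 2 * (real (l n) * tbar n))"
        by (rule no_exc_prob_power) (use Ks elim in auto)
      also have "\<dots> \<le> real (r n) / real (s n) * (rho n + 2 * (real (l n) * tbar n))"
        unfolding K_def using tail_bounds max_corr_nonneg
        by (intro mult_right_mono of_nat_div_le_of_nat) auto
      also have "\<dots> = real (r n) / real (s n) * rho n + 2 * ((real (l n) / real (s n)) * (real (r n) * tbar n))"
        by (simp add: algebra_simps)
      finally have 1: "\<bar>G n (K n * s n) - G n (s n) ^ K n\<bar> \<le>
        real (r n) / real (s n) * rho n + 2 * ((real (l n) / real (s n)) * (real (r n) * tbar n))" .
      have "real (r n - K n * s n) * tbar n \<le> real (s n) * tbar n"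
        by (intro mult_right_mono tail_bounds) (simp only: of_nat_le_iff, use Ks in linarith)
      then have "\<bar>G n (K n * s n) - G n (r n)\<bar> \<le> real (s n) * tbar n"
        using no_exc_prob_Lipschitz[OF Ks(1), of "un n"] by simp
      then show ?case using 1 by (simp add: x_def)
    qed
  qed (use e0 in simp)
  moreover have "(\<lambda>n. G n (r n)) \<longlonglongrightarrow> exp (- \<alpha> * 1)"
    by (rule no_exc_prob_tendsto)
      (use ev_pos in \<open>auto intro!: tendsto_eventually elim!: eventually_mono\<close>)
  ultimately have "(\<lambda>n. (1 - x n) ^ K n) \<longlonglongrightarrow> exp (- \<alpha>)"
    using tendsto_diff by fastforce
  then have "(\<lambda>n. - ln ((1 - x n) ^ K n)) \<longlonglongrightarrow> - ln (exp (- \<alpha>))"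
    by (intro tendsto_minus tendsto_ln) auto
  moreover have x1: "\<forall>\<^sub>F n in sequentially. x n < 1" by (rule order_tendstoD(2)[OF xl]) simp
  then have "\<forall>\<^sub>F n in sequentially. - ln ((1 - x n) ^ K n) = real (K n) * (- ln (1 - x n))"
    by eventually_elim (simp add: ln_realpow)
  ultimately have L: "(\<lambda>n. real (K n) * (- ln (1 - x n))) \<longlonglongrightarrow> \<alpha>"
    using Lim_transform_eventually by fastforce
  \<comment> \<open>\<open>- ln (1 - x)\<close> lies between \<open>x\<close> and \<open>x / (1 - x)\<close>\<close>
  have Kx: "(\<lambda>n. real (K n) * x n) \<longlonglongrightarrow> \<alpha>"
  proof (rule real_tendsto_sandwich[OF _ _ _ L])
    have "(\<lambda>n. (1 - x n) * (real (K n) * (- ln (1 - x n)))) \<longlonglongrightarrow> (1 - 0) * \<alpha>"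
      by (intro tendsto_intros xl L)
    then show "(\<lambda>n. (1 - x n) * (real (K n) * (- ln (1 - x n)))) \<longlonglongrightarrow> \<alpha>" by simp
    show "\<forall>\<^sub>F n in sequentially. (1 - x n) * (real (K n) * (- ln (1 - x n))) \<le> real (K n) * x n"
      using x1
    proof eventually_elim
      case (elim n)
      have "- ln (1 - x n) = ln (1 / (1 - x n))" using elim by (simp add: ln_div)
      also have "\<dots> \<le> 1 / (1 - x n) - 1" using elim by (intro ln_le_minus_one) auto
      also have "\<dots> = x n / (1 - x n)" using elim by (simp add: field_simps)
      finally have "(1 - x n) * (- ln (1 - x n)) \<le> (1 - x n) * (x n / (1 - x n))"
        using elim by (intro mult_left_mono) auto
      then have "(1 - x n) * (- ln (1 - x n)) \<le> x n" using elim by simp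
      then have "real (K n) * ((1 - x n) * (- ln (1 - x n))) \<le> real (K n) * x n" by (intro mult_left_mono) auto
      then show ?case by (simp only: mult.left_commute)
    qed
    show "\<forall>\<^sub>F n in sequentially. real (K n) * x n \<le> real (K n) * (- ln (1 - x n))"
      using x1
    proof eventually_elim
      case (elim n)
      have "ln (1 - x n) \<le> (1 - x n) - 1" using elim by (intro ln_le_minus_one) auto
      then show ?case by (intro mult_left_mono) auto
    qed
  qed
  show ?thesis
    unfolding x_def[symmetric]
  proof (rule real_tendsto_sandwich[OF _ _ Kx])
    show "\<forall>\<^sub>F n in sequentially. real (K n) * x n \<le> real (r n) / real (s n) * x n"
      unfolding K_def using x0 by (intro always_eventually allI mult_right_mono of_nat_div_le_of_nat)
    show "\<forall>\<^sub>F n in sequentially. real (r n) / real (s n) * x n \<le> (real (K n) + 1) * x n"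
      using ev_pos
    proof eventually_elim
      case (elim n)
      show ?case unfolding K_def by (intro mult_right_mono real_div_le x0) (use elim in auto)
    qed
    show "(\<lambda>n. (real (K n) + 1) * x n) \<longlonglongrightarrow> \<alpha>"
      using tendsto_add[OF Kx xl] by (simp add: distrib_right)
  qed
qed

text \<open>
  The count vanishes on a clear block, so its second moment is the conditional one times the
  probability of a hit.
\<close>
lemma second_moment_short_block:
  "(\<lambda>n. real (r n) / real (s n) * expectation (\<lambda>\<omega>. (hit (un n) 0 (s n) \<omega>)\<^sup>2)) \<longlonglongrightarrow> \<alpha> * m2"
proof -
  let ?c = "\<lambda>n. cond_expectation_on M (\<lambda>\<omega>. (real (N_exc X (s n) (un n) \<omega>))\<^sup>2) (\<lambda>\<omega>. block_max X 0 (s n) \<omega> > un n)"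
  have "\<forall>\<^sub>F n in sequentially. 0 < real (r n) / real (s n) * (1 - G n (s n))"
    by (rule order_tendstoD(1)[OF exceedance_prob_short_block alpha_pos])
  then have "\<forall>\<^sub>F n in sequentially. real (r n) / real (s n) * (1 - G n (s n)) * ?c n =
      real (r n) / real (s n) * expectation (\<lambda>\<omega>. (hit (un n) 0 (s n) \<omega>)\<^sup>2)"
    using ev_pos
  proof eventually_elim
    case (elim n)
    let ?A = "{\<omega> \<in> space M. block_max X 0 (s n) \<omega> > un n}"
    have b: "of_bool (block_max X 0 (s n) \<omega> \<le> un n) = clr (un n) 0 (s n) \<omega>" for \<omega>
      using block_max_le_iff[of "s n" 0] elim by simp
    have iff: "block_max X 0 (s n) \<omega> > un n \<longleftrightarrow> clr (un n) 0 (s n) \<omega> = 0" for \<omega>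
      using b[of \<omega>] by (cases "block_max X 0 (s n) \<omega> \<le> un n") auto
    have A: "?A \<in> sets M" unfolding iff by measurable
    have "prob ?A = 1 - prob {\<omega> \<in> space M. block_max X 0 (s n) \<omega> \<le> un n}"
    proof -
      have "{\<omega> \<in> space M. block_max X 0 (s n) \<omega> \<le> un n} = space M - ?A" by auto
      then show ?thesis using prob_compl[OF A] by simp
    qed
    then have P: "prob ?A = 1 - G n (s n)" using prob_block_max[of "s n"] elim by simp
    have "(LINT \<omega>:?A|M. (real (N_exc X (s n) (un n) \<omega>))\<^sup>2) = expectation (\<lambda>\<omega>. (hit (un n) 0 (s n) \<omega>)\<^sup>2)"
      unfolding set_lebesgue_integral_def N_exc_eq
    proof (intro Bochner_Integration.integral_cong refl)
      fix \<omega> assume \<omega>: "\<omega> \<in> space M"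
      show "indicat_real ?A \<omega> *\<^sub>R (hit (un n) 0 (s n) \<omega>)\<^sup>2 = (hit (un n) 0 (s n) \<omega>)\<^sup>2"
      proof (cases "\<omega> \<in> ?A")
        case False
        then have "clr (un n) 0 (s n) \<omega> \<noteq> 0" using \<omega> iff by auto
        moreover have "clr (un n) 0 (s n) \<omega> * hit (un n) 0 (s n) \<omega> = 0"
          by (rule clear_mult_hits_0[OF exc_01]) auto
        ultimately have "hit (un n) 0 (s n) \<omega> = 0" by simp
        then show ?thesis by simp
      qed simp
    qed
    then have "?c n = expectation (\<lambda>\<omega>. (hit (un n) 0 (s n) \<omega>)\<^sup>2) / (1 - G n (s n))"
      unfolding cond_expectation_on_def P by simp
    then show ?case using elim by auto
  qed
  moreover have "(\<lambda>n. real (r n) / real (s n) * (1 - G n (s n)) * ?c n) \<longlonglongrightarrow> \<alpha> * m2"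
    by (intro tendsto_mult exceedance_prob_short_block m2_lim)
  ultimately show ?thesis by (rule Lim_transform_eventually[rotated])
qed

text \<open>
  A short block contains \<open>s div l\<close> disjoint windows of length \<open>l\<close>, so one of them carries only a small
  fraction of the second moment.
\<close>
lemma second_moment_lag:
  "(\<lambda>n. real (r n) / real (s n) * expectation (\<lambda>\<omega>. (hit (un n) 0 (l n) \<omega>)\<^sup>2)) \<longlonglongrightarrow> 0"
proof -
  let ?A = "\<lambda>n. expectation (\<lambda>\<omega>. (hit (un n) 0 (s n) \<omega>)\<^sup>2)" and ?a = "\<lambda>n. expectation (\<lambda>\<omega>. (hit (un n) 0 (l n) \<omega>)\<^sup>2)"
  have lim: "(\<lambda>n. 2 * (real (l n) / real (s n)) * (real (r n) / real (s n) * ?A n)) \<longlonglongrightarrow> 2 * 0 * (\<alpha> * m2)"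
    by (intro tendsto_intros ratio_limits second_moment_short_block)
  show ?thesis
  proof (rule real_tendsto_sandwich[OF _ _ tendsto_const])
    show "(\<lambda>n. 2 * (real (l n) / real (s n)) * (real (r n) / real (s n) * ?A n)) \<longlonglongrightarrow> 0"
      using lim by simp
    show "\<forall>\<^sub>F n in sequentially. real (r n) / real (s n) * ?a n \<le> 2 * (real (l n) / real (s n)) * (real (r n) / real (s n) * ?A n)"
      using ev_pos ev_small_lags
    proof eventually_elim
      case (elim n)
      have "real (s n div l n) * ?a n \<le> ?A n"
        by (rule hit_second_moment_superadditive) auto
      moreover have "real (s n) / (2 * real (l n)) \<le> real (s n div l n)"
      proof -
        have "real (s n) / real (l n) \<le> real (s n div l n) + 1" by (rule real_div_le) (use elim in auto)
        moreover have "2 * l n div l n \<le> s n div l n" using elim by (intro div_le_mono) auto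
        then have "2 \<le> s n div l n" using elim by simp
        then have "1 \<le> real (s n div l n) / 2" by linarith
        moreover have "real (s n) / (2 * real (l n)) = (real (s n) / real (l n)) / 2" by simp
        ultimately show ?thesis by linarith
      qed
      then have "real (s n) / (2 * real (l n)) * ?a n \<le> real (s n div l n) * ?a n"
        by (intro mult_right_mono) auto
      ultimately have "real (s n) / (2 * real (l n)) * ?a n \<le> ?A n" by linarith
      then have "?a n \<le> 2 * (real (l n) / real (s n)) * ?A n" using elim by (simp add: field_simps)
      then have "real (r n) / real (s n) * ?a n \<le> real (r n) / real (s n) * (2 * (real (l n) / real (s n)) * ?A n)"
        by (intro mult_left_mono) auto
      then show ?case by (simp only: mult_ac)
    qed
  qed simp
qed

lemma variance_hit_tendsto:
  "(\<lambda>n. cov (hit (un n) 0 (q * r n)) (hit (un n) 0 (q * r n))) \<longlonglongrightarrow> real q * (\<alpha> * m2)"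
proof -
  let ?A = "\<lambda>n. expectation (\<lambda>\<omega>. (hit (un n) 0 (s n) \<omega>)\<^sup>2)" and ?a = "\<lambda>n. expectation (\<lambda>\<omega>. (hit (un n) 0 (l n) \<omega>)\<^sup>2)"
  let ?e = "\<lambda>n. expectation (\<lambda>\<omega>. (hit (un n) 0 (s n - l n) \<omega>)\<^sup>2)"
  let ?V = "\<lambda>n. cov (hit (un n) 0 (q * r n)) (hit (un n) 0 (q * r n))"
  define K where "K n = q * r n div s n" for n
  have K1: "\<forall>\<^sub>F n in sequentially. real (K n) * (real (s n) / real (r n)) \<le> real q \<and>
      real q - real (s n) / real (r n) \<le> real (K n) * (real (s n) / real (r n))"
    using ev_pos
  proof eventually_elim
    case (elim n)
    have a: "real (K n) \<le> real (q * r n) / real (s n)" unfolding K_def by (rule of_nat_div_le_of_nat)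
    have b: "real (q * r n) / real (s n) \<le> real (K n) + 1" unfolding K_def by (rule real_div_le) (use elim in auto)
    have c: "real (q * r n) / real (s n) * (real (s n) / real (r n)) = real q" using elim by simp
    have "0 \<le> real (s n) / real (r n)" by simp
    from mult_right_mono[OF a this] mult_right_mono[OF b this] show ?case
      unfolding c distrib_right mult_1_left by (intro conjI; linarith)
  qed
  have Ksr: "(\<lambda>n. real (K n) * (real (s n) / real (r n))) \<longlonglongrightarrow> real q"
  proof (rule real_tendsto_sandwich[OF _ _ _ tendsto_const])
    show "(\<lambda>n. real q - real (s n) / real (r n)) \<longlonglongrightarrow> real q"
      using tendsto_diff[OF tendsto_const ratio_limits(4)] by simp
  qed (use K1 in \<open>auto elim: eventually_mono\<close>)
  have scale: "(\<lambda>n. real (K n) * y n) \<longlonglongrightarrow> real q * c"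
    if "(\<lambda>n. real (r n) / real (s n) * y n) \<longlonglongrightarrow> c" for y c
  proof -
    have "(\<lambda>n. (real (K n) * (real (s n) / real (r n))) * (real (r n) / real (s n) * y n)) \<longlonglongrightarrow> real q * c"
      by (intro tendsto_mult Ksr that)
    moreover have "\<forall>\<^sub>F n in sequentially. (real (K n) * (real (s n) / real (r n))) * (real (r n) / real (s n) * y n) = real (K n) * y n"
      using ev_pos by eventually_elim auto
    ultimately show ?thesis by (rule Lim_transform_eventually)
  qed
  have KA: "(\<lambda>n. real (K n) * ?A n) \<longlonglongrightarrow> real q * (\<alpha> * m2)" by (rule scale[OF second_moment_short_block])
  have Ka: "(\<lambda>n. real (K n) * ?a n) \<longlonglongrightarrow> 0" using scale[OF second_moment_lag] by simp
  have Kr: "(\<lambda>n. real (K n) * rho n) \<longlonglongrightarrow> 0" using scale[OF rho_r_s] by simp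
  have A0: "?A \<longlonglongrightarrow> 0"
  proof -
    have "(\<lambda>n. (real (s n) / real (r n)) * (real (r n) / real (s n) * ?A n)) \<longlonglongrightarrow> 0 * (\<alpha> * m2)"
      by (intro tendsto_mult ratio_limits second_moment_short_block)
    moreover have "\<forall>\<^sub>F n in sequentially. (real (s n) / real (r n)) * (real (r n) / real (s n) * ?A n) = ?A n"
      using ev_pos by eventually_elim auto
    ultimately show ?thesis using Lim_transform_eventually by fastforce
  qed
  have "(\<lambda>n. sqrt (real (K n) * ?e n)) \<longlonglongrightarrow> sqrt (real q * (\<alpha> * m2))"
  proof (rule real_tendsto_sandwich)
    have ev: "\<forall>\<^sub>F n in sequentially. sqrt (?A n) - sqrt (?a n) \<le> sqrt (?e n) \<and> sqrt (?e n) \<le> sqrt (?A n)"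
      using ev_small_lags
    proof eventually_elim
      case (elim n)
      have eq: "hit (un n) 0 (s n) \<omega> = hit (un n) 0 (s n - l n) \<omega> + hit (un n) (s n - l n) (s n) \<omega>" for \<omega>
        by (rule hits_split) auto
      have "sqrt (?A n) \<le> sqrt (?e n) + sqrt (expectation (\<lambda>\<omega>. (hit (un n) (s n - l n) (s n) \<omega>)\<^sup>2))"
        unfolding eq by (intro L2_triangle hit_sq_int)
      also have "expectation (\<lambda>\<omega>. (hit (un n) (s n - l n) (s n) \<omega>)\<^sup>2) = ?a n"
        using expectation_hit_square[where u="un n" and a="s n - l n" and h="l n"] elim by simp
      finally show ?case using hit_L2_mono[of 0 0 "s n - l n" "s n" "un n"] by simp
    qed
    show "\<forall>\<^sub>F n in sequentially. sqrt (real (K n) * ?A n) - sqrt (real (K n) * ?a n) \<le> sqrt (real (K n) * ?e n)"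
      using ev
    proof eventually_elim
      case (elim n)
      then have "sqrt (real (K n)) * (sqrt (?A n) - sqrt (?a n)) \<le> sqrt (real (K n)) * sqrt (?e n)"
        by (intro mult_left_mono) auto
      then show ?case by (simp add: real_sqrt_mult right_diff_distrib)
    qed
    show "\<forall>\<^sub>F n in sequentially. sqrt (real (K n) * ?e n) \<le> sqrt (real (K n) * ?A n)"
      using ev by eventually_elim (auto intro!: mult_left_mono)
    show "(\<lambda>n. sqrt (real (K n) * ?A n) - sqrt (real (K n) * ?a n)) \<longlonglongrightarrow> sqrt (real q * (\<alpha> * m2))"
      using tendsto_diff[OF tendsto_real_sqrt[OF KA] tendsto_real_sqrt[OF Ka]] by simp
    show "(\<lambda>n. sqrt (real (K n) * ?A n)) \<longlonglongrightarrow> sqrt (real q * (\<alpha> * m2))"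
      by (rule tendsto_real_sqrt[OF KA])
  qed
  from tendsto_power[OF this, of 2]
  have Ke: "(\<lambda>n. real (K n) * ?e n) \<longlonglongrightarrow> (sqrt (real q * (\<alpha> * m2)))\<^sup>2" by simp
  have nonneg: "0 \<le> real q * (\<alpha> * m2)"
    by (rule LIMSEQ_le_const[OF KA]) auto
  define v where "v n = ?e n - (real (s n - l n) * tbar n)\<^sup>2" for n
  have Kv: "(\<lambda>n. real (K n) * v n) \<longlonglongrightarrow> real q * (\<alpha> * m2)"
  proof -
    have z: "(\<lambda>n. real (K n) * (real (s n - l n) * tbar n)\<^sup>2) \<longlonglongrightarrow> 0"
    proof (rule real_tendsto_sandwich[OF _ _ tendsto_const])
      have "(\<lambda>n. real (K n) * (real (s n) / real (r n)) * (real (r n) * tbar n) * (real (s n) * tbar n)) \<longlonglongrightarrow> real q * \<tau> * 0"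
        by (intro tendsto_mult Ksr r_tbar s_tbar)
      then show "(\<lambda>n. real (K n) * (real (s n) / real (r n)) * (real (r n) * tbar n) * (real (s n) * tbar n)) \<longlonglongrightarrow> 0" by simp
      show "\<forall>\<^sub>F n in sequentially. real (K n) * (real (s n - l n) * tbar n)\<^sup>2 \<le>
          real (K n) * (real (s n) / real (r n)) * (real (r n) * tbar n) * (real (s n) * tbar n)"
        using ev_pos
      proof eventually_elim
        case (elim n)
        have "real (K n) * (real (s n - l n) * tbar n)\<^sup>2 \<le> real (K n) * (real (s n) * tbar n)\<^sup>2"
          by (intro mult_left_mono power_mono mult_right_mono tail_bounds mult_nonneg_nonneg) auto
        also have "\<dots> = real (K n) * (real (s n) / real (r n)) * (real (r n) * tbar n) * (real (s n) * tbar n)"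
          using elim by (simp add: power2_eq_square)
        finally show ?case .
      qed
    qed simp
    from tendsto_diff[OF Ke z] show ?thesis using nonneg by (simp add: v_def right_diff_distrib)
  qed
  have err: "(\<lambda>n. (real (K n))\<^sup>2 * (rho n * ?A n)) \<longlonglongrightarrow> 0"
    using tendsto_mult[OF Kr KA] by (simp add: power2_eq_square mult_ac)
  have "\<forall>\<^sub>F n in sequentially. \<exists>w. \<bar>w - real (K n) * v n\<bar> \<le> (real (K n))\<^sup>2 * (rho n * ?A n) \<and>
    \<bar>sqrt (?V n) - sqrt w\<bar> \<le> sqrt (real (K n) * ?a n + (real (K n))\<^sup>2 * (rho n * ?a n)) + sqrt (?A n)"
    using ev_pos ev_small_lags ev_blocks_fit[of q]
  proof eventually_elim
    case (elim n)
    show ?case unfolding K_def v_def by (rule variance_hit_blocks) (use elim in auto)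
  qed
  then obtain w where w: "\<forall>\<^sub>F n in sequentially. \<bar>w n - real (K n) * v n\<bar> \<le> (real (K n))\<^sup>2 * (rho n * ?A n) \<and>
    \<bar>sqrt (?V n) - sqrt (w n)\<bar> \<le> sqrt (real (K n) * ?a n + (real (K n))\<^sup>2 * (rho n * ?a n)) + sqrt (?A n)"
    unfolding eventually_ex by blast
  have "(\<lambda>n. w n - real (K n) * v n) \<longlonglongrightarrow> 0"
    by (rule Lim_null_comparison[OF _ err]) (use w in \<open>auto elim: eventually_mono\<close>)
  from tendsto_add[OF this Kv] have wl: "w \<longlonglongrightarrow> real q * (\<alpha> * m2)" by simp
  have err2: "(\<lambda>n. sqrt (real (K n) * ?a n + (real (K n))\<^sup>2 * (rho n * ?a n)) + sqrt (?A n)) \<longlonglongrightarrow> 0"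
  proof -
    have "(\<lambda>n. real (K n) * ?a n + (real (K n) * rho n) * (real (K n) * ?a n)) \<longlonglongrightarrow> 0 + 0 * 0"
      by (intro tendsto_intros Ka Kr)
    then have "(\<lambda>n. real (K n) * ?a n + (real (K n))\<^sup>2 * (rho n * ?a n)) \<longlonglongrightarrow> 0"
      by (simp add: power2_eq_square mult_ac)
    from tendsto_add[OF tendsto_real_sqrt[OF this] tendsto_real_sqrt[OF A0]] show ?thesis by simp
  qed
  have "(\<lambda>n. sqrt (?V n) - sqrt (w n)) \<longlonglongrightarrow> 0"
    by (rule Lim_null_comparison[OF _ err2]) (use w in \<open>auto elim: eventually_mono\<close>)
  from tendsto_add[OF this tendsto_real_sqrt[OF wl]]
  have "(\<lambda>n. sqrt (?V n)) \<longlonglongrightarrow> sqrt (real q * (\<alpha> * m2))" by simp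
  from tendsto_power[OF this, of 2] show ?thesis
    using nonneg by (simp add: cov_self_nonneg)
qed

end

section \<open>Limits of the block covariances\<close>

text \<open>
  An error that stays bounded as \<open>q\<close> grows disappears after division by \<open>q\<close>; this absorbs all boundary
  effects at the two ends of \<open>q\<close> consecutive blocks.
\<close>
lemma tendsto_iter_seq_average:
  fixes c err :: "nat \<Rightarrow> nat \<Rightarrow> real"
  assumes c: "\<And>q. q \<ge> 1 \<Longrightarrow> \<forall>\<^sub>F n in sequentially. \<bar>c q n - real q * L n\<bar> \<le> err q n"
    and err: "\<And>q. (\<lambda>n. err q n) \<longlonglongrightarrow> b" and L: "L \<longlonglongrightarrow> L0"
  shows "((\<lambda>(q, n). c q n / real q) \<longlongrightarrow> L0) iter_seq"
proof -
  have "((\<lambda>(q, n). err q n / real q + \<bar>L n - L0\<bar>) \<longlongrightarrow> 0) iter_seq"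
  proof (rule tendsto_iter_seq)
    show "(\<lambda>n. err q n / real q + \<bar>L n - L0\<bar>) \<longlonglongrightarrow> b / real q" for q
    proof (cases "q = 0")
      case True
      then show ?thesis using tendsto_rabs_zero[OF LIM_zero[OF L]] by simp
    next
      case False
      have "(\<lambda>n. err q n / real q + \<bar>L n - L0\<bar>) \<longlonglongrightarrow> b / real q + \<bar>L0 - L0\<bar>"
        using False by (intro tendsto_intros err L) auto
      then show ?thesis by simp
    qed
    show "(\<lambda>q. b / real q) \<longlonglongrightarrow> 0"
      by (rule tendsto_divide_0[OF tendsto_const filterlim_at_top_imp_at_infinity[OF filterlim_real_sequentially]])
  qed
  moreover have "\<forall>\<^sub>F x in iter_seq. norm ((case x of (q, n) \<Rightarrow> c q n / real q) - L0) \<le> (case x of (q, n) \<Rightarrow> err q n / real q + \<bar>L n - L0\<bar>)"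
    unfolding eventually_iter_seq prod.case
  proof (rule eventually_sequentiallyI)
    fix q :: nat assume q: "q \<ge> 1"
    show "\<forall>\<^sub>F n in sequentially. norm (c q n / real q - L0) \<le> err q n / real q + \<bar>L n - L0\<bar>"
      using c[OF q]
    proof eventually_elim
      case (elim n)
      have "c q n / real q - L0 = (c q n - real q * L n) / real q + (L n - L0)"
        using q by (simp add: field_simps)
      also have "\<bar>\<dots>\<bar> \<le> \<bar>c q n - real q * L n\<bar> / real q + \<bar>L n - L0\<bar>"
        by (rule order_trans[OF abs_triangle_ineq]) simp
      also have "\<dots> \<le> err q n / real q + \<bar>L n - L0\<bar>"
        using elim by (intro add_right_mono divide_right_mono) auto
      finally show ?case by simp
    qed
  qed
  ultimately have "((\<lambda>x. (case x of (q, n) \<Rightarrow> c q n / real q) - L0) \<longlongrightarrow> 0) iter_seq"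
    by (rule Lim_null_comparison[rotated])
  then show ?thesis by (simp add: LIM_zero_iff)
qed

text \<open>
  At most one block of positions at either end is outside the middle range.  The first estimate is used
  for sliding windows, the second one for disjoint blocks.
\<close>
lemma sum_near_constant:
  fixes f :: "nat \<Rightarrow> real"
  assumes r: "r \<ge> 1" and e: "e \<ge> 0" and B: "B \<ge> 0"
    and mid: "\<And>j. r \<le> j \<Longrightarrow> j + r \<le> q * r \<Longrightarrow> \<bar>f j - L\<bar> \<le> e"
    and all: "\<And>j. j < q * r \<Longrightarrow> \<bar>f j - L\<bar> \<le> B"
  shows "\<bar>(\<Sum>j<q * r. f j) / real r - real q * L\<bar> \<le> real q * e + 2 * B"
    and "\<bar>(\<Sum>i<q. f (i * r)) - real q * L\<bar> \<le> real q * e + 2 * B"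
proof -
  define b where "b j = (if j < r then B else 0) + (if q * r < j + r then B else 0)" for j
  have f: "\<bar>f j - L\<bar> \<le> e + b j" if "j < q * r" for j
  proof (cases "r \<le> j \<and> j + r \<le> q * r")
    case True
    then show ?thesis using mid[of j] by (simp add: b_def)
  next
    case False
    then have "B \<le> b j" using B by (auto simp: b_def)
    then show ?thesis using all[OF that] e by linarith
  qed
  have "\<bar>(\<Sum>j<q * r. f j) - real (q * r) * L\<bar> = \<bar>\<Sum>j<q * r. f j - L\<bar>"
    by (simp add: sum_subtractf)
  also have "\<dots> \<le> (\<Sum>j<q * r. e + b j)"
    by (rule order_trans[OF sum_abs]) (intro sum_mono f, simp)
  also have "\<dots> = real (q * r) * e + (\<Sum>j<q * r. if j < r then B else 0) + (\<Sum>j<q * r. if q * r < j + r then B else 0)"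
    by (simp add: b_def sum.distrib)
  also have "(\<Sum>j<q * r. if j < r then B else 0) = real (card ({..<q * r} \<inter> {j. j < r})) * B"
    by (simp add: sum.If_cases)
  also have "(\<Sum>j<q * r. if q * r < j + r then B else 0) = real (card ({..<q * r} \<inter> {j. q * r < j + r})) * B"
    by (simp add: sum.If_cases)
  also have "card ({..<q * r} \<inter> {j. j < r}) \<le> r"
    by (rule order_trans[OF card_mono[of "{..<r}"]]) auto
  also have "card ({..<q * r} \<inter> {j. q * r < j + r}) \<le> r"
    by (rule order_trans[OF card_mono[of "{q * r - r..<q * r}"]]) auto
  finally have "\<bar>(\<Sum>j<q * r. f j) - real (q * r) * L\<bar> \<le> real (q * r) * e + real r * B + real r * B"
    using B by (simp add: mult_right_mono)
  then have "\<bar>(\<Sum>j<q * r. f j) - real (q * r) * L\<bar> / real r \<le> (real (q * r) * e + real r * B + real r * B) / real r"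
    by (intro divide_right_mono) auto
  also have "\<dots> = real q * e + 2 * B" using r by (simp add: field_simps)
  also have "\<bar>(\<Sum>j<q * r. f j) - real (q * r) * L\<bar> / real r = \<bar>((\<Sum>j<q * r. f j) - real (q * r) * L) / real r\<bar>"
    by simp
  also have "((\<Sum>j<q * r. f j) - real (q * r) * L) / real r = (\<Sum>j<q * r. f j) / real r - real q * L"
    using r by (simp add: diff_divide_distrib)
  finally show "\<bar>(\<Sum>j<q * r. f j) / real r - real q * L\<bar> \<le> real q * e + 2 * B" .
  have "\<bar>(\<Sum>i<q. f (i * r)) - real q * L\<bar> = \<bar>\<Sum>i<q. f (i * r) - L\<bar>"
    by (simp add: sum_subtractf)
  also have "\<dots> \<le> (\<Sum>i<q. e + (if i = 0 then B else 0))"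
  proof (rule order_trans[OF sum_abs], intro sum_mono)
    fix i assume i: "i \<in> {..<q}"
    then have iq: "i * r + r \<le> q * r" using mult_right_mono[of "i + 1" q r] by simp
    then have iq': "i * r < q * r" using r by linarith
    show "\<bar>f (i * r) - L\<bar> \<le> e + (if i = 0 then B else 0)"
    proof (cases "i = 0")
      case True
      then show ?thesis using all[OF iq'] e by simp
    next
      case False
      then have "1 * r \<le> i * r" by (intro mult_right_mono) auto
      then show ?thesis using mid[of "i * r"] iq False by simp
    qed
  qed
  also have "\<dots> \<le> real q * e + 2 * B" using B by (simp add: sum.distrib sum.delta)
  finally show "\<bar>(\<Sum>i<q. f (i * r)) - real q * L\<bar> \<le> real q * e + 2 * B" .
qed

context block_asymptotics
begin

lemma r_moment_bound: "\<exists>C\<ge>0. \<forall>\<^sub>F n in sequentially. expectation (\<lambda>\<omega>. hit (un n) 0 (r n) \<omega> powr (2 * p)) \<le> C"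
proof -
  obtain C where "C > 0" "\<forall>\<^sub>F n in sequentially. norm (expectation (\<lambda>\<omega>. real (N_exc X (r n) (un n) \<omega>) powr (2 * p))) \<le> C * norm (1::real)"
    using landau_o.bigE[OF moments] by blast
  then have "\<forall>\<^sub>F n in sequentially. expectation (\<lambda>\<omega>. hit (un n) 0 (r n) \<omega> powr (2 * p)) \<le> C"
    by (auto simp: N_exc_eq elim!: eventually_mono)
  with \<open>C > 0\<close> show ?thesis by (intro exI[of _ C]) auto
qed

lemma hit_powr_integrable: "integrable M (\<lambda>\<omega>. hit v a b \<omega> powr (2 * p))"
proof (rule integrable_const_bound[where B="real (b - a) powr (2 * p)"])
  show "AE \<omega> in M. norm (hit v a b \<omega> powr (2 * p)) \<le> real (b - a) powr (2 * p)"
    using p_gt_1 hits_nonneg_le(1,2)[OF exc_01] by (intro AE_I2) (auto intro!: powr_mono2)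
qed measurable

lemma hit_L2_bound: "\<exists>C\<ge>0. \<forall>q. \<forall>\<^sub>F n in sequentially. sqrt (expectation (\<lambda>\<omega>. (hit (un n) 0 (q * r n) \<omega>)\<^sup>2)) \<le> real q * C"
proof -
  obtain C where C: "C \<ge> 0" "\<forall>\<^sub>F n in sequentially. expectation (\<lambda>\<omega>. hit (un n) 0 (r n) \<omega> powr (2 * p)) \<le> C"
    using r_moment_bound by blast
  have "\<forall>\<^sub>F n in sequentially. sqrt (expectation (\<lambda>\<omega>. (hit (un n) 0 (q * r n) \<omega>)\<^sup>2)) \<le> real q * sqrt (1 + C)" for q
    using C(2)
  proof eventually_elim
    case (elim n)
    have "expectation (\<lambda>\<omega>. (hit (un n) 0 (r n) \<omega>)\<^sup>2) \<le> expectation (\<lambda>\<omega>. 1 + hit (un n) 0 (r n) \<omega> powr (2 * p))"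
    proof (intro integral_mono)
      show "(hit (un n) 0 (r n) \<omega>)\<^sup>2 \<le> 1 + hit (un n) 0 (r n) \<omega> powr (2 * p)" for \<omega>
        using square_le_1_powr[OF p_gt_1, of "hit (un n) 0 (r n) \<omega>"] hit_nonneg by simp
    qed (auto intro!: sq_int_square hit_powr_integrable)
    also have "\<dots> \<le> 1 + C" using elim hit_powr_integrable by (simp add: prob_space)
    finally have E: "expectation (\<lambda>\<omega>. (hit (un n) 0 (r n) \<omega>)\<^sup>2) \<le> 1 + C" .
    have "sqrt (expectation (\<lambda>\<omega>. (hit (un n) 0 (q * r n) \<omega>)\<^sup>2)) \<le>
        (\<Sum>i<q. sqrt (expectation (\<lambda>\<omega>. (hit (un n) (i * r n) (i * r n + r n) \<omega>)\<^sup>2)))"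
      unfolding hits_nat_group by (rule L2_triangle_sum) simp
    also have "\<dots> \<le> (\<Sum>i<q. sqrt (1 + C))"
      unfolding expectation_hit_square using E by (intro sum_mono real_sqrt_le_mono)
    finally show ?case by simp
  qed
  then show ?thesis using C(1) by (intro exI[of _ "sqrt (1 + C)"]) auto
qed

text \<open>
  Limit of the covariance of the indicators of two clear windows of length \<open>r\<close> at distance \<open>x * r\<close>.
\<close>
definition wcov :: "real \<Rightarrow> real" where
  "wcov x = exp (- \<alpha> * (1 + min x 1)) - exp (- 2 * \<alpha>)"

lemma wcov_0: "wcov 0 = exp (- \<alpha>) * (1 - exp (- \<alpha>))"
  by (simp add: wcov_def right_diff_distrib flip: exp_add)

lemma wcov_ge_1: "x \<ge> 1 \<Longrightarrow> wcov x = 0"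
  by (simp add: wcov_def min_def mult.commute)

lemma wcov_abs_le: "x \<ge> 0 \<Longrightarrow> \<bar>wcov x\<bar> \<le> 1"
proof -
  assume x: "x \<ge> 0"
  have "exp (- \<alpha> * (1 + min x 1)) \<le> 1" "exp (- 2 * \<alpha>) \<le> 1"
    using alpha_pos x by (auto simp: mult_nonneg_nonneg)
  moreover have "exp (- \<alpha> * (1 + min x 1)) > 0" "exp (- 2 * \<alpha>) > 0" by auto
  ultimately show ?thesis unfolding wcov_def by linarith
qed

text \<open>
  Two windows of length \<open>r\<close> at distance \<open>d \<le> r\<close> are both clear exactly when one window of length
  \<open>r + d\<close> is; for larger \<open>d\<close> they are almost uncorrelated.
\<close>
lemma cov_clr_uniform:
  "\<exists>\<epsilon>. \<epsilon> \<longlonglongrightarrow> 0 \<and> (\<forall>n. 0 \<le> \<epsilon> n) \<and> (\<forall>q. \<forall>\<^sub>F n in sequentially. \<forall>j j'. j < q * r n \<longrightarrow> j' < q * r n \<longrightarrow>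
    \<bar>cov (clr (un n) j (j + r n)) (clr (un n) j' (j' + r n)) - wcov (\<bar>real j - real j'\<bar> / real (r n))\<bar> \<le> \<epsilon> n)"
proof -
  obtain \<epsilon> where \<epsilon>: "\<epsilon> \<longlonglongrightarrow> 0" "\<And>n h. h \<le> 2 * r n \<Longrightarrow> \<bar>G n h - exp (- \<alpha> * (real h / real (r n)))\<bar> \<le> \<epsilon> n"
    using no_exc_prob_uniform by blast
  have \<epsilon>0: "\<epsilon> n \<ge> 0" for n using \<epsilon>(2)[of 0 n] by linarith
  define e where "e n = 3 * \<epsilon> n + rho n + 2 * (real (l n) * tbar n)" for n
  have "e \<longlonglongrightarrow> 3 * 0 + 0 + 2 * 0" unfolding e_def by (intro tendsto_intros \<epsilon> rho_0 l_tbar)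
  moreover have e0: "e n \<ge> 0" for n unfolding e_def using \<epsilon>0[of n] max_corr_nonneg tail_bounds by simp
  moreover have "\<forall>\<^sub>F n in sequentially. \<forall>j j'. j < q * r n \<longrightarrow> j' < q * r n \<longrightarrow>
    \<bar>cov (clr (un n) j (j + r n)) (clr (un n) j' (j' + r n)) - wcov (\<bar>real j - real j'\<bar> / real (r n))\<bar> \<le> e n" for q
    using ev_pos ev_small_lags ev_blocks_fit[of "q + 1"]
  proof eventually_elim
    case (elim n)
    have le: "\<bar>cov (clr (un n) j (j + r n)) (clr (un n) j' (j' + r n)) - wcov ((real j' - real j) / real (r n))\<bar> \<le> e n"
      if j: "j \<le> j'" "j' < q * r n" for j j'
    proof (cases "j' \<le> j + r n")
      case True
      have "clr (un n) j (j + r n) \<omega> * clr (un n) j' (j' + r n) \<omega> = clr (un n) j (j' + r n) \<omega>" for \<omega>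
      proof -
        have 1: "clr (un n) j (j + r n) \<omega> = clr (un n) j j' \<omega> * clr (un n) j' (j + r n) \<omega>"
          by (rule clear_split) (use j True in auto)
        have 2: "clr (un n) j' (j' + r n) \<omega> = clr (un n) j' (j + r n) \<omega> * clr (un n) (j + r n) (j' + r n) \<omega>"
          by (rule clear_split) (use j True in auto)
        have 3: "clr (un n) j (j' + r n) \<omega> = clr (un n) j j' \<omega> * clr (un n) j' (j' + r n) \<omega>"
          by (rule clear_split) (use j True in auto)
        have "clr (un n) j' (j + r n) \<omega> \<in> {0, 1}" by (rule clear_01[OF exc_01])
        then show ?thesis unfolding 1 3 unfolding 2 by auto
      qed
      moreover have "expectation (clr (un n) j (j' + r n)) = G n (r n + (j' - j))"
        using expectation_clr[where u="un n" and a=j and h="r n + (j' - j)"] j by (simp add: add.commute)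
      ultimately have c: "cov (clr (un n) j (j + r n)) (clr (un n) j' (j' + r n)) = G n (r n + (j' - j)) - G n (r n) * G n (r n)"
        by (simp add: cov_def expectation_clr)
      have "real (r n + (j' - j)) / real (r n) = 1 + min ((real j' - real j) / real (r n)) 1"
        using j True elim by (simp add: field_simps min_def)
      moreover have "r n + (j' - j) \<le> 2 * r n" using j True by simp
      ultimately have 1: "\<bar>G n (r n + (j' - j)) - exp (- \<alpha> * (1 + min ((real j' - real j) / real (r n)) 1))\<bar> \<le> \<epsilon> n"
        using \<epsilon>(2)[of "r n + (j' - j)" n] by (simp only:)
      have g: "\<bar>G n (r n) - exp (- \<alpha>)\<bar> \<le> \<epsilon> n" using \<epsilon>(2)[of "r n" n] elim by simp
      have "G n (r n) * G n (r n) - exp (- 2 * \<alpha>) = (G n (r n) - exp (- \<alpha>)) * (G n (r n) + exp (- \<alpha>))"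
        by (simp add: algebra_simps flip: exp_add)
      also have "\<bar>\<dots>\<bar> \<le> \<epsilon> n * 2"
      proof -
        have "0 < exp (- \<alpha>)" "exp (- \<alpha>) \<le> 1" using alpha_pos by auto
        then have "\<bar>G n (r n) + exp (- \<alpha>)\<bar> \<le> 2" using no_exc_prob_bounds[of "un n" "r n"] by linarith
        then show ?thesis unfolding abs_mult using g \<epsilon>0[of n] by (intro mult_mono) auto
      qed
      finally have 2: "\<bar>G n (r n) * G n (r n) - exp (- 2 * \<alpha>)\<bar> \<le> 2 * \<epsilon> n" by simp
      have "0 \<le> rho n + 2 * (real (l n) * tbar n)" using max_corr_nonneg tail_bounds by simp
      then show ?thesis unfolding c wcov_def e_def using 1 2 by linarith
    next
      case False
      have "\<bar>cov (clr (un n) j (j + r n)) (clr (un n) j' (j' + r n))\<bar> \<le> rho n + 2 * (real (l n) * tbar n)"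
        by (rule cov_clr_clr) (use False j elim in auto)
      moreover have "wcov ((real j' - real j) / real (r n)) = 0"
        using False elim by (intro wcov_ge_1) (simp add: field_simps)
      ultimately show ?thesis unfolding e_def using \<epsilon>0[of n] by simp
    qed
    show ?case
    proof (intro allI impI)
      fix j j' assume "j < q * r n" "j' < q * r n"
      then show "\<bar>cov (clr (un n) j (j + r n)) (clr (un n) j' (j' + r n)) - wcov (\<bar>real j - real j'\<bar> / real (r n))\<bar> \<le> e n"
        using le[of j j'] le[of j' j] cov_commute[of "clr (un n) j (j + r n)" "clr (un n) j' (j' + r n)"]
        by (cases "j \<le> j'") (auto simp: abs_minus_commute)
    qed
  qed
  ultimately show ?thesis by (intro exI[of _ e]) auto
qed

text \<open>
  Riemann sum of \<open>wcov (\<bar>x\<bar>)\<close> over the positions of all windows that overlap a given one.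
\<close>
definition wcov_sum :: "nat \<Rightarrow> real" where
  "wcov_sum n = (2 * (\<Sum>d<r n. wcov (real d / real (r n))) - wcov 0) / real (r n)"

text \<open>
  Closed form of twice the integral of \<open>wcov\<close> over \<open>{0..1}\<close>, the common value of \<open>\<sigma>\<^sub>1\<^sub>2\<close> and \<open>\<sigma>\<^sub>2\<^sub>2\<close>.
\<close>
definition \<gamma> :: real where
  "\<gamma> = 2 / \<alpha> * exp (- \<alpha>) * (1 - (1 + \<alpha>) * exp (- \<alpha>))"

text \<open>The Riemann sum is a geometric sum with ratio \<open>exp (- \<alpha> / r)\<close>.\<close>
lemma wcov_sum_tendsto: "wcov_sum \<longlonglongrightarrow> \<gamma>"
proof -
  have "(\<lambda>n. 1 / real (r n)) \<longlonglongrightarrow> 0"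
    by (rule tendsto_divide_0[OF tendsto_const filterlim_at_top_imp_at_infinity[OF r_real_at_top]])
  then have inv_r: "(\<lambda>n. wcov 0 * (1 / real (r n))) \<longlonglongrightarrow> wcov 0 * 0" by (rule tendsto_mult_left)
  have "((\<lambda>x. x * (1 - exp (- \<alpha> / x))) \<longlongrightarrow> \<alpha>) at_top" using alpha_pos by real_asymp
  then have den: "(\<lambda>n. real (r n) * (1 - exp (- \<alpha> / real (r n)))) \<longlonglongrightarrow> \<alpha>"
    by (rule filterlim_compose[OF _ r_real_at_top])
  have "(\<lambda>n. 2 * (exp (- \<alpha>) * ((1 - exp (- \<alpha>)) / (real (r n) * (1 - exp (- \<alpha> / real (r n))))) - exp (- 2 * \<alpha>)) - wcov 0 * (1 / real (r n))) \<longlonglongrightarrow>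
      2 * (exp (- \<alpha>) * ((1 - exp (- \<alpha>)) / \<alpha>) - exp (- 2 * \<alpha>)) - wcov 0 * 0"
    using alpha_pos by (intro tendsto_intros den inv_r) auto
  moreover have "\<forall>\<^sub>F n in sequentially. 2 * (exp (- \<alpha>) * ((1 - exp (- \<alpha>)) / (real (r n) * (1 - exp (- \<alpha> / real (r n))))) - exp (- 2 * \<alpha>)) - wcov 0 * (1 / real (r n)) = wcov_sum n"
    using ev_pos
  proof eventually_elim
    case (elim n)
    let ?z = "exp (- \<alpha> / real (r n))"
    have z: "?z \<noteq> 1" using alpha_pos elim by simp
    have "(\<Sum>d<r n. wcov (real d / real (r n))) = (\<Sum>d<r n. exp (- \<alpha>) * ?z ^ d - exp (- 2 * \<alpha>))"
    proof (rule sum.cong[OF refl])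
      fix d assume "d \<in> {..<r n}"
      then have "min (real d / real (r n)) 1 = real d / real (r n)" by simp
      moreover have "?z ^ d = exp (- \<alpha> * (real d / real (r n)))"
        by (simp add: exp_of_nat_mult[symmetric] mult.commute)
      ultimately show "wcov (real d / real (r n)) = exp (- \<alpha>) * ?z ^ d - exp (- 2 * \<alpha>)"
        by (simp add: wcov_def algebra_simps flip: exp_add)
    qed
    also have "\<dots> = exp (- \<alpha>) * (\<Sum>d<r n. ?z ^ d) - real (r n) * exp (- 2 * \<alpha>)"
      by (simp add: sum_subtractf sum_distrib_left)
    also have "(\<Sum>d<r n. ?z ^ d) = (1 - ?z ^ r n) / (1 - ?z)"
      using z by (simp add: sum_gp_strict)
    also have "?z ^ r n = exp (- \<alpha>)"
      using elim by (simp add: exp_of_nat_mult[symmetric])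
    finally have S: "(\<Sum>d<r n. wcov (real d / real (r n))) = exp (- \<alpha>) * ((1 - exp (- \<alpha>)) / (1 - ?z)) - real (r n) * exp (- 2 * \<alpha>)" .
    have alg: "2 * (a * (b / (x * c)) - d) - g * (1 / x) = (2 * (a * (b / c) - x * d) - g) / x" if "x \<noteq> 0" for a b c d g x :: real
      using that by (simp add: diff_divide_distrib right_diff_distrib)
    show ?case unfolding wcov_sum_def S by (rule alg) (use elim in simp)
  qed
  ultimately have "wcov_sum \<longlonglongrightarrow> 2 * (exp (- \<alpha>) * ((1 - exp (- \<alpha>)) / \<alpha>) - exp (- 2 * \<alpha>)) - wcov 0 * 0"
    by (rule Lim_transform_eventually)
  also have "2 * (exp (- \<alpha>) * ((1 - exp (- \<alpha>)) / \<alpha>) - exp (- 2 * \<alpha>)) - wcov 0 * 0 = \<gamma>"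
  proof -
    have "exp (- 2 * \<alpha>) = exp (- \<alpha>) * exp (- \<alpha>)" by (simp flip: exp_add)
    then show ?thesis unfolding \<gamma>_def using alpha_pos by (simp add: field_simps)
  qed
  finally show ?thesis .
qed

lemma wcov_window_sum:
  fixes j Q n :: nat
  defines "H \<equiv> (\<Sum>j'<Q. wcov (\<bar>real j - real j'\<bar> / real (r n))) / real (r n)"
  assumes r: "r n \<ge> 1" and j: "j < Q"
  shows "\<bar>H\<bar> \<le> 2" and "r n \<le> j \<Longrightarrow> j + r n \<le> Q \<Longrightarrow> H = wcov_sum n"
proof -
  define \<phi> where "\<phi> d = wcov (real d / real (r n))" for d
  have \<phi>0: "\<phi> d = 0" if "d \<ge> r n" for d unfolding \<phi>_def using that r by (intro wcov_ge_1) simp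
  have \<phi>1: "\<bar>\<phi> d\<bar> \<le> 1" for d unfolding \<phi>_def by (rule wcov_abs_le) simp
  have cut: "(\<Sum>d\<in>D. \<phi> d) = (\<Sum>d\<in>D \<inter> {..<r n}. \<phi> d)" if "finite D" for D
  proof -
    have "i < r n" if "\<phi> i \<noteq> 0" for i using \<phi>0[of i] that by (cases "i < r n") auto
    then show ?thesis using that by (intro sum.mono_neutral_right) auto
  qed
  have bound: "\<bar>\<Sum>d\<in>D. \<phi> d\<bar> \<le> real (r n)" if "finite D" for D
  proof -
    have "\<bar>\<Sum>d\<in>D. \<phi> d\<bar> \<le> (\<Sum>d\<in>D \<inter> {..<r n}. 1)"
      unfolding cut[OF that] by (rule order_trans[OF sum_abs]) (intro sum_mono \<phi>1)
    also have "\<dots> \<le> real (card {..<r n})"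
      using card_mono[of "{..<r n}" "D \<inter> {..<r n}"] by simp
    finally show ?thesis by simp
  qed
  have "(\<Sum>j'<Q. wcov (\<bar>real j - real j'\<bar> / real (r n))) =
      (\<Sum>j'\<in>{0..<j}. wcov (\<bar>real j - real j'\<bar> / real (r n))) + (\<Sum>j'\<in>{j..<Q}. wcov (\<bar>real j - real j'\<bar> / real (r n)))"
    using sum.atLeastLessThan_concat[of 0 j Q "\<lambda>j'. wcov (\<bar>real j - real j'\<bar> / real (r n))"] j
    by (simp only: lessThan_atLeast0 zero_le less_imp_le)
  also have "(\<Sum>j'\<in>{0..<j}. wcov (\<bar>real j - real j'\<bar> / real (r n))) = (\<Sum>d\<in>{1..j}. \<phi> d)"
    by (rule sum.reindex_bij_witness[of _ "\<lambda>d. j - d" "\<lambda>j'. j - j'"]) (auto simp: \<phi>_def of_nat_diff)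
  also have "(\<Sum>j'\<in>{j..<Q}. wcov (\<bar>real j - real j'\<bar> / real (r n))) = (\<Sum>d\<in>{..<Q - j}. \<phi> d)"
    by (rule sum.reindex_bij_witness[of _ "\<lambda>d. j + d" "\<lambda>j'. j' - j"]) (auto simp: \<phi>_def of_nat_diff)
  finally have H: "H = ((\<Sum>d\<in>{1..j}. \<phi> d) + (\<Sum>d\<in>{..<Q - j}. \<phi> d)) / real (r n)"
    unfolding H_def by simp
  have "\<bar>(\<Sum>d\<in>{1..j}. \<phi> d) + (\<Sum>d\<in>{..<Q - j}. \<phi> d)\<bar> \<le> 2 * real (r n)"
    using bound[of "{1..j}"] bound[of "{..<Q - j}"] by simp
  then show "\<bar>H\<bar> \<le> 2" unfolding H using r by (simp add: abs_divide divide_le_eq)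
  assume mid: "r n \<le> j" "j + r n \<le> Q"
  have "{1..j} \<inter> {..<r n} = {..<r n} - {0}" "{..<Q - j} \<inter> {..<r n} = {..<r n}" using mid by auto
  then have "(\<Sum>d\<in>{1..j}. \<phi> d) = (\<Sum>d\<in>{..<r n}. \<phi> d) - \<phi> 0" "(\<Sum>d\<in>{..<Q - j}. \<phi> d) = (\<Sum>d\<in>{..<r n}. \<phi> d)"
    using cut[of "{1..j}"] cut[of "{..<Q - j}"] r by (simp_all add: sum_diff1)
  then show "H = wcov_sum n" unfolding H wcov_sum_def by (simp add: \<phi>_def)
qed

text \<open>
  Contributions of the first \<open>q\<close> blocks to the disjoint blocks estimator, to the sliding blocks
  estimator and to the exceedance count.
\<close>
definition T_dj :: "nat \<Rightarrow> nat \<Rightarrow> 'a \<Rightarrow> real" where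
  "T_dj q n \<omega> = (\<Sum>i<q. clr (un n) (i * r n) (i * r n + r n) \<omega>)"
definition T_sl :: "nat \<Rightarrow> nat \<Rightarrow> 'a \<Rightarrow> real" where
  "T_sl q n \<omega> = (\<Sum>j<q * r n. clr (un n) j (j + r n) \<omega>) / real (r n)"
definition T_exc :: "nat \<Rightarrow> nat \<Rightarrow> 'a \<Rightarrow> real" where
  "T_exc q n \<omega> = hit (un n) 0 (q * r n) \<omega>"

lemma T_sq_int[simp]: "sq_int (T_dj q n)" "sq_int (T_sl q n)" "sq_int (T_exc q n)"
  unfolding T_dj_def T_sl_def T_exc_def by (auto intro!: sq_int_sum sq_int_divide)

lemma cov_T_dj: "sq_int Y \<Longrightarrow> cov (T_dj q n) Y = (\<Sum>i<q. cov (clr (un n) (i * r n) (i * r n + r n)) Y)"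
  unfolding T_dj_def by (rule cov_sum_left) auto

lemma cov_T_sl: "sq_int Y \<Longrightarrow> cov (T_sl q n) Y = (\<Sum>j<q * r n. cov (clr (un n) j (j + r n)) Y) / real (r n)"
proof -
  assume Y: "sq_int Y"
  have "cov (T_sl q n) Y = cov (\<lambda>\<omega>. (1 / real (r n)) * (\<Sum>j<q * r n. clr (un n) j (j + r n) \<omega>)) Y"
    unfolding T_sl_def by simp
  also have "\<dots> = (1 / real (r n)) * (\<Sum>j<q * r n. cov (clr (un n) j (j + r n)) Y)"
    unfolding cov_cmult_left by (subst cov_sum_left) (use Y in auto)
  finally show ?thesis by simp
qed

lemma cov_T_dj_right: "sq_int Y \<Longrightarrow> cov Y (T_dj q n) = (\<Sum>i<q. cov Y (clr (un n) (i * r n) (i * r n + r n)))"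
  unfolding T_dj_def by (rule cov_sum_right) auto

lemma cov_T_sl_right: "sq_int Y \<Longrightarrow> cov Y (T_sl q n) = (\<Sum>j<q * r n. cov Y (clr (un n) j (j + r n))) / real (r n)"
  by (subst cov_commute, subst cov_T_sl) (auto intro!: sum.cong arg_cong2[where f="(/)"] cov_commute)

text \<open>
  The covariance of one window with the sliding total is \<open>wcov_sum n\<close> up to a uniformly small error,
  except near the ends.  Summing over disjoint or over sliding windows gives the same limit.
\<close>
lemma cov_limits_clear:
  "((\<lambda>(q, n). cov (T_dj q n) (T_dj q n) / real q) \<longlongrightarrow> wcov 0) iter_seq"
  "((\<lambda>(q, n). cov (T_dj q n) (T_sl q n) / real q) \<longlongrightarrow> \<gamma>) iter_seq"
  "((\<lambda>(q, n). cov (T_sl q n) (T_sl q n) / real q) \<longlongrightarrow> \<gamma>) iter_seq"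
proof -
  obtain \<epsilon> where \<epsilon>: "\<epsilon> \<longlonglongrightarrow> 0" "\<And>n. 0 \<le> \<epsilon> n" and
    ev: "\<And>q. \<forall>\<^sub>F n in sequentially. \<forall>j j'. j < q * r n \<longrightarrow> j' < q * r n \<longrightarrow>
    \<bar>cov (clr (un n) j (j + r n)) (clr (un n) j' (j' + r n)) - wcov (\<bar>real j - real j'\<bar> / real (r n))\<bar> \<le> \<epsilon> n"
    using cov_clr_uniform by blast
  show "((\<lambda>(q, n). cov (T_dj q n) (T_dj q n) / real q) \<longlongrightarrow> wcov 0) iter_seq"
  proof (rule tendsto_iter_seq_average[where L="\<lambda>_. wcov 0" and b=0 and err="\<lambda>q n. (real q)\<^sup>2 * \<epsilon> n"])
    fix q :: nat
    show "\<forall>\<^sub>F n in sequentially. \<bar>cov (T_dj q n) (T_dj q n) - real q * wcov 0\<bar> \<le> (real q)\<^sup>2 * \<epsilon> n"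
      using ev[of q] ev_pos
    proof eventually_elim
      case (elim n)
      let ?c = "\<lambda>i i'. cov (clr (un n) (i * r n) (i * r n + r n)) (clr (un n) (i' * r n) (i' * r n + r n))"
      have c: "cov (T_dj q n) (T_dj q n) = (\<Sum>i<q. \<Sum>i'<q. ?c i i')"
        by (simp only: cov_T_dj[OF T_sq_int(1)] cov_T_dj_right[OF clr_sq_int])
      have "real q * wcov 0 = (\<Sum>i<q. \<Sum>i'<q. if i = i' then wcov 0 else 0)" by (simp add: sum.delta)
      then have eq: "cov (T_dj q n) (T_dj q n) - real q * wcov 0 = (\<Sum>i<q. \<Sum>i'<q. ?c i i' - (if i = i' then wcov 0 else 0))"
        unfolding c by (simp only: sum_subtractf)
      have "\<bar>cov (T_dj q n) (T_dj q n) - real q * wcov 0\<bar> \<le> (\<Sum>i<q. \<Sum>i'<q. \<epsilon> n)"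
        unfolding eq
      proof (intro order_trans[OF sum_abs] sum_mono)
        fix i i' assume i: "i \<in> {..<q}" "i' \<in> {..<q}"
        have "wcov (\<bar>real (i * r n) - real (i' * r n)\<bar> / real (r n)) = (if i = i' then wcov 0 else 0)"
        proof (cases "i = i'")
          case False
          have "\<bar>real (i * r n) - real (i' * r n)\<bar> / real (r n) = \<bar>real i - real i'\<bar>"
            using elim by (simp add: abs_mult flip: left_diff_distrib)
          also have "\<dots> \<ge> 1" using False by linarith
          finally show ?thesis using False by (simp add: wcov_ge_1)
        qed simp
        moreover have "\<bar>?c i i' - wcov (\<bar>real (i * r n) - real (i' * r n)\<bar> / real (r n))\<bar> \<le> \<epsilon> n"
        proof -
          have "i * r n < q * r n" "i' * r n < q * r n" using elim i by auto
          with elim(1) show ?thesis by blast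
        qed
        ultimately show "\<bar>?c i i' - (if i = i' then wcov 0 else 0)\<bar> \<le> \<epsilon> n" by (simp only:)
      qed
      also have "(\<Sum>i<q. \<Sum>i'<q. \<epsilon> n) = (real q)\<^sup>2 * \<epsilon> n"
        by (simp only: sum_constant card_lessThan power2_eq_square mult.assoc)
      finally show ?case .
    qed
    show "(\<lambda>n. (real q)\<^sup>2 * \<epsilon> n) \<longlonglongrightarrow> 0" using tendsto_mult_left[OF \<epsilon>(1), of "(real q)\<^sup>2"] by simp
  qed simp
  define B where "B q n = real q * \<epsilon> n + 2 + \<bar>wcov_sum n\<bar>" for q n
  define err where "err q n = real q * (real q * \<epsilon> n) + 2 * B q n" for q n
  have err_lim: "(\<lambda>n. err q n) \<longlonglongrightarrow> 2 * (2 + \<bar>\<gamma>\<bar>)" for q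
  proof -
    have "(\<lambda>n. err q n) \<longlonglongrightarrow> real q * (real q * 0) + 2 * (real q * 0 + 2 + \<bar>\<gamma>\<bar>)"
      unfolding err_def B_def by (intro tendsto_intros \<epsilon> wcov_sum_tendsto)
    then show ?thesis by simp
  qed
  have main: "\<forall>\<^sub>F n in sequentially. \<bar>cov (T_sl q n) (T_sl q n) - real q * wcov_sum n\<bar> \<le> err q n \<and>
      \<bar>cov (T_dj q n) (T_sl q n) - real q * wcov_sum n\<bar> \<le> err q n" for q
    using ev[of q] ev_pos
  proof eventually_elim
    case (elim n)
    define f where "f j = cov (clr (un n) j (j + r n)) (T_sl q n)" for j
    define H where "H j = (\<Sum>j'<q * r n. wcov (\<bar>real j - real j'\<bar> / real (r n))) / real (r n)" for j
    have fH: "\<bar>f j - H j\<bar> \<le> real q * \<epsilon> n" if j: "j < q * r n" for j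
    proof -
      have eq: "f j - H j = (\<Sum>j'<q * r n. cov (clr (un n) j (j + r n)) (clr (un n) j' (j' + r n)) - wcov (\<bar>real j - real j'\<bar> / real (r n))) / real (r n)"
        unfolding f_def H_def by (simp only: cov_T_sl_right[OF clr_sq_int] sum_subtractf diff_divide_distrib)
      have "\<bar>f j - H j\<bar> \<le> (\<Sum>j'<q * r n. \<epsilon> n) / real (r n)"
        unfolding eq abs_divide abs_of_nat
        by (intro divide_right_mono order_trans[OF sum_abs] sum_mono) (use elim j in auto)
      also have "\<dots> = real q * \<epsilon> n" using elim by simp
      finally show ?thesis .
    qed
    have r: "r n \<ge> 1" using elim by simp
    have q\<epsilon>: "0 \<le> real q * \<epsilon> n" using \<epsilon> by simp
    have B0: "0 \<le> B q n" using q\<epsilon> unfolding B_def by simp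
    have mid: "\<bar>f j - wcov_sum n\<bar> \<le> real q * \<epsilon> n" if "r n \<le> j" "j + r n \<le> q * r n" for j
    proof -
      have "j < q * r n" using that r by linarith
      then show ?thesis using fH[of j] wcov_window_sum(2)[OF r, of j "q * r n"] that unfolding H_def by simp
    qed
    have all: "\<bar>f j - wcov_sum n\<bar> \<le> B q n" if "j < q * r n" for j
      using fH[OF that] wcov_window_sum(1)[OF r that] unfolding H_def B_def by linarith
    show ?case
      using sum_near_constant[OF r q\<epsilon> B0 mid all]
      unfolding err_def by (simp add: cov_T_sl[of "T_sl q n"] cov_T_dj[of "T_sl q n"] f_def)
  qed
  show "((\<lambda>(q, n). cov (T_dj q n) (T_sl q n) / real q) \<longlongrightarrow> \<gamma>) iter_seq"
    by (rule tendsto_iter_seq_average[where err=err and L=wcov_sum, OF _ err_lim wcov_sum_tendsto])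
      (rule eventually_mono[OF main], blast)
  show "((\<lambda>(q, n). cov (T_sl q n) (T_sl q n) / real q) \<longlongrightarrow> \<gamma>) iter_seq"
    by (rule tendsto_iter_seq_average[where err=err and L=wcov_sum, OF _ err_lim wcov_sum_tendsto])
      (rule eventually_mono[OF main], blast)
qed

text \<open>
  The covariance of one window with the count comes from the exceedances inside the window, except
  near the right end where part of the window is not counted.
\<close>
lemma cov_limits_hits:
  "((\<lambda>(q, n). cov (T_dj q n) (T_exc q n) / real q) \<longlongrightarrow> - \<tau> * exp (- \<alpha>)) iter_seq"
  "((\<lambda>(q, n). cov (T_sl q n) (T_exc q n) / real q) \<longlongrightarrow> - \<tau> * exp (- \<alpha>)) iter_seq"
  "((\<lambda>(q, n). cov (T_exc q n) (T_exc q n) / real q) \<longlongrightarrow> \<alpha> * m2) iter_seq"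
proof -
  obtain C where C: "C \<ge> 0" "\<And>q. \<forall>\<^sub>F n in sequentially. sqrt (expectation (\<lambda>\<omega>. (hit (un n) 0 (q * r n) \<omega>)\<^sup>2)) \<le> real q * C"
    using hit_L2_bound by blast
  define L where "L n = - (real (r n) * tbar n * G n (r n))" for n
  define e where "e q n = rho n * (real q * C) + real (l n) * tbar n" for q n
  define err where "err q n = real q * (2 * e q n) + 2 * (2 * e q n + 2 * (real (r n) * tbar n))" for q n
  have e0: "0 \<le> e q n" for q n unfolding e_def using C(1) max_corr_nonneg tail_bounds by simp
  have Gr: "(\<lambda>n. G n (r n)) \<longlonglongrightarrow> exp (- \<alpha> * 1)"
    by (rule no_exc_prob_tendsto)
      (use ev_pos in \<open>auto intro!: tendsto_eventually elim!: eventually_mono\<close>)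
  have L: "L \<longlonglongrightarrow> - \<tau> * exp (- \<alpha>)"
    using tendsto_minus[OF tendsto_mult[OF r_tbar Gr]] by (simp add: L_def[abs_def])
  have err_lim: "(\<lambda>n. err q n) \<longlonglongrightarrow> 4 * \<tau>" for q
  proof -
    have "(\<lambda>n. err q n) \<longlonglongrightarrow> real q * (2 * (0 * (real q * C) + 0)) + 2 * (2 * (0 * (real q * C) + 0) + 2 * \<tau>)"
      unfolding err_def e_def by (intro tendsto_intros rho_0 l_tbar r_tbar)
    then show ?thesis by simp
  qed
  have main: "\<forall>\<^sub>F n in sequentially. \<bar>cov (T_sl q n) (T_exc q n) - real q * L n\<bar> \<le> err q n \<and>
      \<bar>cov (T_dj q n) (T_exc q n) - real q * L n\<bar> \<le> err q n" for q
    using C(2)[of q] ev_pos ev_small_lags ev_blocks_fit[of "q + 1"]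
  proof eventually_elim
    case (elim n)
    define f where "f j = cov (clr (un n) j (j + r n)) (T_exc q n)" for j
    have f: "f j = cov (hit (un n) 0 (q * r n)) (clr (un n) j (j + r n))" for j
      unfolding f_def T_exc_def by (rule cov_commute)
    have r: "r n \<ge> 1" using elim by simp
    have rt: "0 \<le> real (r n) * tbar n" using tail_bounds by simp
    have ee: "rho n * sqrt (expectation (\<lambda>\<omega>. (hit (un n) 0 (q * r n) \<omega>)\<^sup>2)) + real (l n) * tbar n \<le> e q n"
      unfolding e_def using elim max_corr_nonneg by (intro add_right_mono mult_left_mono) auto
    have within: "\<bar>f j - L n\<bar> \<le> 2 * e q n" if "j + r n \<le> q * r n" for j
    proof -
      have "\<bar>f j - L n\<bar> = \<bar>f j + real (r n) * tbar n * G n (r n)\<bar>" by (simp add: L_def)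
      also have "\<dots> \<le> 2 * (rho n * sqrt (expectation (\<lambda>\<omega>. (hit (un n) 0 (q * r n) \<omega>)\<^sup>2)) + real (l n) * tbar n)"
        unfolding f by (rule cov_hit_clr_within) (use elim that in auto)
      also have "\<dots> \<le> 2 * e q n" by (intro mult_left_mono ee) simp
      finally show ?thesis .
    qed
    have gen: "\<bar>x - y\<bar> \<le> 2 * c + 2 * a" if "\<bar>x\<bar> \<le> a + b" "\<bar>y\<bar> \<le> a * 1" "b \<le> c" "0 \<le> c" for x y a b c :: real
      using that by linarith
    have all: "\<bar>f j - L n\<bar> \<le> 2 * e q n + 2 * (real (r n) * tbar n)" if j: "j < q * r n" for j
    proof (cases "j + r n \<le> q * r n")
      case True
      show ?thesis by (rule order_trans[OF within[OF True]]) (use rt in simp)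
    next
      case False
      have "\<bar>f j\<bar> \<le> real (r n) * tbar n +
        (rho n * sqrt (expectation (\<lambda>\<omega>. (hit (un n) 0 (q * r n) \<omega>)\<^sup>2)) + real (l n) * tbar n)"
        unfolding f by (rule cov_hit_clr_boundary) (use elim j False in auto)
      moreover have "\<bar>L n\<bar> \<le> real (r n) * tbar n * 1"
        unfolding L_def abs_minus_cancel abs_mult using no_exc_prob_bounds[of "un n" "r n"] tail_bounds
        by (intro mult_mono) (auto simp: abs_mult)
      ultimately show ?thesis by (rule gen[OF _ _ ee e0])
    qed
    have E0: "0 \<le> 2 * e q n" "0 \<le> 2 * e q n + 2 * (real (r n) * tbar n)" using e0[of q n] rt by auto
    show ?case
      using sum_near_constant[OF r E0 within all]
      unfolding err_def by (simp add: cov_T_sl[of "T_exc q n"] cov_T_dj[of "T_exc q n"] f_def)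
  qed
  show "((\<lambda>(q, n). cov (T_dj q n) (T_exc q n) / real q) \<longlongrightarrow> - \<tau> * exp (- \<alpha>)) iter_seq"
    by (rule tendsto_iter_seq_average[where err=err and L=L, OF _ err_lim L])
      (rule eventually_mono[OF main], blast)
  show "((\<lambda>(q, n). cov (T_sl q n) (T_exc q n) / real q) \<longlongrightarrow> - \<tau> * exp (- \<alpha>)) iter_seq"
    by (rule tendsto_iter_seq_average[where err=err and L=L, OF _ err_lim L])
      (rule eventually_mono[OF main], blast)
  show "((\<lambda>(q, n). cov (T_exc q n) (T_exc q n) / real q) \<longlongrightarrow> \<alpha> * m2) iter_seq"
  proof (rule tendsto_iter_seq)
    show "(\<lambda>n. cov (T_exc q n) (T_exc q n) / real q) \<longlonglongrightarrow> real q * (\<alpha> * m2) / real q" for q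
      unfolding T_exc_def divide_inverse by (rule tendsto_mult[OF variance_hit_tendsto tendsto_const])
    show "(\<lambda>q. real q * (\<alpha> * m2) / real q) \<longlonglongrightarrow> \<alpha> * m2"
      by (rule tendsto_eventually) (rule eventually_mono[OF eventually_gt_at_top[of 0]], simp)
  qed
qed

end

section \<open>The central limit theorem for block contributions\<close>

lemma iter_seq_neq_bot: "iter_seq \<noteq> bot"
  unfolding trivial_limit_def eventually_iter_seq by simp

text \<open>
  Contribution of block \<open>i\<close> to the linear combination with coefficients \<open>a\<close>, \<open>b\<close>, \<open>c\<close>, as a functional of
  the indicator sequence; the block length is \<open>k\<close> and \<open>\<mu>\<close> is the centring.
\<close>
definition block_stat :: "real \<Rightarrow> real \<Rightarrow> real \<Rightarrow> nat \<Rightarrow> real \<Rightarrow> nat \<Rightarrow> (nat \<Rightarrow> real) \<Rightarrow> real" where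
  "block_stat a b c k \<mu> i x = a * clear (i * k) (i * k + k) x +
    b * ((\<Sum>j\<in>{i * k..<i * k + k}. clear j (j + k) x) / real k) + c * hits (i * k) (i * k + k) x - \<mu>"

lemma block_stat_measurable[measurable]: "block_stat a b c k \<mu> i \<in> borel_measurable (\<Pi>\<^sub>M i\<in>UNIV. borel)"
  unfolding block_stat_def by measurable

lemma block_stat_shift: "block_stat a b c k \<mu> (i + h) x = block_stat a b c k \<mu> i (\<lambda>m. x (m + h * k))"
proof -
  have e: "(i + h) * k = i * k + h * k" "i * k + h * k + k = i * k + k + h * k" by (simp_all add: algebra_simps)
  have "(\<Sum>j\<in>{i * k + h * k..<i * k + k + h * k}. clear j (j + k) x) =
      (\<Sum>j\<in>{i * k..<i * k + k}. clear (j + h * k) (j + h * k + k) x)"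
    by (rule sum.shift_bounds_nat_ivl)
  also have "\<dots> = (\<Sum>j\<in>{i * k..<i * k + k}. clear j (j + k) (\<lambda>m. x (m + h * k)))"
    using clear_shift[of _ "h * k" _ x] by (intro sum.cong refl) (metis add.assoc add.commute)
  finally show ?thesis
    unfolding block_stat_def e clear_shift hits_shift by simp
qed

lemma block_stat_bound:
  assumes "\<And>i. x i \<in> {0, 1}"
  shows "\<bar>block_stat a b c k \<mu> i x\<bar> \<le> \<bar>a\<bar> + \<bar>b\<bar> + \<bar>\<mu>\<bar> + \<bar>c\<bar> * hits (i * k) (i * k + k) x"
proof -
  have "\<bar>a * clear (i * k) (i * k + k) x\<bar> \<le> \<bar>a\<bar> * 1"
    unfolding abs_mult by (intro mult_left_mono clear_nonneg_le_1 assms) auto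
  moreover have "\<bar>(\<Sum>j\<in>{i * k..<i * k + k}. clear j (j + k) x) / real k\<bar> \<le> 1"
  proof -
    have "\<bar>\<Sum>j\<in>{i * k..<i * k + k}. clear j (j + k) x\<bar> \<le> (\<Sum>j\<in>{i * k..<i * k + k}. 1)"
      by (rule order_trans[OF sum_abs]) (intro sum_mono clear_nonneg_le_1 assms)
    then show ?thesis by (cases "k = 0") (auto simp: abs_divide divide_le_eq)
  qed
  then have "\<bar>b * ((\<Sum>j\<in>{i * k..<i * k + k}. clear j (j + k) x) / real k)\<bar> \<le> \<bar>b\<bar> * 1"
    unfolding abs_mult by (intro mult_left_mono) auto
  moreover have "\<bar>c * hits (i * k) (i * k + k) x\<bar> = \<bar>c\<bar> * hits (i * k) (i * k + k) x"
    using hits_nonneg_le(1)[OF assms] by (simp add: abs_mult)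
  ultimately show ?thesis unfolding block_stat_def by linarith
qed

context block_asymptotics
begin

text \<open>The quadratic form of the limiting covariance matrix.\<close>
definition limit_var :: "real \<Rightarrow> real \<Rightarrow> real \<Rightarrow> real" where
  "limit_var a b c = a\<^sup>2 * wcov 0 + b\<^sup>2 * \<gamma> + c\<^sup>2 * (\<alpha> * m2) + 2 * a * b * \<gamma> +
    2 * a * c * (- \<tau> * exp (- \<alpha>)) + 2 * b * c * (- \<tau> * exp (- \<alpha>))"

lemma cov_T_quadratic:
  "cov (\<lambda>\<omega>. a * T_dj q n \<omega> + b * T_sl q n \<omega> + c * T_exc q n \<omega>) (\<lambda>\<omega>. a * T_dj q n \<omega> + b * T_sl q n \<omega> + c * T_exc q n \<omega>) =
    a\<^sup>2 * cov (T_dj q n) (T_dj q n) + b\<^sup>2 * cov (T_sl q n) (T_sl q n) + c\<^sup>2 * cov (T_exc q n) (T_exc q n) +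
    2 * a * b * cov (T_dj q n) (T_sl q n) + 2 * a * c * cov (T_dj q n) (T_exc q n) + 2 * b * c * cov (T_sl q n) (T_exc q n)"
proof -
  have sq: "sq_int (\<lambda>\<omega>. x * T_dj q n \<omega>)" "sq_int (\<lambda>\<omega>. x * T_sl q n \<omega>)" "sq_int (\<lambda>\<omega>. x * T_exc q n \<omega>)" for x
    by (intro sq_int_cmult T_sq_int)+
  let ?Y = "\<lambda>\<omega>. a * T_dj q n \<omega> + b * T_sl q n \<omega> + c * T_exc q n \<omega>"
  have Y: "sq_int ?Y" by (intro sq_int_add sq)
  have l: "cov ?Y Z = a * cov (T_dj q n) Z + b * cov (T_sl q n) Z + c * cov (T_exc q n) Z" if "sq_int Z" for Z
    by (simp add: cov_add_left sq sq_int_add that cov_cmult_left)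
  have r: "cov Z ?Y = a * cov Z (T_dj q n) + b * cov Z (T_sl q n) + c * cov Z (T_exc q n)" if "sq_int Z" for Z
    by (simp add: cov_add_right sq sq_int_add that cov_cmult_right)
  show ?thesis
    unfolding l[OF Y] r[OF T_sq_int(1)] r[OF T_sq_int(2)] r[OF T_sq_int(3)]
    using cov_commute[of "T_sl q n" "T_dj q n"] cov_commute[of "T_exc q n" "T_dj q n"] cov_commute[of "T_exc q n" "T_sl q n"]
    by (simp add: algebra_simps power2_eq_square)
qed

lemma quadratic_limit:
  "((\<lambda>(q, n). cov (\<lambda>\<omega>. a * T_dj q n \<omega> + b * T_sl q n \<omega> + c * T_exc q n \<omega>)
     (\<lambda>\<omega>. a * T_dj q n \<omega> + b * T_sl q n \<omega> + c * T_exc q n \<omega>) / real q) \<longlongrightarrow> limit_var a b c) iter_seq"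
proof -
  note lims = cov_limits_clear[unfolded case_prod_unfold] cov_limits_hits[unfolded case_prod_unfold]
  have "((\<lambda>x. a\<^sup>2 * (cov (T_dj (fst x) (snd x)) (T_dj (fst x) (snd x)) / real (fst x)) +
      b\<^sup>2 * (cov (T_sl (fst x) (snd x)) (T_sl (fst x) (snd x)) / real (fst x)) +
      c\<^sup>2 * (cov (T_exc (fst x) (snd x)) (T_exc (fst x) (snd x)) / real (fst x)) +
      2 * a * b * (cov (T_dj (fst x) (snd x)) (T_sl (fst x) (snd x)) / real (fst x)) +
      2 * a * c * (cov (T_dj (fst x) (snd x)) (T_exc (fst x) (snd x)) / real (fst x)) +
      2 * b * c * (cov (T_sl (fst x) (snd x)) (T_exc (fst x) (snd x)) / real (fst x))) \<longlongrightarrow> limit_var a b c) iter_seq"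
    unfolding limit_var_def by (intro tendsto_add tendsto_mult tendsto_const lims)
  then show ?thesis
    unfolding case_prod_unfold cov_T_quadratic by (simp add: add_divide_distrib)
qed

text \<open>
  Nonnegativity is inherited from the variances of which it is the limit; it is not evident from the
  formula.
\<close>
lemma limit_var_nonneg: "0 \<le> limit_var a b c"
proof (rule tendsto_lowerbound[OF quadratic_limit _ iter_seq_neq_bot])
  show "\<forall>\<^sub>F x in iter_seq. 0 \<le> (case x of (q, n) \<Rightarrow> cov (\<lambda>\<omega>. a * T_dj q n \<omega> + b * T_sl q n \<omega> + c * T_exc q n \<omega>)
     (\<lambda>\<omega>. a * T_dj q n \<omega> + b * T_sl q n \<omega> + c * T_exc q n \<omega>) / real q)"
    by (auto intro!: always_eventually divide_nonneg_nonneg cov_self_nonneg sq_int_add sq_int_cmult T_sq_int)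
qed

definition mean_W :: "real \<Rightarrow> real \<Rightarrow> real \<Rightarrow> nat \<Rightarrow> real" where
  "mean_W a b c n = a * G n (r n) + b * G n (r n) + c * (real (r n) * tbar n)"

definition W :: "real \<Rightarrow> real \<Rightarrow> real \<Rightarrow> nat \<Rightarrow> nat \<Rightarrow> 'a \<Rightarrow> real" where
  "W a b c n i \<omega> = block_stat a b c (r n) (mean_W a b c n) i (exc (un n) \<omega>)"

lemma W_sq_int: "sq_int (W a b c n i)"
  unfolding W_def block_stat_def
  by (intro sq_int_diff sq_int_add sq_int_cmult sq_int_divide sq_int_sum clr_sq_int hit_sq_int sq_int_const)

lemma expectation_W:
  assumes "r n \<ge> 1"
  shows "expectation (W a b c n i) = 0"
proof -
  have i: "integrable M (clr (un n) j j')" "integrable M (hit (un n) j j')" for j j'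
    by (intro sq_int_integrable clr_sq_int hit_sq_int)+
  have "expectation (\<lambda>\<omega>. (\<Sum>j\<in>{i * r n..<i * r n + r n}. clr (un n) j (j + r n) \<omega>) / real (r n)) = G n (r n)"
    using assms i by (simp add: expectation_clr)
  then show ?thesis
    unfolding W_def block_stat_def mean_W_def using i assms
    by (simp add: expectation_clr expectation_hit prob_space)
qed

lemma sum_W: "(\<Sum>i<q. W a b c n i \<omega>) = a * T_dj q n \<omega> + b * T_sl q n \<omega> + c * T_exc q n \<omega> - real q * mean_W a b c n"
proof -
  have "(\<Sum>i<q. \<Sum>j\<in>{i * r n..<i * r n + r n}. clr (un n) j (j + r n) \<omega>) = (\<Sum>j<q * r n. clr (un n) j (j + r n) \<omega>)"
    by (rule sum.nat_group)
  then have "T_sl q n \<omega> = (\<Sum>i<q. (\<Sum>j\<in>{i * r n..<i * r n + r n}. clr (un n) j (j + r n) \<omega>) / real (r n))"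
    unfolding T_sl_def by (simp only: sum_divide_distrib[symmetric])
  then show ?thesis
    unfolding W_def block_stat_def T_dj_def T_exc_def hits_nat_group
    by (simp add: sum.distrib sum_subtractf sum_distrib_left)
qed

lemma W_stationary:
  "distr M borel (\<lambda>\<omega>. \<Sum>i\<in>{d..<d+q}. W a b c n i \<omega>) = distr M borel (\<lambda>\<omega>. \<Sum>i<q. W a b c n i \<omega>)"
proof -
  let ?f = "\<lambda>x. \<Sum>i<q. block_stat a b c (r n) (mean_W a b c n) i x"
  have "(\<Sum>i\<in>{d..<d+q}. W a b c n i \<omega>) = ?f (\<lambda>i. exc (un n) \<omega> (i + d * r n))" for \<omega>
  proof -
    have "(\<Sum>i\<in>{0 + d..<q + d}. W a b c n i \<omega>) = (\<Sum>i\<in>{0..<q}. W a b c n (i + d) \<omega>)"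
      by (rule sum.shift_bounds_nat_ivl)
    then show ?thesis by (simp add: W_def block_stat_shift add.commute[of q d] lessThan_atLeast0)
  qed
  moreover have "(\<Sum>i<q. W a b c n i \<omega>) = ?f (exc (un n) \<omega>)" for \<omega> by (simp add: W_def)
  moreover have "?f \<in> borel_measurable (\<Pi>\<^sub>M i\<in>UNIV. borel)" by measurable
  ultimately show ?thesis using distr_exc_shift[of ?f "un n" "d * r n"] by simp
qed

text \<open>The windows starting in block \<open>i\<close> end in block \<open>i + 1\<close>.\<close>
lemma W_field:
  assumes "lo \<le> Suc (i * r n)" "(i + 2) * r n \<le> hi"
  shows "W a b c n i \<in> borel_measurable (threshold_field M X (un n) lo hi)"
proof -
  have "j + r n \<le> hi" if "j < i * r n + r n" for j using assms that by (simp add: add_mult_distrib)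
  then show ?thesis
    unfolding W_def block_stat_def using assms
    by (intro borel_measurable_diff borel_measurable_add borel_measurable_times borel_measurable_divide
        borel_measurable_sum borel_measurable_const clear_threshold_field hits_threshold_field)
      (auto simp: add_mult_distrib)
qed

text \<open>
  Two missing indices leave one whole block of length \<open>r \<ge> l\<close> between the observations involved.
\<close>
lemma W_mixing:
  fixes f g :: "real \<Rightarrow> real"
  assumes r: "1 \<le> r n" "l n \<le> r n" and K: "d + 2 \<le> n div r n - 1"
    and I: "I \<subseteq> {..<d}" "I' \<subseteq> {d + 2..<n div r n - 1}"
    and [measurable]: "f \<in> borel_measurable borel" "g \<in> borel_measurable borel"
    and sq: "sq_int (\<lambda>\<omega>. f (\<Sum>i\<in>I. W a b c n i \<omega>))" "sq_int (\<lambda>\<omega>. g (\<Sum>i\<in>I'. W a b c n i \<omega>))"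
  shows "\<bar>cov (\<lambda>\<omega>. f (\<Sum>i\<in>I. W a b c n i \<omega>)) (\<lambda>\<omega>. g (\<Sum>i\<in>I'. W a b c n i \<omega>))\<bar> \<le>
    rho n * (sqrt (expectation (\<lambda>\<omega>. (f (\<Sum>i\<in>I. W a b c n i \<omega>))\<^sup>2)) *
      sqrt (expectation (\<lambda>\<omega>. (g (\<Sum>i\<in>I'. W a b c n i \<omega>))\<^sup>2)))"
proof (rule cov_le_max_corr[where t="(d + 1) * r n" and t'="Suc ((d + 2) * r n)"])
  have kn: "n div r n * r n \<le> n" by (rule div_times_less_eq_dividend)
  have "(d + 3) * r n \<le> n div r n * r n" using K by (intro mult_right_mono) auto
  then have d3: "(d + 3) * r n \<le> n" using kn by linarith
  have "1 * 1 \<le> (d + 1) * r n" using r by (intro mult_mono) auto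
  then show "1 \<le> (d + 1) * r n" by simp
  show "(d + 1) * r n \<le> n - l n" using d3 r by (simp add: add_mult_distrib)
  show "(d + 1) * r n + l n \<le> Suc ((d + 2) * r n)" using r by (simp add: add_mult_distrib)
  have "W a b c n i \<in> borel_measurable (threshold_field M X (un n) 1 ((d + 1) * r n))" if "i \<in> I" for i
  proof -
    have "i + 2 \<le> d + 1" using I that by auto
    then have "(i + 2) * r n \<le> (d + 1) * r n" by (rule mult_right_mono) simp
    then show ?thesis by (intro W_field) auto
  qed
  then have [measurable]: "(\<lambda>\<omega>. \<Sum>i\<in>I. W a b c n i \<omega>) \<in> borel_measurable (threshold_field M X (un n) 1 ((d + 1) * r n))"
    by (rule borel_measurable_sum)
  show "(\<lambda>\<omega>. f (\<Sum>i\<in>I. W a b c n i \<omega>)) \<in> borel_measurable (threshold_field M X (un n) 1 ((d + 1) * r n))" by measurable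
  have "W a b c n i \<in> borel_measurable (threshold_field M X (un n) (Suc ((d + 2) * r n)) n)" if "i \<in> I'" for i
  proof -
    have "i \<in> {d + 2..<n div r n - 1}" using I(2) that by blast
    then have i: "d + 2 \<le> i" "i + 2 \<le> n div r n" by auto
    have "(d + 2) * r n \<le> i * r n" "(i + 2) * r n \<le> n div r n * r n" using i by (intro mult_right_mono; simp)+
    then show ?thesis by (intro W_field) (simp, rule order_trans[OF _ kn])
  qed
  then have [measurable]: "(\<lambda>\<omega>. \<Sum>i\<in>I'. W a b c n i \<omega>) \<in> borel_measurable (threshold_field M X (un n) (Suc ((d + 2) * r n)) n)"
    by (rule borel_measurable_sum)
  show "(\<lambda>\<omega>. g (\<Sum>i\<in>I'. W a b c n i \<omega>)) \<in> borel_measurable (threshold_field M X (un n) (Suc ((d + 2) * r n)) n)" by measurable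
qed (fact sq)+

lemma W_powr_bound:
  "\<bar>W a b c n i \<omega>\<bar> powr (2 * p) \<le> 2 powr (2 * p) *
    ((\<bar>a\<bar> + \<bar>b\<bar> + \<bar>mean_W a b c n\<bar>) powr (2 * p) + \<bar>c\<bar> powr (2 * p) * hit (un n) (i * r n) (i * r n + r n) \<omega> powr (2 * p))"
proof -
  let ?A = "\<bar>a\<bar> + \<bar>b\<bar> + \<bar>mean_W a b c n\<bar>" and ?h = "hit (un n) (i * r n) (i * r n + r n) \<omega>"
  have "\<bar>W a b c n i \<omega>\<bar> powr (2 * p) \<le> \<bar>?A + \<bar>c\<bar> * ?h\<bar> powr (2 * p)"
    using block_stat_bound[of "exc (un n) \<omega>" a b c "r n" "mean_W a b c n" i, OF exc_01] p_gt_1 hit_nonneg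
    unfolding W_def by (intro powr_mono2) auto
  also have "\<dots> = \<bar>\<Sum>k\<in>{0, 1::nat}. if k = 0 then ?A else \<bar>c\<bar> * ?h\<bar> powr (2 * p)" by simp
  also have "\<dots> \<le> real (card {0, 1::nat}) powr (2 * p) * (\<Sum>k\<in>{0, 1::nat}. \<bar>if k = 0 then ?A else \<bar>c\<bar> * ?h\<bar> powr (2 * p))"
    using p_gt_1 by (intro powr_sum_le) auto
  also have "\<dots> = 2 powr (2 * p) * (?A powr (2 * p) + \<bar>c\<bar> powr (2 * p) * ?h powr (2 * p))"
    using hit_nonneg by (simp add: abs_mult powr_mult)
  finally show ?thesis .
qed

lemma W_powr_integrable: "integrable M (\<lambda>\<omega>. \<bar>W a b c n i \<omega>\<bar> powr (2 * p))"
proof (rule Bochner_Integration.integrable_bound)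
  show "integrable M (\<lambda>\<omega>. 2 powr (2 * p) * ((\<bar>a\<bar> + \<bar>b\<bar> + \<bar>mean_W a b c n\<bar>) powr (2 * p) +
      \<bar>c\<bar> powr (2 * p) * hit (un n) (i * r n) (i * r n + r n) \<omega> powr (2 * p)))"
    by (intro integrable_mult_right Bochner_Integration.integrable_add hit_powr_integrable integrable_const)
  have [measurable]: "W a b c n i \<in> borel_measurable M" using W_sq_int by (rule sq_int_measurable)
  show "(\<lambda>\<omega>. \<bar>W a b c n i \<omega>\<bar> powr (2 * p)) \<in> borel_measurable M" by measurable
qed (auto intro!: AE_I2 W_powr_bound)

lemma W_moments: "\<exists>C. \<forall>\<^sub>F n in sequentially. \<forall>i. expectation (\<lambda>\<omega>. \<bar>W a b c n i \<omega>\<bar> powr (2 * p)) \<le> C"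
proof -
  obtain C where C: "C \<ge> 0" "\<forall>\<^sub>F n in sequentially. expectation (\<lambda>\<omega>. hit (un n) 0 (r n) \<omega> powr (2 * p)) \<le> C"
    using r_moment_bound by blast
  define A where "A = \<bar>a\<bar> + \<bar>b\<bar> + (\<bar>a\<bar> + \<bar>b\<bar> + \<bar>c\<bar> * (\<tau> + 1))"
  have "\<forall>\<^sub>F n in sequentially. real (r n) * tbar n < \<tau> + 1"
    by (rule order_tendstoD(2)[OF r_tbar]) simp
  then have "\<forall>\<^sub>F n in sequentially. \<forall>i. expectation (\<lambda>\<omega>. \<bar>W a b c n i \<omega>\<bar> powr (2 * p)) \<le>
      2 powr (2 * p) * (A powr (2 * p) + \<bar>c\<bar> powr (2 * p) * C)"
    using C(2)
  proof eventually_elim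
    case (elim n)
    have rt0: "0 \<le> real (r n) * tbar n" using tail_bounds by simp
    have "\<bar>mean_W a b c n\<bar> \<le> \<bar>a * G n (r n)\<bar> + \<bar>b * G n (r n)\<bar> + \<bar>c * (real (r n) * tbar n)\<bar>"
      unfolding mean_W_def by linarith
    also have "\<dots> \<le> \<bar>a\<bar> * 1 + \<bar>b\<bar> * 1 + \<bar>c\<bar> * (\<tau> + 1)"
      unfolding abs_mult using no_exc_prob_bounds[of "un n" "r n"] elim(1) rt0
      by (intro add_mono mult_left_mono) (auto simp: abs_mult)
    finally have m: "\<bar>a\<bar> + \<bar>b\<bar> + \<bar>mean_W a b c n\<bar> \<le> A" unfolding A_def by simp
    show ?case
    proof
      fix i
      have st: "expectation (\<lambda>\<omega>. hit (un n) (i * r n) (i * r n + r n) \<omega> powr (2 * p)) = expectation (\<lambda>\<omega>. hit (un n) 0 (r n) \<omega> powr (2 * p))"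
      proof -
        have "(\<lambda>x. hits 0 (r n) x powr (2 * p)) \<in> borel_measurable (\<Pi>\<^sub>M i\<in>UNIV. borel)" by measurable
        from expectation_exc_shift[OF this, of "un n" "i * r n"] show ?thesis
          using hits_shift[of 0 "i * r n" "r n"] by (simp add: add.commute)
      qed
      have "expectation (\<lambda>\<omega>. \<bar>W a b c n i \<omega>\<bar> powr (2 * p)) \<le>
          expectation (\<lambda>\<omega>. 2 powr (2 * p) * ((\<bar>a\<bar> + \<bar>b\<bar> + \<bar>mean_W a b c n\<bar>) powr (2 * p) +
            \<bar>c\<bar> powr (2 * p) * hit (un n) (i * r n) (i * r n + r n) \<omega> powr (2 * p)))"
        by (intro integral_mono W_powr_bound W_powr_integrable integrable_mult_right
            Bochner_Integration.integrable_add hit_powr_integrable integrable_const)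
      also have "\<dots> = 2 powr (2 * p) * ((\<bar>a\<bar> + \<bar>b\<bar> + \<bar>mean_W a b c n\<bar>) powr (2 * p) +
          \<bar>c\<bar> powr (2 * p) * expectation (\<lambda>\<omega>. hit (un n) 0 (r n) \<omega> powr (2 * p)))"
        using hit_powr_integrable by (simp add: st[symmetric] prob_space)
      also have "\<dots> \<le> 2 powr (2 * p) * (A powr (2 * p) + \<bar>c\<bar> powr (2 * p) * C)"
        using m elim(2) p_gt_1 by (intro mult_left_mono add_mono powr_mono2) auto
      finally show "expectation (\<lambda>\<omega>. \<bar>W a b c n i \<omega>\<bar> powr (2 * p)) \<le> 2 powr (2 * p) * (A powr (2 * p) + \<bar>c\<bar> powr (2 * p) * C)" .
    qed
  qed
  then show ?thesis by blast
qed

lemma blocks_at_top: "filterlim (\<lambda>n. real (n div r n)) at_top sequentially"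
  unfolding filterlim_at_top_ge[where c=1]
proof (intro allI impI)
  fix Z :: real
  obtain q :: nat where q: "Z \<le> real q" using real_arch_simple by blast
  show "\<forall>\<^sub>F n in sequentially. Z \<le> real (n div r n)"
    using ev_blocks_fit[of q] ev_pos
  proof eventually_elim
    case (elim n)
    then have "q * r n div r n \<le> n div r n" by (intro div_le_mono)
    then show ?case using elim q by simp
  qed
qed

lemma W_clt:
  "(\<lambda>n. expectation (\<lambda>\<omega>. iexp ((\<Sum>i<n div r n - 1. W a b c n i \<omega>) / sqrt (real (n div r n))))) \<longlonglongrightarrow> exp (- limit_var a b c / 2)"
proof -
  obtain C where C: "\<forall>\<^sub>F n in sequentially. \<forall>i. expectation (\<lambda>\<omega>. \<bar>W a b c n i \<omega>\<bar> powr (2 * p)) \<le> C"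
    using W_moments by blast
  have rpos: "r n \<ge> 1" if "i < n div r n - 1" for i n
    using that by (cases "r n = 0") auto
  show ?thesis
  proof (rule bernstein_clt[where W="W a b c" and \<delta>=rho and p=p and C=C])
    show "\<forall>\<^sub>F n in sequentially. \<forall>i<n div r n - 1. expectation (\<lambda>\<omega>. \<bar>W a b c n i \<omega>\<bar> powr (2 * p)) \<le> C"
      using C by eventually_elim blast
    show "\<forall>\<^sub>F n in sequentially. \<forall>d I I' (f :: real \<Rightarrow> real) (g :: real \<Rightarrow> real).
      d + 2 \<le> n div r n - 1 \<longrightarrow> I \<subseteq> {..<d} \<longrightarrow> I' \<subseteq> {d+2..<n div r n - 1} \<longrightarrow>
      f \<in> borel_measurable borel \<longrightarrow> g \<in> borel_measurable borel \<longrightarrow>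
      sq_int (\<lambda>\<omega>. f (\<Sum>i\<in>I. W a b c n i \<omega>)) \<longrightarrow> sq_int (\<lambda>\<omega>. g (\<Sum>i\<in>I'. W a b c n i \<omega>)) \<longrightarrow>
      \<bar>cov (\<lambda>\<omega>. f (\<Sum>i\<in>I. W a b c n i \<omega>)) (\<lambda>\<omega>. g (\<Sum>i\<in>I'. W a b c n i \<omega>))\<bar> \<le>
        rho n * (sqrt (expectation (\<lambda>\<omega>. (f (\<Sum>i\<in>I. W a b c n i \<omega>))\<^sup>2)) *
          sqrt (expectation (\<lambda>\<omega>. (g (\<Sum>i\<in>I'. W a b c n i \<omega>))\<^sup>2)))"
      using ev_pos ev_small_lags
    proof eventually_elim
      case (elim n)
      then show ?case by (intro allI impI) (rule W_mixing, auto)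
    qed
    show "(\<lambda>n. real (n div r n) * rho n) \<longlonglongrightarrow> 0"
    proof (rule real_tendsto_sandwich[OF _ _ tendsto_const rho_n_r])
      show "\<forall>\<^sub>F n in sequentially. real (n div r n) * rho n \<le> rho n * real n / real (r n)"
      proof (intro always_eventually allI)
        fix n
        have "real (n div r n) * rho n \<le> real n / real (r n) * rho n"
          by (intro mult_right_mono of_nat_div_le_of_nat max_corr_nonneg)
        then show "real (n div r n) * rho n \<le> rho n * real n / real (r n)" by (simp add: mult.commute)
      qed
    qed (simp add: max_corr_nonneg)
    show "(\<lambda>n. real (n div r n - 1) / real (n div r n)) \<longlonglongrightarrow> 1"
    proof -
      have "(\<lambda>n. 1 - 1 / real (n div r n)) \<longlonglongrightarrow> 1 - 0"
        by (intro tendsto_diff tendsto_const tendsto_divide_0[OF tendsto_const]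
            filterlim_at_top_imp_at_infinity[OF blocks_at_top])
      moreover have "\<forall>\<^sub>F n in sequentially. 1 - 1 / real (n div r n) = real (n div r n - 1) / real (n div r n)"
        using eventually_compose_filterlim[OF eventually_ge_at_top[of 1] blocks_at_top]
        by eventually_elim (simp add: of_nat_diff field_simps)
      ultimately show ?thesis using Lim_transform_eventually by fastforce
    qed
    show "((\<lambda>(q, n). expectation (\<lambda>\<omega>. (\<Sum>i<q. W a b c n i \<omega>)\<^sup>2) / real q) \<longlongrightarrow> limit_var a b c) iter_seq"
    proof (rule Lim_transform_eventually[OF quadratic_limit[of a b c]])
      show "\<forall>\<^sub>F x in iter_seq. (case x of (q, n) \<Rightarrow> cov (\<lambda>\<omega>. a * T_dj q n \<omega> + b * T_sl q n \<omega> + c * T_exc q n \<omega>)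
          (\<lambda>\<omega>. a * T_dj q n \<omega> + b * T_sl q n \<omega> + c * T_exc q n \<omega>) / real q) =
        (case x of (q, n) \<Rightarrow> expectation (\<lambda>\<omega>. (\<Sum>i<q. W a b c n i \<omega>)\<^sup>2) / real q)"
        using eventually_iter_seq_snd[OF ev_pos]
      proof eventually_elim
        case (elim x)
        obtain q n where x: "x = (q, n)" by (cases x)
        let ?Y = "\<lambda>\<omega>. a * T_dj q n \<omega> + b * T_sl q n \<omega> + c * T_exc q n \<omega>"
        have Y: "sq_int ?Y" by (intro sq_int_add sq_int_cmult T_sq_int)
        have S: "sq_int (\<lambda>\<omega>. \<Sum>i<q. W a b c n i \<omega>)" by (intro sq_int_sum W_sq_int)
        have "expectation (\<lambda>\<omega>. \<Sum>i<q. W a b c n i \<omega>) = (\<Sum>i<q. expectation (W a b c n i))"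
          by (rule Bochner_Integration.integral_sum) (intro sq_int_integrable W_sq_int)
        also have "\<dots> = 0" using elim x by (simp add: expectation_W)
        finally have "expectation (\<lambda>\<omega>. (\<Sum>i<q. W a b c n i \<omega>)\<^sup>2) = cov (\<lambda>\<omega>. \<Sum>i<q. W a b c n i \<omega>) (\<lambda>\<omega>. \<Sum>i<q. W a b c n i \<omega>)"
          by (simp add: cov_def power2_eq_square)
        also have "\<dots> = cov ?Y ?Y"
          unfolding sum_W by (subst cov_diff_const_left[OF Y sq_int_diff[OF Y sq_int_const]], subst cov_diff_const_right[OF Y Y]) (rule refl)
        finally show ?case unfolding x by simp
      qed
    qed
  qed (use W_sq_int expectation_W rpos W_powr_integrable p_gt_1 W_stationary max_corr_nonneg blocks_at_top in auto)
qed

end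

section \<open>The three estimators\<close>

text \<open>
  The sliding average runs over \<open>Q\<close> window positions, between \<open>K\<close> and \<open>K + 1\<close> full blocks.  Neither the
  surplus positions nor the change of the denominator matter by more than \<open>1 / K\<close>.
\<close>
lemma average_boundary_bound:
  fixes y :: "nat \<Rightarrow> real"
  assumes y: "\<And>j. \<bar>y j\<bar> \<le> 1" and K: "K \<ge> 1" and r: "r \<ge> 1" and Q: "K * r \<le> Q" "Q \<le> (K + 1) * r"
  shows "\<bar>(\<Sum>j<Q. y j) / real Q - (\<Sum>j<K * r. y j) / (real (K + 1) * real r)\<bar> \<le> 2 / real K"
proof -
  have Kr: "0 < K * r" using K r by simp
  then have Q0: "Q > 0" using Q by linarith
  let ?S = "\<Sum>j<K * r. y j"
  have S: "\<bar>?S\<bar> \<le> real (K * r)"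
    using order_trans[OF sum_abs sum_mono[of "{..<K * r}" "\<lambda>j. \<bar>y j\<bar>" "\<lambda>_. 1"]] y by simp
  have R: "\<bar>\<Sum>j\<in>{K * r..<Q}. y j\<bar> \<le> real (Q - K * r)"
    using order_trans[OF sum_abs sum_mono[of "{K * r..<Q}" "\<lambda>j. \<bar>y j\<bar>" "\<lambda>_. 1"]] y by simp
  have split: "(\<Sum>j<Q. y j) = ?S + (\<Sum>j\<in>{K * r..<Q}. y j)"
    using sum.atLeastLessThan_concat[of 0 "K * r" Q y] Q by (simp add: lessThan_atLeast0)
  define k where "k = real (K + 1) * real r"
  have k: "k = real ((K + 1) * r)" "k \<ge> real Q" "k > 0"
    using Q Q0 unfolding k_def by (auto simp only: of_nat_mult[symmetric] of_nat_le_iff of_nat_0_less_iff)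
  have "(\<Sum>j<Q. y j) / real Q - ?S / k = ?S * (1 / real Q - 1 / k) + (\<Sum>j\<in>{K * r..<Q}. y j) / real Q"
    unfolding split by (simp add: add_divide_distrib right_diff_distrib)
  also have "\<bar>\<dots>\<bar> \<le> \<bar>?S\<bar> * \<bar>1 / real Q - 1 / k\<bar> + \<bar>\<Sum>j\<in>{K * r..<Q}. y j\<bar> / real Q"
    by (rule order_trans[OF abs_triangle_ineq]) (simp add: abs_mult)
  also have "\<dots> \<le> real Q * (1 / real Q - 1 / k) + real r / real Q"
  proof (intro add_mono mult_mono divide_right_mono)
    have "1 / k \<le> 1 / real Q" using k Q0 by (intro divide_left_mono) auto
    then show "\<bar>1 / real Q - 1 / k\<bar> \<le> 1 / real Q - 1 / k" by simp
    show "\<bar>?S\<bar> \<le> real Q" using S Q by linarith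
    have "Q - K * r \<le> r" using Q by simp
    then show "\<bar>\<Sum>j\<in>{K * r..<Q}. y j\<bar> \<le> real r" using R by linarith
  qed auto
  also have "real Q * (1 / real Q - 1 / k) = (k - real Q) / k"
    using Q0 k by (simp add: right_diff_distrib diff_divide_distrib)
  also have "(k - real Q) / k \<le> real r / real (K * r)"
  proof (rule frac_le)
    show "k - real Q \<le> real r"
    proof -
      have "(K + 1) * r \<le> Q + r" using Q by simp
      then have "real ((K + 1) * r) \<le> real (Q + r)" by (simp only: of_nat_le_iff)
      then show ?thesis using k by simp
    qed
    show "real (K * r) \<le> k" unfolding k(1) by (simp only: of_nat_le_iff) simp
    show "0 < real (K * r)" using Kr by (simp only: of_nat_0_less_iff)
  qed simp
  also have "real r / real Q \<le> real r / real (K * r)"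
    using Kr Q0 Q by (intro divide_left_mono mult_pos_pos) (simp_all only: of_nat_le_iff of_nat_0_less_iff of_nat_0_le_iff)
  also have "real r / real (K * r) + real r / real (K * r) = 2 / real K"
    using r by simp
  finally show ?thesis unfolding k_def by simp
qed

context block_asymptotics
begin

lemma F_dj_eq:
  assumes "r n \<ge> 1"
  shows "F_dj X n (r n) (un n) \<omega> = T_dj (n div r n) n \<omega> / real (n div r n)"
proof -
  have "(\<Sum>i = 1..n div r n. of_bool (block_max X ((i - 1) * r n) (i * r n) \<omega> \<le> un n)) =
      (\<Sum>i<n div r n. of_bool (block_max X (i * r n) (i * r n + r n) \<omega> \<le> un n) :: real)"
    unfolding image_Suc_lessThan[symmetric]
    by (subst sum.reindex) (simp_all add: add.commute)
  then show ?thesis unfolding F_dj_def T_dj_def by (simp only: block_max_le_iff[OF assms])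
qed

lemma F_sl_eq:
  assumes "r n \<ge> 1"
  shows "F_sl X n (r n) (un n) \<omega> = (\<Sum>j<n - r n + 1. clr (un n) j (j + r n) \<omega>) / real (n - r n + 1)"
proof -
  have "{0..n - r n} = {..<n - r n + 1}" by auto
  then show ?thesis unfolding F_sl_def by (simp only: block_max_le_iff[OF assms])
qed

lemma tau_hat_eq: "tau_hat X n (r n) (un n) \<omega> = T_exc (n div r n) n \<omega> / real (n div r n)"
proof -
  have "(\<Sum>i = 1..r n * (n div r n). of_bool (X i \<omega> > un n)) = (\<Sum>i\<in>{0..<n div r n * r n}. of_bool (X (Suc i) \<omega> > un n) :: real)"
    by (rule sum.reindex_bij_witness[of _ Suc "\<lambda>i. i - 1"]) (auto simp: mult.commute)
  then show ?thesis by (simp add: tau_hat_def T_exc_def hits_def exc_def)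
qed

lemma F_block_eq: "r n \<ge> 1 \<Longrightarrow> F_block M X (r n) (un n) = G n (r n)"
  unfolding F_block_def by (rule prob_block_max)

definition comb :: "real \<Rightarrow> real \<Rightarrow> real \<Rightarrow> nat \<Rightarrow> 'a \<Rightarrow> real" where
  "comb a b c n \<omega> = sqrt (real (n div r n)) *
    (a * (F_dj X n (r n) (un n) \<omega> - F_block M X (r n) (un n)) +
     b * (F_sl X n (r n) (un n) \<omega> - F_block M X (r n) (un n)) +
     c * (tau_hat X n (r n) (un n) \<omega> - tau_block M X (r n) (un n)))"

lemma comb_sq_int: "sq_int (comb a b c n)"
proof (cases "r n \<ge> 1")
  case True
  have S: "sq_int (\<lambda>\<omega>. (\<Sum>j<n - r n + 1. clr (un n) j (j + r n) \<omega>) / real (n - r n + 1))"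
    by (intro sq_int_divide sq_int_sum clr_sq_int)
  show ?thesis unfolding comb_def F_dj_eq[OF True] F_sl_eq[OF True] tau_hat_eq
    by (intro sq_int_cmult sq_int_add sq_int_diff sq_int_divide T_sq_int S sq_int_const)
next
  case False
  then have "comb a b c n = (\<lambda>\<omega>. 0)" by (auto simp: comb_def not_le)
  then show ?thesis by simp
qed

text \<open>
  The contributions of the first \<open>k - 1\<close> blocks differ from the estimators by the last disjoint block, by
  the last exceedance count, and by the boundary of the sliding average.
\<close>
lemma comb_minus_sum_W:
  assumes r: "r n \<ge> 1" and k: "n div r n \<ge> 2"
  defines "k \<equiv> n div r n"
  shows "\<bar>comb a b c n \<omega> - (\<Sum>i<k - 1. W a b c n i \<omega>) / sqrt (real k)\<bar> \<le>
    (\<bar>a\<bar> + 4 * \<bar>b\<bar> + \<bar>c\<bar> * (real (r n) * tbar n) + \<bar>c\<bar> * hit (un n) ((k - 1) * r n) ((k - 1) * r n + r n) \<omega>) / sqrt (real k)"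
proof -
  define K where "K = k - 1"
  have K: "k = K + 1" "K \<ge> 1" using k unfolding K_def k_def by auto
  let ?g = "G n (r n)" and ?s = "sqrt (real k)" and ?rt = "real (r n) * tbar n"
  let ?C = "clr (un n) (K * r n) (K * r n + r n) \<omega>" and ?H = "hit (un n) (K * r n) (K * r n + r n) \<omega>"
  define Q where "Q = n - r n + 1"
  define y where "y j = clr (un n) j (j + r n) \<omega> - ?g" for j
  define D where "D = (\<Sum>j<Q. y j) / real Q - (\<Sum>j<K * r n. y j) / (real (K + 1) * real (r n))"
  have s: "?s > 0" "?s * ?s = real k" using K by auto
  have T_dj: "T_dj k n \<omega> = T_dj K n \<omega> + ?C" unfolding T_dj_def K(1) by simp
  have T_exc: "T_exc k n \<omega> = T_exc K n \<omega> + ?H"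
    unfolding T_exc_def K(1) using hits_split[of 0 "K * r n" "K * r n + r n"] by (simp add: add.commute)
  have kr: "k * r n \<le> n" "n < k * r n + r n" unfolding k_def
    using dividend_less_div_times[of "r n" n] r by auto
  have Q: "K * r n \<le> Q" "Q \<le> (K + 1) * r n" "Q > 0" using kr r unfolding Q_def K(1) by auto
  have y1: "\<bar>y j\<bar> \<le> 1" for j
    unfolding y_def using clr_bounds[where u="un n" and a=j and b="j + r n" and \<omega>=\<omega>] no_exc_prob_bounds[of "un n" "r n"] by linarith
  have D: "\<bar>D\<bar> \<le> 2 / real K" unfolding D_def by (rule average_boundary_bound[OF y1 K(2) r Q(1,2)])
  have Fsl: "F_sl X n (r n) (un n) \<omega> - ?g = (\<Sum>j<Q. y j) / real Q"
  proof -
    have "(\<Sum>j<Q. y j) = (\<Sum>j<Q. clr (un n) j (j + r n) \<omega>) - real Q * ?g" by (simp add: y_def sum_subtractf)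
    then show ?thesis unfolding F_sl_eq[OF r] Q_def[symmetric] using Q(3) by (simp add: diff_divide_distrib)
  qed
  have T_sl: "(\<Sum>j<K * r n. y j) / (real (K + 1) * real (r n)) = (T_sl K n \<omega> - real K * ?g) / real k"
  proof -
    have "(\<Sum>j<K * r n. y j) = (\<Sum>j<K * r n. clr (un n) j (j + r n) \<omega>) - real (K * r n) * ?g" by (simp add: y_def sum_subtractf)
    then have "(\<Sum>j<K * r n. y j) / real (r n) = T_sl K n \<omega> - real K * ?g" unfolding T_sl_def using r by (simp add: diff_divide_distrib)
    then show ?thesis unfolding K(1) by (simp add: mult.commute flip: divide_divide_eq_left)
  qed
  have "comb a b c n \<omega> = ?s * (a * ((T_dj K n \<omega> + ?C) / real k - ?g) + b * (D + (T_sl K n \<omega> - real K * ?g) / real k) +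
      c * ((T_exc K n \<omega> + ?H) / real k - ?rt))"
    unfolding comb_def F_block_eq[OF r] F_dj_eq[OF r] tau_hat_eq Fsl k_def[symmetric] T_dj T_exc tau_block_def
    unfolding D_def T_sl diff_add_cancel by (simp only: mult_1)
  also have "\<dots> = (a * (T_dj K n \<omega> + ?C - real k * ?g) + b * (real k * D + (T_sl K n \<omega> - real K * ?g)) +
      c * (T_exc K n \<omega> + ?H - real k * ?rt)) / ?s"
  proof -
    have alg: "t * (a * (x / m - g) + b * (d + y / m) + c * (z / m - h)) =
        (a * (x - m * g) + b * (m * d + y) + c * (z - m * h)) / t"
      if t: "t > 0" "t * t = m" for t m x y z g h d :: real
    proof -
      have m: "m \<noteq> 0" using t by auto
      have e: "m * (a * (x / m - g) + b * (d + y / m) + c * (z / m - h)) =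
          a * (x - m * g) + b * (m * d + y) + c * (z - m * h)"
        using m by (simp add: field_simps)
      have "t * w = (m * w) / t" for w using t(1) by (simp add: t(2)[symmetric])
      from this[of "a * (x / m - g) + b * (d + y / m) + c * (z / m - h)"] show ?thesis unfolding e .
    qed
    show ?thesis by (rule alg[OF s])
  qed
  finally have Yeq: "comb a b c n \<omega> = (a * (T_dj K n \<omega> + ?C - real k * ?g) +
      b * (real k * D + (T_sl K n \<omega> - real K * ?g)) + c * (T_exc K n \<omega> + ?H - real k * ?rt)) / ?s" .
  have eq: "comb a b c n \<omega> - (\<Sum>i<k - 1. W a b c n i \<omega>) / ?s = (a * (?C - ?g) + b * (real k * D) + c * (?H - ?rt)) / ?s"
    unfolding Yeq K_def[symmetric] sum_W mean_W_def diff_divide_distrib[symmetric] K(1)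
    by (rule arg_cong2[where f="(/)", OF _ refl]) (simp add: algebra_simps)
  have "\<bar>a * (?C - ?g)\<bar> \<le> \<bar>a\<bar> * 1"
    unfolding abs_mult using y1[of "K * r n"] by (intro mult_left_mono) (auto simp: y_def)
  moreover have "\<bar>b * (real k * D)\<bar> \<le> \<bar>b\<bar> * 4"
  proof -
    have "\<bar>real k * D\<bar> \<le> real k * (2 / real K)" unfolding abs_mult using D by (intro mult_mono) auto
    also have "\<dots> \<le> 4" using K by (simp add: field_simps)
    finally show ?thesis unfolding abs_mult[of b] by (intro mult_left_mono) auto
  qed
  moreover have "\<bar>c * (?H - ?rt)\<bar> \<le> \<bar>c\<bar> * (?H + ?rt)"
    unfolding abs_mult using hit_nonneg[where u="un n" and a="K * r n" and b="K * r n + r n" and \<omega>=\<omega>] tail_bounds[of "un n"]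
    by (intro mult_left_mono) (auto simp: abs_le_iff add_increasing2)
  ultimately have "\<bar>a * (?C - ?g) + b * (real k * D) + c * (?H - ?rt)\<bar> \<le> \<bar>a\<bar> + 4 * \<bar>b\<bar> + \<bar>c\<bar> * ?rt + \<bar>c\<bar> * ?H"
    unfolding distrib_left by linarith
  then show ?thesis unfolding eq abs_divide using s(1) unfolding K_def[symmetric]
    by (simp add: divide_right_mono)
qed

lemma comb_char_tendsto: "(\<lambda>n. expectation (\<lambda>\<omega>. iexp (comb a b c n \<omega>))) \<longlonglongrightarrow> exp (- limit_var a b c / 2)"
proof -
  obtain C where C: "C \<ge> 0" "\<And>q. \<forall>\<^sub>F n in sequentially. sqrt (expectation (\<lambda>\<omega>. (hit (un n) 0 (q * r n) \<omega>)\<^sup>2)) \<le> real q * C"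
    using hit_L2_bound by blast
  let ?k = "\<lambda>n. n div r n"
  let ?Z = "\<lambda>n \<omega>. (\<Sum>i<?k n - 1. W a b c n i \<omega>) / sqrt (real (?k n))"
  define A where "A = \<bar>a\<bar> + 4 * \<bar>b\<bar> + \<bar>c\<bar> * (\<tau> + 1)"
  have A0: "A \<ge> 0" unfolding A_def using tau_pos by simp
  have "\<forall>\<^sub>F n in sequentially. real (r n) * tbar n < \<tau> + 1" by (rule order_tendstoD(2)[OF r_tbar]) simp
  then have bound: "\<forall>\<^sub>F n in sequentially. norm (expectation (\<lambda>\<omega>. iexp (comb a b c n \<omega>)) - expectation (\<lambda>\<omega>. iexp (?Z n \<omega>))) \<le>
      (A + \<bar>c\<bar> * C) / sqrt (real (?k n))"
    using C(2)[of 1] ev_pos ev_blocks_fit[of 2]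
  proof eventually_elim
    case (elim n)
    have "2 * r n div r n \<le> n div r n" using elim by (intro div_le_mono) auto
    then have k: "n div r n \<ge> 2" using elim by simp
    let ?h = "hit (un n) ((?k n - 1) * r n) ((?k n - 1) * r n + r n)"
    have Z: "sq_int (?Z n)" by (intro sq_int_divide sq_int_sum W_sq_int)
    have h: "sq_int (\<lambda>\<omega>. A)" "sq_int (\<lambda>\<omega>. \<bar>c\<bar> * ?h \<omega>)" by (intro sq_int_const sq_int_cmult hit_sq_int)+
    have "norm (expectation (\<lambda>\<omega>. iexp (comb a b c n \<omega>)) - expectation (\<lambda>\<omega>. iexp (?Z n \<omega>))) \<le>
        sqrt (expectation (\<lambda>\<omega>. (comb a b c n \<omega> - ?Z n \<omega>)\<^sup>2))"
      by (rule norm_expectation_iexp_diff_le[OF comb_sq_int Z])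
    also have "\<dots> \<le> sqrt (expectation (\<lambda>\<omega>. ((A + \<bar>c\<bar> * ?h \<omega>) / sqrt (real (?k n)))\<^sup>2))"
    proof (intro real_sqrt_le_mono integral_mono sq_int_square sq_int_diff comb_sq_int Z sq_int_divide sq_int_add h)
      fix \<omega>
      have "\<bar>comb a b c n \<omega> - ?Z n \<omega>\<bar> \<le> (\<bar>a\<bar> + 4 * \<bar>b\<bar> + \<bar>c\<bar> * (real (r n) * tbar n) + \<bar>c\<bar> * ?h \<omega>) / sqrt (real (?k n))"
        by (rule comb_minus_sum_W) (use elim k in auto)
      also have "\<dots> \<le> (A + \<bar>c\<bar> * ?h \<omega>) / sqrt (real (?k n))"
        unfolding A_def using elim by (intro divide_right_mono add_right_mono add_left_mono mult_left_mono) auto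
      finally show "(comb a b c n \<omega> - ?Z n \<omega>)\<^sup>2 \<le> ((A + \<bar>c\<bar> * ?h \<omega>) / sqrt (real (?k n)))\<^sup>2"
        by (rule order_trans[OF _ power_mono, where n1=2, rotated]) auto
    qed
    also have "\<dots> = sqrt (expectation (\<lambda>\<omega>. (A + \<bar>c\<bar> * ?h \<omega>)\<^sup>2)) / sqrt (real (?k n))"
      by (simp add: power_divide real_sqrt_divide)
    also have "\<dots> \<le> (sqrt (expectation (\<lambda>\<omega>. A\<^sup>2)) + sqrt (expectation (\<lambda>\<omega>. (\<bar>c\<bar> * ?h \<omega>)\<^sup>2))) / sqrt (real (?k n))"
      by (intro divide_right_mono L2_triangle h) auto
    also have "sqrt (expectation (\<lambda>\<omega>. A\<^sup>2)) = A" using A0 by (simp add: prob_space)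
    also have "sqrt (expectation (\<lambda>\<omega>. (\<bar>c\<bar> * ?h \<omega>)\<^sup>2)) = \<bar>c\<bar> * sqrt (expectation (\<lambda>\<omega>. (hit (un n) 0 (r n) \<omega>)\<^sup>2))"
      by (simp add: power_mult_distrib real_sqrt_mult expectation_hit_square)
    also have "(A + \<bar>c\<bar> * sqrt (expectation (\<lambda>\<omega>. (hit (un n) 0 (r n) \<omega>)\<^sup>2))) / sqrt (real (?k n)) \<le> (A + \<bar>c\<bar> * C) / sqrt (real (?k n))"
      using elim by (intro divide_right_mono add_left_mono mult_left_mono) auto
    finally show ?case .
  qed
  have "(\<lambda>n. (A + \<bar>c\<bar> * C) / sqrt (real (?k n))) \<longlonglongrightarrow> 0"
    by (rule tendsto_divide_0[OF tendsto_const filterlim_at_top_imp_at_infinity[OF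
          filterlim_compose[OF sqrt_at_top blocks_at_top]]])
  from Lim_null_comparison[OF bound this] W_clt[of a b c]
  have "(\<lambda>n. (expectation (\<lambda>\<omega>. iexp (comb a b c n \<omega>)) - expectation (\<lambda>\<omega>. iexp (?Z n \<omega>))) + expectation (\<lambda>\<omega>. iexp (?Z n \<omega>)))
      \<longlonglongrightarrow> 0 + complex_of_real (exp (- limit_var a b c / 2))"
    by (rule tendsto_add)
  then show ?thesis by simp
qed

theorem estimators_converge:
  "\<exists>L :: (real^3) measure. multivariate_normal 0 (limit_cov \<tau> \<theta> m2) L \<and>
     converges_in_distribution M
       (\<lambda>n \<omega>. sqrt (real (n div r n)) *\<^sub>R
          (vector [F_dj X n (r n) (un n) \<omega> - F_block M X (r n) (un n),
                   F_sl X n (r n) (un n) \<omega> - F_block M X (r n) (un n),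
                   tau_hat X n (r n) (un n) \<omega> - tau_block M X (r n) (un n)] :: real^3)) L"
proof -
  let ?S = "limit_cov \<tau> \<theta> m2"
  let ?Z = "\<lambda>n \<omega>. sqrt (real (n div r n)) *\<^sub>R
          (vector [F_dj X n (r n) (un n) \<omega> - F_block M X (r n) (un n),
                   F_sl X n (r n) (un n) \<omega> - F_block M X (r n) (un n),
                   tau_hat X n (r n) (un n) \<omega> - tau_block M X (r n) (un n)] :: real^3)"
  have S: "?S = vector [vector [wcov 0, \<gamma>, - \<tau> * exp (- \<alpha>)], vector [\<gamma>, \<gamma>, - \<tau> * exp (- \<alpha>)],
      vector [- \<tau> * exp (- \<alpha>), - \<tau> * exp (- \<alpha>), \<alpha> * m2]]"
    unfolding limit_cov_def Let_def wcov_0 \<gamma>_def \<alpha>_def ..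
  have psd: "wcov 0 * x\<^sup>2 + \<gamma> * y\<^sup>2 + \<alpha> * m2 * z\<^sup>2 + 2 * \<gamma> * x * y + 2 * (- \<tau> * exp (- \<alpha>)) * x * z
      + 2 * (- \<tau> * exp (- \<alpha>)) * y * z \<ge> 0" for x y z
    using limit_var_nonneg[of x y z] by (simp add: limit_var_def algebra_simps)
  obtain A :: "real^3^3" where A: "A ** transpose A = ?S"
    unfolding S using psd3_factor[OF psd] by blast
  have form: "v \<bullet> (?S *v v) = limit_var (v $ 1) (v $ 2) (v $ 3)" for v :: "real^3"
    unfolding S limit_var_def
    by (simp add: inner_vec_def matrix_vector_mult_def sum_3 vector_3 algebra_simps power2_eq_square)
  define L where "L = distr (std_gaussian :: (real^3) measure) borel (\<lambda>z. 0 + A *v z)"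
  have Am: "(\<lambda>z. A *v z) \<in> borel_measurable borel"
    by (intro borel_measurable_continuous_onI linear_continuous_on linear_linear[THEN iffD2] matrix_vector_mul_linear)
  have "converges_in_distribution M ?Z L"
  proof (rule multivariate_levy_continuity)
    show "prob_space M" by unfold_locales
    show "prob_space L" unfolding L_def
      by (rule prob_space.prob_space_distr[OF prob_space_std_gaussian]) (use Am in simp)
    show "sets L = sets borel" by (simp add: L_def)
    have Yv: "v \<bullet> ?Z n \<omega> = comb (v $ 1) (v $ 2) (v $ 3) n \<omega>" for v n \<omega>
      by (simp add: comb_def inner_vec_def sum_3 vector_3 algebra_simps)
    show "?Z n \<in> borel_measurable M" for n
    proof (rule borel_measurable_euclidean_space[THEN iffD2], rule ballI)
      fix v :: "real^3"
      show "(\<lambda>\<omega>. ?Z n \<omega> \<bullet> v) \<in> borel_measurable M"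
        unfolding inner_commute[of _ v] Yv by (rule sq_int_measurable[OF comb_sq_int])
    qed
    show "(\<lambda>n. expectation (\<lambda>\<omega>. iexp (v \<bullet> ?Z n \<omega>))) \<longlonglongrightarrow> (\<integral>x. iexp (v \<bullet> x) \<partial>L)" for v
    proof -
      have "(\<integral>x. iexp (v \<bullet> x) \<partial>L) = exp (- limit_var (v $ 1) (v $ 2) (v $ 3) / 2)"
        unfolding L_def using char_linear_image_std_gaussian[of A v] by (simp add: A form)
      then show ?thesis unfolding Yv using comb_char_tendsto by simp
    qed
  qed
  moreover have "multivariate_normal 0 ?S L"
    unfolding multivariate_normal_def L_def using A by blast
  ultimately show ?thesis by blast
qed

end

section \<open>Asymptotic normality\<close>

theorem theorem4p2:
  fixes M :: "'a measure"
    and X :: "nat \<Rightarrow> 'a \<Rightarrow> real"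
    and \<theta> \<tau> p :: real
    and u :: "nat \<Rightarrow> real"
    and r l s :: "nat \<Rightarrow> nat"
    and \<pi> :: "nat pmf"
  assumes "prob_space M"
    and "\<And>i. i \<ge> 1 \<Longrightarrow> X i \<in> borel_measurable M"
    and "strictly_stationary M X"
    and "has_extremal_index M X \<theta>"
    and "\<tau> > 0"
    and "(\<lambda>k. real k * tail M X (u k)) \<longlonglongrightarrow> \<tau>"
    and "\<And>n. n \<ge> 1 \<Longrightarrow> r n > 0"
    and "\<And>n. n \<ge> 1 \<Longrightarrow> l n > 0"
    and "(\<lambda>n. real (l n)) \<in> o(\<lambda>n. real (r n))"
    and "(\<lambda>n. real (r n)) \<in> o(\<lambda>n. real n)"
    and "(\<lambda>n. \<Sum>k = l n..n. max_corr M X n k (u (r n))) \<in> o(\<lambda>n. real (r n))"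
    and "(\<lambda>n. \<Sum>k = 1..n. max_corr M X n k (u (r n))) \<in> o(\<lambda>n. sqrt (real (r n)))"
    and "\<And>n. n \<ge> 1 \<Longrightarrow> s n > 0"
    and "set_pmf \<pi> \<subseteq> {1..}"
    and "(\<lambda>n. real (l n)) \<in> o(\<lambda>n. real (s n))"
    and "(\<lambda>n. real (s n)) \<in> o(\<lambda>n. real (r n))"
    and "(\<lambda>n. max_corr M X n (l n) (u (r n))) \<in> o(\<lambda>n. real (s n) / real n)"
    and "\<And>j. j \<ge> 1 \<Longrightarrow>
           (\<lambda>n. \<P>(\<omega> in M. N_exc X (s n) (u (r n)) \<omega> = j
                           \<bar> block_max X 0 (s n) \<omega> > u (r n))) \<longlonglongrightarrow> pmf \<pi> j"
    and "summable (\<lambda>j. (real j)\<^sup>2 * pmf \<pi> j)"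
    and "(\<lambda>n. cond_expectation_on M (\<lambda>\<omega>. (real (N_exc X (s n) (u (r n)) \<omega>))\<^sup>2)
                 (\<lambda>\<omega>. block_max X 0 (s n) \<omega> > u (r n)))
           \<longlonglongrightarrow> (\<Sum>j. (real j)\<^sup>2 * pmf \<pi> j)"
    and "p > 1"
    and "(\<lambda>n. prob_space.expectation M
                 (\<lambda>\<omega>. real (N_exc X (r n) (u (r n)) \<omega>) powr (2 * p))) \<in> O(\<lambda>_. 1)"
  shows "\<exists>L :: (real^3) measure.
           multivariate_normal 0 (limit_cov \<tau> \<theta> (\<Sum>j. (real j)\<^sup>2 * pmf \<pi> j)) L \<and>
           converges_in_distribution M
             (\<lambda>n \<omega>. sqrt (real (n div r n)) *\<^sub>R
                (vector [F_dj X n (r n) (u (r n)) \<omega> - F_block M X (r n) (u (r n)),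
                         F_sl X n (r n) (u (r n)) \<omega> - F_block M X (r n) (u (r n)),
                         tau_hat X n (r n) (u (r n)) \<omega> - tau_block M X (r n) (u (r n))] :: real^3))
             L"
proof -
  interpret prob_space M by fact
  interpret block_asymptotics M X \<theta> \<tau> "\<Sum>j. (real j)\<^sup>2 * pmf \<pi> j" p u r l s
    by unfold_locales (fact assms)+
  show ?thesis by (rule estimators_converge)
qed

end
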